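(* Let $\mu$ and $\mu_n$, $n \in \mathbb{N}$, be s-graphons. Then the following conditions are equivalent: (1) for every $k \in \mathbb{N}$, $\lim_{n\rightarrow\infty} C(\mu_n,k) = C(\mu,k)$ in the Vietoris topology on the hyperspace of compact subsets of $\mathbb{M}_k$; (2) $\lim_{n\rightarrow\infty} C(\mu_n) = C(\mu)$ in the Vietoris topology on the hyperspace of compact subsets of $\mathfrak{sG}$.
   Context: $\mathbb{N}=\{1,2,\ldots\}$. $\lambda$ is Lebesgue measure on $[0,1]$ and $\lambda^2$ is Lebesgue measure on $[0,1]^2$. $\mathbb{M}_k$ is the space of real $k\times k$ matrices with the topology of $\mathbb{R}^{k\times k}$. An s-graphon is a symmetric Borel probability measure on $[0,1]^2$ (invariant under $(x,y)\mapsto(y,x)$). $\mathfrak{sG}$ is the space of all s-graphons with the weak topology inherited from the space of Borel probability measures on $[0,1]^2$ (convergence of integrals of continuous functions); it is compact and metrizable. Fairly distributed functions: $\mathcal{FD}$ is the set of non-negative bounded Borel functions $f\colon[0,1]^2\to[0,\infty)$ such that for all $x,y\in[0,1]$, $\int_{[0,1]} f(x,v)\,d\lambda(v)=\int_{[0,1]} f(u,y)\,d\lambda(u)=1$. $\mathcal{FDC}$ is the set of continuous functions in $\mathcal{FD}$. For $f\in\mathcal{FD}$ and $\mu\in\mathfrak{sG}$ put $\varphi(f,\mu)(u,v)=\int_{[0,1]^2} f(x,u)f(y,v)\,d\mu(x,y)$ for $u,v\in[0,1]$, and let $\Phi(f,\mu)$ be the measure on $[0,1]^2$ with density $\varphi(f,\mu)$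 with respect to $\lambda^2$; it is an s-graphon. Shape: $C(\mu)=\overline{\{\Phi(f,\mu)\colon f\in\mathcal{FDC}\}}\subseteq\mathfrak{sG}$, closure in the weak topology; it is a compact subset of $\mathfrak{sG}$. $k$-shape: for $k\in\mathbb{N}$, $C(\mu,k)\subseteq\mathbb{M}_k$ is the closure in $\mathbb{M}_k$ of the set of all matrices $\left(\int_{[0,1]^2} f_i(x)f_j(y)\,d\mu(x,y)\right)_{i,j=1}^k$, where $f_1,\ldots,f_k$ are non-negative Borel functions on $[0,1]$ with $f_1+\cdots+f_k\equiv 1$ and $\int_{[0,1]} f_i\,d\lambda=1/k$ for each $i$; it is compact. The Vietoris topology on the hyperspace of compact subsets of a metrizable space is the one induced (on nonempty compact sets) by the Hausdorff distance of any compatible metric. *)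

theory Defs
  imports "HOL-Probability.Probability"
begin

abbreviation unit_interval :: "real set" where
  "unit_interval \<equiv> {0..1}"

abbreviation unit_square :: "(real \<times> real) set" where
  "unit_square \<equiv> {0..1} \<times> {0..1}"

definition leb1 :: "real measure" where
  "leb1 = restrict_space lborel unit_interval"

definition leb2 :: "(real \<times> real) measure" where
  "leb2 = restrict_space lborel unit_square"

definition prob_measures_square :: "(real \<times> real) measure set" where
  "prob_measures_square =
    {\<mu>. prob_space \<mu> \<and> sets \<mu> = sets (restrict_space borel unit_square)}"

text \<open>The coarsest topology on the Borel probability measures on the unit square for which
  integration of every continuous function on the square is continuous.\<close>

definition weak_topology :: "(real \<times> real) measure topology" where
  "weak_topology = topology_generated_by
    {{\<mu> \<in> prob_measures_square. (LINT z|\<mu>. g z) \<in> U} | (g :: real \<times> real \<Rightarrow> real) U.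
      continuous_on unit_square g \<and> open U}"

definition s_graphons :: "(real \<times> real) measure set" where
  "s_graphons = {\<mu> \<in> prob_measures_square. distr \<mu> \<mu> prod.swap = \<mu>}"

definition s_graphon_topology :: "(real \<times> real) measure topology" where
  "s_graphon_topology = subtopology weak_topology s_graphons"

text \<open>Functions on the unit square are total functions on the plane; only their values on the
  square matter.\<close>

definition FD :: "(real \<times> real \<Rightarrow> real) set" where
  "FD = {f. f \<in> borel_measurable (restrict_space borel unit_square) \<and>
            (\<forall>z\<in>unit_square. 0 \<le> f z) \<and> bounded (f ` unit_square) \<and>
            (\<forall>x\<in>unit_interval. (LINT v|leb1. f (x, v)) = 1) \<and>
            (\<forall>y\<in>unit_interval. (LINT u|leb1. f (u, y)) = 1)}"

definition FDC :: "(real \<times> real \<Rightarrow> real) set" where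
  "FDC = {f \<in> FD. continuous_on unit_square f}"

definition phi :: "(real \<times> real \<Rightarrow> real) \<Rightarrow> (real \<times> real) measure \<Rightarrow> real \<times> real \<Rightarrow> real" where
  "phi f \<mu> = (\<lambda>(u, v). LINT (x, y)|\<mu>. f (x, u) * f (y, v))"

definition Phi ::
  "(real \<times> real \<Rightarrow> real) \<Rightarrow> (real \<times> real) measure \<Rightarrow> (real \<times> real) measure" where
  "Phi f \<mu> = density leb2 (\<lambda>z. ennreal (phi f \<mu> z))"

definition shape :: "(real \<times> real) measure \<Rightarrow> (real \<times> real) measure set" where
  "shape \<mu> = s_graphon_topology closure_of {Phi f \<mu> | f. f \<in> FDC}"

text \<open>Real \<open>k \<times> k\<close> matrices are functions on \<open>{1..k} \<times> {1..k}\<close>, extended by \<^const>\<open>undefined\<close>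
  outside this index set, with the product topology.\<close>

abbreviation matrix_topology :: "nat \<Rightarrow> (nat \<times> nat \<Rightarrow> real) topology" where
  "matrix_topology k \<equiv> powertop_real ({1..k} \<times> {1..k})"

definition fair_partitions :: "nat \<Rightarrow> (nat \<Rightarrow> real \<Rightarrow> real) set" where
  "fair_partitions k =
    {f. (\<forall>i\<in>{1..k}. f i \<in> borel_measurable (restrict_space borel unit_interval) \<and>
                    (\<forall>x\<in>unit_interval. 0 \<le> f i x) \<and>
                    (LINT x|leb1. f i x) = 1 / real k) \<and>
        (\<forall>x\<in>unit_interval. (\<Sum>i=1..k. f i x) = 1)}"

definition quotient_matrix ::
  "nat \<Rightarrow> (nat \<Rightarrow> real \<Rightarrow> real) \<Rightarrow> (real \<times> real) measure \<Rightarrow> nat \<times> nat \<Rightarrow> real" where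
  "quotient_matrix k f \<mu> =
    (\<lambda>(i, j) \<in> {1..k} \<times> {1..k}. LINT (x, y)|\<mu>. f i x * f j y)"

definition k_shape :: "(real \<times> real) measure \<Rightarrow> nat \<Rightarrow> (nat \<times> nat \<Rightarrow> real) set" where
  "k_shape \<mu> k =
    matrix_topology k closure_of {quotient_matrix k f \<mu> | f. f \<in> fair_partitions k}"

text \<open>The hyperspace of all compact subsets of \<open>X\<close>, with the subbase of the ``miss'' sets
  \<open>{K. K \<subseteq> U}\<close> and the ``hit'' sets \<open>{K. K \<inter> U \<noteq> {}}\<close> for \<open>U\<close> open. The empty set is
  an isolated point of it. Lemma \<open>limitin_vietoris_iff_Hausdorff\<close> below shows that on
  nonempty compact sets the convergence is the one of the Hausdorff distance of any
  compatible metric.\<close>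

definition vietoris :: "'a topology \<Rightarrow> 'a set topology" where
  "vietoris X = topology_generated_by
    ({{K. compactin X K \<and> K \<subseteq> U} | U. openin X U} \<union>
     {{K. compactin X K \<and> K \<inter> U \<noteq> {}} | U. openin X U})"

lemma topspace_vietoris: "topspace (vietoris X) = {K. compactin X K}"
proof
  show "{K. compactin X K} \<subseteq> topspace (vietoris X)"
    unfolding vietoris_def topology_generated_by_topspace
    using compactin_subset_topspace[of X] openin_topspace[of X] by blast
qed (auto simp: vietoris_def)

lemma limitin_topology_generated_by:
  "limitin (topology_generated_by \<S>) f l F \<longleftrightarrow>
     l \<in> \<Union>\<S> \<and> (\<forall>S\<in>\<S>. l \<in> S \<longrightarrow> (\<forall>\<^sub>F x in F. f x \<in> S))"
  (is "?L \<longleftrightarrow> ?R")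
proof
  assume ?L
  then show ?R
    by (auto simp: limitin_def topology_generated_by_Basis)
next
  assume R: ?R
  have "l \<in> U \<longrightarrow> (\<forall>\<^sub>F x in F. f x \<in> U)" if "generate_topology_on \<S> U" for U
    using that
  proof induction
    case (UN K)
    show ?case
    proof
      assume "l \<in> \<Union>K"
      then obtain k where "k \<in> K" "l \<in> k" by blast
      with UN have "\<forall>\<^sub>F x in F. f x \<in> k" by blast
      then show "\<forall>\<^sub>F x in F. f x \<in> \<Union>K"
        by (rule eventually_mono) (use \<open>k \<in> K\<close> in blast)
    qed
  qed (use R in \<open>auto intro: eventually_conj\<close>)
  with R show ?L
    by (auto simp: limitin_def openin_topology_generated_by_iff)
qed

lemma (in Metric_space) limitin_vietoris_iff_Hausdorff:
  assumes K: "compactin mtopology K" "K \<noteq> {}"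
    and Ks: "\<And>n. compactin mtopology (Ks n)" "\<And>n. Ks n \<noteq> {}"
  shows "limitin (vietoris mtopology) Ks K F \<longleftrightarrow>
    (\<forall>\<epsilon>>0. \<forall>\<^sub>F n in F. (\<forall>x\<in>Ks n. \<exists>y\<in>K. d x y < \<epsilon>) \<and> (\<forall>y\<in>K. \<exists>x\<in>Ks n. d x y < \<epsilon>))"
  (is "?L \<longleftrightarrow> ?R")
proof -
  have KM: "K \<subseteq> M" and KsM: "\<And>n. Ks n \<subseteq> M"
    using K Ks compactin_subset_topspace by fastforce+
  have lim: "?L \<longleftrightarrow>
      (\<forall>U. openin mtopology U \<and> K \<subseteq> U \<longrightarrow> (\<forall>\<^sub>F n in F. Ks n \<subseteq> U)) \<and>
      (\<forall>U. openin mtopology U \<and> K \<inter> U \<noteq> {} \<longrightarrow> (\<forall>\<^sub>F n in F. Ks n \<inter> U \<noteq> {}))"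
  proof -
    have "K \<in> topspace (vietoris mtopology)"
      by (simp add: topspace_vietoris K)
    then have top: "K \<in> \<Union> ({{C. compactin mtopology C \<and> C \<subseteq> U} | U. openin mtopology U} \<union>
        {{C. compactin mtopology C \<and> C \<inter> U \<noteq> {}} | U. openin mtopology U})"
      by (simp only: vietoris_def topology_generated_by_topspace)
    have eq: "(\<forall>S \<in> {P U | U. openin mtopology U} \<union> {Q U | U. openin mtopology U}. R S) \<longleftrightarrow>
        (\<forall>U. openin mtopology U \<longrightarrow> R (P U)) \<and> (\<forall>U. openin mtopology U \<longrightarrow> R (Q U))"
      for P Q :: "'a set \<Rightarrow> 'a set set" and R
      by blast
    show ?thesis
      unfolding vietoris_def limitin_topology_generated_by eq
      using top K(1) Ks(1) by (simp add: imp_conjL)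
  qed
  have fin: "\<exists>T. finite T \<and> T \<subseteq> K \<and> K \<subseteq> (\<Union>y\<in>T. mball y (r y))"
    if r: "\<And>y. y \<in> K \<Longrightarrow> 0 < r y" for r
  proof -
    have "\<exists>\<F>. finite \<F> \<and> \<F> \<subseteq> (\<lambda>y. mball y (r y)) ` K \<and> K \<subseteq> \<Union>\<F>"
    proof (rule compactinD[OF K(1)])
      show "K \<subseteq> \<Union> ((\<lambda>y. mball y (r y)) ` K)"
        using KM r by auto
    qed auto
    then obtain \<F> where \<F>: "finite \<F>" "\<F> \<subseteq> (\<lambda>y. mball y (r y)) ` K" "K \<subseteq> \<Union>\<F>"
      by blast
    from finite_subset_image[OF this(1,2)] obtain T
      where "T \<subseteq> K" "finite T" "\<F> = (\<lambda>y. mball y (r y)) ` T"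
      by blast
    with \<F>(3) show ?thesis
      by (intro exI[of _ T]) simp
  qed
  show ?thesis
  proof
    assume ?L
    show ?R
    proof (intro allI impI eventually_conj)
      fix \<epsilon> :: real assume "\<epsilon> > 0"
      have "openin mtopology (\<Union>y\<in>K. mball y \<epsilon>)" "K \<subseteq> (\<Union>y\<in>K. mball y \<epsilon>)"
        using KM \<open>\<epsilon> > 0\<close> by auto
      then have "\<forall>\<^sub>F n in F. Ks n \<subseteq> (\<Union>y\<in>K. mball y \<epsilon>)"
        using \<open>?L\<close> lim by blast
      then show "\<forall>\<^sub>F n in F. \<forall>x\<in>Ks n. \<exists>y\<in>K. d x y < \<epsilon>"
        by (rule eventually_mono) (use commute in fastforce)
      obtain T where T: "finite T" "T \<subseteq> K" "K \<subseteq> (\<Union>y\<in>T. mball y (\<epsilon>/2))"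
        using fin[of "\<lambda>_. \<epsilon>/2"] \<open>\<epsilon> > 0\<close> by auto
      have "\<forall>\<^sub>F n in F. Ks n \<inter> mball t (\<epsilon>/2) \<noteq> {}" if "t \<in> T" for t
      proof -
        have "t \<in> K \<inter> mball t (\<epsilon>/2)"
          using that T KM \<open>\<epsilon> > 0\<close> by auto
        then show ?thesis
          using \<open>?L\<close> lim openin_mball by blast
      qed
      then have "\<forall>\<^sub>F n in F. \<forall>t\<in>T. Ks n \<inter> mball t (\<epsilon>/2) \<noteq> {}"
        by (simp add: eventually_ball_finite T)
      then show "\<forall>\<^sub>F n in F. \<forall>y\<in>K. \<exists>x\<in>Ks n. d x y < \<epsilon>"
      proof (rule eventually_mono, intro ballI)
        fix n y assume h: "\<forall>t\<in>T. Ks n \<inter> mball t (\<epsilon>/2) \<noteq> {}" and y: "y \<in> K"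
        obtain t where t: "t \<in> T" "y \<in> mball t (\<epsilon>/2)" using T y by blast
        then obtain x where x: "x \<in> Ks n" "x \<in> mball t (\<epsilon>/2)" using h by blast
        have "d x y \<le> d t x + d t y"
          using t x triangle[of x t y] commute[of x t] by auto
        then show "\<exists>x\<in>Ks n. d x y < \<epsilon>"
          using t x by (intro bexI[of _ x]) auto
      qed
    qed
  next
    assume R: ?R
    show ?L
      unfolding lim
    proof (intro conjI allI impI; elim conjE)
      fix U assume U: "openin mtopology U" "K \<subseteq> U"
      then have "\<forall>y\<in>K. \<exists>r>0. mball y r \<subseteq> U"
        by (meson openin_mtopology subsetD)
      then obtain r where r: "\<And>y. y \<in> K \<Longrightarrow> 0 < r y \<and> mball y (r y) \<subseteq> U"
        by metis
      obtain T where T: "finite T" "T \<subseteq> K" "K \<subseteq> (\<Union>y\<in>T. mball y (r y / 2))"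
        using fin[of "\<lambda>y. r y / 2"] r by auto
      have "T \<noteq> {}" using T K(2) by auto
      define \<epsilon> where "\<epsilon> = Min ((\<lambda>y. r y / 2) ` T)"
      have "\<epsilon> > 0" unfolding \<epsilon>_def
        using T r \<open>T \<noteq> {}\<close> by (subst Min_gr_iff) auto
      have \<epsilon>: "\<epsilon> \<le> r t / 2" if "t \<in> T" for t
        unfolding \<epsilon>_def using that T(1) by (intro Min_le) auto
      show "\<forall>\<^sub>F n in F. Ks n \<subseteq> U"
        using R[rule_format, OF \<open>\<epsilon> > 0\<close>]
      proof (rule eventually_mono, intro subsetI)
        fix n x
        assume "(\<forall>x\<in>Ks n. \<exists>y\<in>K. d x y < \<epsilon>) \<and> (\<forall>y\<in>K. \<exists>x\<in>Ks n. d x y < \<epsilon>)" and x: "x \<in> Ks n"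
        then obtain y where y: "y \<in> K" "d x y < \<epsilon>" by blast
        then obtain t where t: "t \<in> T" "y \<in> mball t (r t / 2)" using T by blast
        have "x \<in> M" using x KsM by blast
        then have "d t x \<le> d t y + d x y"
          using t triangle[of t y x] commute[of x y] by auto
        then have "x \<in> mball t (r t)"
          using t y \<epsilon>[OF t(1)] \<open>x \<in> M\<close> by auto
        then show "x \<in> U" using r t T by blast
      qed
    next
      fix U assume U: "openin mtopology U" "K \<inter> U \<noteq> {}"
      then obtain y where y: "y \<in> K" "y \<in> U" by blast
      then obtain r where r: "r > 0" "mball y r \<subseteq> U"
        using U openin_mtopology by metis
      show "\<forall>\<^sub>F n in F. Ks n \<inter> U \<noteq> {}"
        using R[rule_format, OF r(1)]
      proof (rule eventually_mono)
        fix n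
        assume "(\<forall>x\<in>Ks n. \<exists>y\<in>K. d x y < r) \<and> (\<forall>y\<in>K. \<exists>x\<in>Ks n. d x y < r)"
        then obtain x where x: "x \<in> Ks n" "d x y < r" using y by blast
        then have "x \<in> mball y r"
          using KM KsM y commute[of x y] by auto
        then show "Ks n \<inter> U \<noteq> {}" using x r by blast
      qed
    qed
  qed
qed

end

theory Submission
  imports Defs
begin

text \<open>Fix a continuous fair partition \<open>p\<^sub>1, \<dots>, p\<^sub>k\<close> of unity on \<open>[0,1]\<close>. An element
  \<open>f\<close> of \<open>FDC\<close> averages to the fair partition \<open>\<integral>f(x,u) p\<^sub>i(u) du\<close>, whose quotient matrix
  is the matrix of integrals of \<open>p\<^sub>i \<otimes> p\<^sub>j\<close> against \<open>\<Phi>(f,\<mu>)\<close>. Conversely a continuous fair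
  partition \<open>f\<^sub>1, \<dots>, f\<^sub>k\<close> gives the kernel \<open>k \<Sum>\<^sub>i f\<^sub>i(x) p\<^sub>i(u)\<close> in \<open>FDC\<close>, and the integral of
  \<open>g\<close> against the resulting measure is a linear functional of the quotient matrix of \<open>f\<close>.
  If the \<open>p\<^sub>i\<close> have small supports, the two passages are nearly inverse on measures, uniformly
  in \<open>\<mu>\<close>, so convergence of the \<open>k\<close>-shapes forces convergence of the shapes. If the \<open>p\<^sub>i\<close> are
  \<open>L\<^sup>1\<close>-close to indicators, they are nearly inverse on \<open>k \<times> k\<close> matrices, which gives the other
  direction. Fair partitions are approximated by continuous ones in \<open>L\<^sup>1\<close> of Lebesgue measure
  and of both marginals of \<open>\<mu>\<close> simultaneously.

  Points of the Vietoris space are compact sets, so compactness of the space of s-graphons is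
  needed as well. It follows from Helly's theorem on the line, transferred to the square
  through a space-filling curve and a Borel section of it.\<close>


section \<open>Topologies generated by real functions and the Vietoris topology\<close>

text \<open>Both topologies are initial for a family of real functions: integrals of continuous
  functions, or matrix entries. Hausdorff closeness then means closeness in finitely many of them,
  and s-graphons need no metric.

  All shapes along the sequence are compared with one limit shape, so the estimates must not depend
  on the measure. They do not, because partition functions sum to 1 and a quotient matrix has
  nonnegative entries of sum 1: an error \<eta> in every coefficient costs only \<eta> in the
  result.

  The obstacle is continuity. A shape is built from continuous kernels, while \<mu> may be singular,
  so indicators of intervals cannot serve as the \<open>p\<close>. Trapezoids with transitions of
  width \<open>d\<close> replace them: \<open>d = 1/k\<close> gives supports of length
  \<open>2/k\<close>, and \<open>d\<close> of order \<open>\<epsilon>/k\<close> makes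
  \<open>k\<close> times their Gram matrix nearly the identity. Making a fair partition continuous
  is delicate for a similar reason: it must keep every mean exactly \<open>1/k\<close> while being
  close for marginals unrelated to Lebesgue measure. Hence the means are repaired at the end, by
  shrinking slightly and adding constants.\<close>

definition initial_topology :: "'a topology \<Rightarrow> ('i \<Rightarrow> 'a \<Rightarrow> real) \<Rightarrow> 'i set \<Rightarrow> bool" where
  "initial_topology X F I \<longleftrightarrow> (\<forall>U. openin X U \<longleftrightarrow> U \<subseteq> topspace X \<and>
     (\<forall>x\<in>U. \<exists>G \<epsilon>. finite G \<and> G \<subseteq> I \<and> \<epsilon> > 0 \<and>
        (\<forall>y\<in>topspace X. (\<forall>i\<in>G. \<bar>F i y - F i x\<bar> < \<epsilon>) \<longrightarrow> y \<in> U)))"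

lemma initial_topology_nhd:
  assumes "initial_topology X F I" "openin X U" "x \<in> U"
  obtains G \<epsilon> where "finite G" "G \<subseteq> I" "\<epsilon> > 0"
    "\<And>y. y \<in> topspace X \<Longrightarrow> (\<forall>i\<in>G. \<bar>F i y - F i x\<bar> < \<epsilon>) \<Longrightarrow> y \<in> U"
proof -
  have "\<exists>G \<epsilon>. finite G \<and> G \<subseteq> I \<and> \<epsilon> > 0 \<and>
        (\<forall>y\<in>topspace X. (\<forall>i\<in>G. \<bar>F i y - F i x\<bar> < \<epsilon>) \<longrightarrow> y \<in> U)"
    using assms unfolding initial_topology_def by blast
  then show thesis
    using that by blast
qed

lemma initial_topology_openin_ball:
  assumes X: "initial_topology X F I" and G: "finite G" "G \<subseteq> I"
  shows "openin X {y \<in> topspace X. \<forall>i\<in>G. \<bar>F i y - F i x\<bar> < \<epsilon>}" (is "openin X ?B")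
proof -
  have "\<exists>G' \<delta>. finite G' \<and> G' \<subseteq> I \<and> \<delta> > 0 \<and>
      (\<forall>z\<in>topspace X. (\<forall>i\<in>G'. \<bar>F i z - F i y\<bar> < \<delta>) \<longrightarrow> z \<in> ?B)" if y: "y \<in> ?B" for y
  proof -
    \<comment> \<open>The smallest margin still left at \<open>y\<close>. The inserted 1 keeps the
      minimum meaningful when \<open>G\<close> is empty.\<close>
    define \<delta> where "\<delta> = Min (insert 1 ((\<lambda>i. \<epsilon> - \<bar>F i y - F i x\<bar>) ` G))"
    have "\<delta> > 0"
      using y G by (auto simp: \<delta>_def)
    moreover have \<delta>: "\<delta> \<le> \<epsilon> - \<bar>F i y - F i x\<bar>" if "i \<in> G" for i
      unfolding \<delta>_def using that G by (intro Min_le) auto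
    have "z \<in> ?B" if "z \<in> topspace X" and z: "\<forall>i\<in>G. \<bar>F i z - F i y\<bar> < \<delta>" for z
    proof -
      have "\<bar>F i z - F i x\<bar> < \<epsilon>" if "i \<in> G" for i
        using z[rule_format, OF that] \<delta>[OF that] by linarith
      with that show ?thesis by auto
    qed
    ultimately show ?thesis
      using G by blast
  qed
  then show ?thesis
    using X[unfolded initial_topology_def, THEN spec, of ?B] by auto
qed

text \<open>Elements of a shape or a \<open>k\<close>-shape are later unpacked in this form, as
  limits of generators in finitely many coordinates.\<close>

lemma initial_topology_in_closure_of:
  assumes X: "initial_topology X F I"
  shows "x \<in> X closure_of S \<longleftrightarrow> x \<in> topspace X \<and>
    (\<forall>G \<epsilon>. finite G \<longrightarrow> G \<subseteq> I \<longrightarrow> \<epsilon> > 0 \<longrightarrow>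
       (\<exists>y\<in>S. y \<in> topspace X \<and> (\<forall>i\<in>G. \<bar>F i y - F i x\<bar> < \<epsilon>)))"
    (is "_ \<longleftrightarrow> _ \<and> ?R")
proof (cases "x \<in> topspace X")
  case True
  have "x \<in> X closure_of S \<longleftrightarrow> ?R"
  proof
    assume cl: "x \<in> X closure_of S"
    show ?R
    proof (intro allI impI)
      fix G and \<epsilon> :: real assume G: "finite G" "G \<subseteq> I" "\<epsilon> > 0"
      define B where "B = {y \<in> topspace X. \<forall>i\<in>G. \<bar>F i y - F i x\<bar> < \<epsilon>}"
      have "x \<in> B"
        using True \<open>\<epsilon> > 0\<close> by (simp add: B_def)
      moreover have "openin X B"
        unfolding B_def by (rule initial_topology_openin_ball[OF X G(1,2)])
      ultimately have "\<exists>y. y \<in> S \<and> y \<in> B"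
        using cl unfolding in_closure_of by simp
      then show "\<exists>y\<in>S. y \<in> topspace X \<and> (\<forall>i\<in>G. \<bar>F i y - F i x\<bar> < \<epsilon>)"
        unfolding B_def mem_Collect_eq by (simp only: Bex_def)
    qed
  next
    assume R: ?R
    show "x \<in> X closure_of S"
      unfolding in_closure_of
    proof (intro conjI True allI impI, elim conjE)
      fix T assume "x \<in> T" "openin X T"
      obtain G \<epsilon> where G: "finite G" "G \<subseteq> I" "\<epsilon> > 0"
        and GT: "\<And>y. y \<in> topspace X \<Longrightarrow> (\<forall>i\<in>G. \<bar>F i y - F i x\<bar> < \<epsilon>) \<Longrightarrow> y \<in> T"
        using initial_topology_nhd[OF X \<open>openin X T\<close> \<open>x \<in> T\<close>] by blast
      from R[rule_format, OF G] obtain y where "y \<in> S" "y \<in> topspace X" "\<forall>i\<in>G. \<bar>F i y - F i x\<bar> < \<epsilon>"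
        by blast
      then show "\<exists>y. y \<in> S \<and> y \<in> T"
        using GT by blast
    qed
  qed
  with True show ?thesis by blast
qed (auto simp: in_closure_of)

text \<open>Replaces a finite net in a metric space; both the radius and the tested coordinates may
  vary with the centre.\<close>

lemma initial_topology_finite_subcover:
  assumes X: "initial_topology X F I" and K: "compactin X K"
    and G: "\<And>x. x \<in> K \<Longrightarrow> finite (G x) \<and> G x \<subseteq> I \<and> \<epsilon> x > (0::real)"
  obtains T where "finite T" "T \<subseteq> K" "\<And>y. y \<in> K \<Longrightarrow> \<exists>x\<in>T. \<forall>i\<in>G x. \<bar>F i y - F i x\<bar> < \<epsilon> x"
proof -
  define B where "B x = {y \<in> topspace X. \<forall>i\<in>G x. \<bar>F i y - F i x\<bar> < \<epsilon> x}" for x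
  have KX: "K \<subseteq> topspace X"
    using K by (rule compactin_subset_topspace)
  have "\<exists>\<F>. finite \<F> \<and> \<F> \<subseteq> B ` K \<and> K \<subseteq> \<Union>\<F>"
  proof (rule compactinD[OF K])
    show "openin X U" if "U \<in> B ` K" for U
      using that G initial_topology_openin_ball[OF X] unfolding B_def by fastforce
    show "K \<subseteq> \<Union> (B ` K)"
      using KX G by (auto simp: B_def)
  qed
  then obtain \<F> where \<F>: "finite \<F>" "\<F> \<subseteq> B ` K" "K \<subseteq> \<Union>\<F>" by blast
  then obtain T where "T \<subseteq> K" "finite T" "\<F> = B ` T"
    by (meson finite_subset_image)
  then show thesis
  proof (intro that[of T])
    fix y assume "y \<in> K"
    then obtain x where "x \<in> T" "y \<in> B x"
      using \<F>(3) \<open>\<F> = B ` T\<close> by blast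
    then show "\<exists>x\<in>T. \<forall>i\<in>G x. \<bar>F i y - F i x\<bar> < \<epsilon> x"
      by (auto simp: B_def)
  qed
qed

text \<open>The Hausdorff criterion with finitely many coordinates in place of a distance. Miss sets
  give the first half and hit sets on a finite net the second, as in the metric case. Compactness of
  \<open>Ks n\<close> is asked only eventually, because the sequence of measures is constrained only
  from index 1 on.\<close>

lemma limitin_vietoris_iff:
  assumes X: "initial_topology X F I"
    and K: "compactin X K" and Ks: "\<forall>\<^sub>F n in H. compactin X (Ks n)"
  shows "limitin (vietoris X) Ks K H \<longleftrightarrow>
    (\<forall>G \<epsilon>. finite G \<longrightarrow> G \<subseteq> I \<longrightarrow> \<epsilon> > 0 \<longrightarrow>
      (\<forall>\<^sub>F n in H. (\<forall>x\<in>Ks n. \<exists>y\<in>K. \<forall>i\<in>G. \<bar>F i x - F i y\<bar> < \<epsilon>) \<and>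
                  (\<forall>y\<in>K. \<exists>x\<in>Ks n. \<forall>i\<in>G. \<bar>F i x - F i y\<bar> < \<epsilon>)))"
  (is "?L \<longleftrightarrow> ?R")
proof -
  have lim: "?L \<longleftrightarrow>
      (\<forall>U. openin X U \<and> K \<subseteq> U \<longrightarrow> (\<forall>\<^sub>F n in H. Ks n \<subseteq> U)) \<and>
      (\<forall>U. openin X U \<and> K \<inter> U \<noteq> {} \<longrightarrow> (\<forall>\<^sub>F n in H. Ks n \<inter> U \<noteq> {}))"
  proof -
    have "K \<in> topspace (vietoris X)"
      by (simp add: topspace_vietoris K)
    then have top: "K \<in> \<Union> ({{C. compactin X C \<and> C \<subseteq> U} | U. openin X U} \<union>
        {{C. compactin X C \<and> C \<inter> U \<noteq> {}} | U. openin X U})"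
      by (simp only: vietoris_def topology_generated_by_topspace)
    have eq: "(\<forall>S \<in> {P U | U. openin X U} \<union> {Q U | U. openin X U}. R S) \<longleftrightarrow>
        (\<forall>U. openin X U \<longrightarrow> R (P U)) \<and> (\<forall>U. openin X U \<longrightarrow> R (Q U))"
      for P Q :: "'a set \<Rightarrow> 'a set set" and R
      by blast
    \<comment> \<open>Subbasic sets contain only compact sets, so each carries a compactness clause;
      it is eventually true and drops out.\<close>
    have ev: "(\<forall>\<^sub>F n in H. compactin X (Ks n) \<and> Q n) \<longleftrightarrow> (\<forall>\<^sub>F n in H. Q n)" for Q
      using Ks by (simp add: eventually_conj_iff)
    show ?thesis
      unfolding vietoris_def limitin_topology_generated_by eq
      using top K by (simp add: imp_conjL ev)
  qed
  have KX: "K \<subseteq> topspace X"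
    using K by (rule compactin_subset_topspace)
  show ?thesis
  proof
    assume ?L
    show ?R
    proof (intro allI impI eventually_conj)
      fix G and \<epsilon> :: real assume G: "finite G" "G \<subseteq> I" and "\<epsilon> > 0"
      define B where "B e x = {y \<in> topspace X. \<forall>i\<in>G. \<bar>F i y - F i x\<bar> < e}" for e x
      have B: "openin X (B e x)" for e x
        unfolding B_def by (rule initial_topology_openin_ball[OF X G])
      have B_self: "x \<in> B e x" if "x \<in> K" "e > 0" for e x
        using that KX by (auto simp: B_def)
      have "openin X (\<Union>y\<in>K. B \<epsilon> y)" "K \<subseteq> (\<Union>y\<in>K. B \<epsilon> y)"
        using B B_self \<open>\<epsilon> > 0\<close> by auto
      then have "\<forall>\<^sub>F n in H. Ks n \<subseteq> (\<Union>y\<in>K. B \<epsilon> y)"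
        using \<open>?L\<close> lim by blast
      then show "\<forall>\<^sub>F n in H. \<forall>x\<in>Ks n. \<exists>y\<in>K. \<forall>i\<in>G. \<bar>F i x - F i y\<bar> < \<epsilon>"
        by (rule eventually_mono) (auto simp: B_def)
      \<comment> \<open>Hit conditions can be combined only over finitely many open sets, hence the
        net of radius \<open>\<epsilon>/2\<close>; the other half moves from the net point to an
        arbitrary \<open>y\<close>.\<close>
      obtain T where T: "finite T" "T \<subseteq> K"
          "\<And>y. y \<in> K \<Longrightarrow> \<exists>x\<in>T. \<forall>i\<in>G. \<bar>F i y - F i x\<bar> < \<epsilon>/2"
        using initial_topology_finite_subcover[OF X K, of "\<lambda>_. G" "\<lambda>_. \<epsilon>/2"] G \<open>\<epsilon> > 0\<close>
        by auto
      have "\<forall>\<^sub>F n in H. Ks n \<inter> B (\<epsilon>/2) t \<noteq> {}" if "t \<in> T" for t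
      proof -
        have "t \<in> K \<inter> B (\<epsilon>/2) t"
          using that T B_self \<open>\<epsilon> > 0\<close> by auto
        then show ?thesis
          using \<open>?L\<close> lim B by blast
      qed
      then have "\<forall>\<^sub>F n in H. \<forall>t\<in>T. Ks n \<inter> B (\<epsilon>/2) t \<noteq> {}"
        by (simp add: eventually_ball_finite T)
      then show "\<forall>\<^sub>F n in H. \<forall>y\<in>K. \<exists>x\<in>Ks n. \<forall>i\<in>G. \<bar>F i x - F i y\<bar> < \<epsilon>"
      proof (rule eventually_mono, intro ballI)
        fix n y assume h: "\<forall>t\<in>T. Ks n \<inter> B (\<epsilon>/2) t \<noteq> {}" and y: "y \<in> K"
        obtain t where t: "t \<in> T" "\<forall>i\<in>G. \<bar>F i y - F i t\<bar> < \<epsilon>/2" using T y by blast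
        then obtain x where "x \<in> Ks n" "x \<in> B (\<epsilon>/2) t"
          using h by blast
        then have x: "x \<in> Ks n" "\<forall>i\<in>G. \<bar>F i x - F i t\<bar> < \<epsilon>/2"
          unfolding B_def by blast+
        have "\<bar>F i x - F i y\<bar> < \<epsilon>" if "i \<in> G" for i
          using t(2)[rule_format, OF that] x(2)[rule_format, OF that] by linarith
        with x(1) show "\<exists>x\<in>Ks n. \<forall>i\<in>G. \<bar>F i x - F i y\<bar> < \<epsilon>"
          by auto
      qed
    qed
  next
    assume R: ?R
    show ?L
      unfolding lim
    proof (intro conjI allI impI; elim conjE)
      fix U assume U: "openin X U" "K \<subseteq> U"
      have "\<exists>G \<epsilon>. finite G \<and> G \<subseteq> I \<and> \<epsilon> > 0 \<and>
          (\<forall>y\<in>topspace X. (\<forall>i\<in>G. \<bar>F i y - F i x\<bar> < \<epsilon>) \<longrightarrow> y \<in> U)" if "x \<in> K" for x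
        using X[unfolded initial_topology_def, rule_format, THEN iffD1, OF U(1)] U(2) that
        by (meson subsetD)
      then obtain G \<epsilon> where G: "\<And>x. x \<in> K \<Longrightarrow> finite (G x) \<and> G x \<subseteq> I \<and> \<epsilon> x > 0"
        and GU: "\<And>x y. x \<in> K \<Longrightarrow> y \<in> topspace X \<Longrightarrow>
            (\<forall>i\<in>G x. \<bar>F i y - F i x\<bar> < \<epsilon> x) \<Longrightarrow> y \<in> U"
        by metis
      obtain T where T: "finite T" "T \<subseteq> K"
          "\<And>y. y \<in> K \<Longrightarrow> \<exists>x\<in>T. \<forall>i\<in>G x. \<bar>F i y - F i x\<bar> < \<epsilon> x / 2"
        using initial_topology_finite_subcover[OF X K, of G "\<lambda>x. \<epsilon> x / 2"] G by auto
      \<comment> \<open>Balls of half radius cover \<open>K\<close>, so a point within \<delta> of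
        \<open>K\<close> stays inside one of the full balls contained in \<open>U\<close>. The
        inserted 1 covers the case of empty \<open>K\<close>.\<close>
      define \<delta> where "\<delta> = Min (insert 1 ((\<lambda>x. \<epsilon> x / 2) ` T))"
      have "\<delta> > 0"
        unfolding \<delta>_def using T G by (subst Min_gr_iff) auto
      have \<delta>: "\<delta> \<le> \<epsilon> t / 2" if "t \<in> T" for t
        unfolding \<delta>_def using that T(1) by (intro Min_le) auto
      have "finite (G t) \<and> G t \<subseteq> I" if "t \<in> T" for t
        using G[of t] T(2) that by auto
      then have "finite (\<Union>t\<in>T. G t)" "(\<Union>t\<in>T. G t) \<subseteq> I"
        using T(1) by auto
      from R[rule_format, OF this \<open>\<delta> > 0\<close>] Ks
      show "\<forall>\<^sub>F n in H. Ks n \<subseteq> U"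
      proof eventually_elim
        case (elim n)
        show ?case
        proof
          fix x assume x: "x \<in> Ks n"
          then obtain y where y: "y \<in> K" "\<forall>i\<in>(\<Union>t\<in>T. G t). \<bar>F i x - F i y\<bar> < \<delta>"
            using elim by blast
          then obtain t where t: "t \<in> T" "\<forall>i\<in>G t. \<bar>F i y - F i t\<bar> < \<epsilon> t / 2"
            using T by blast
          have "\<bar>F i x - F i t\<bar> < \<epsilon> t" if "i \<in> G t" for i
          proof -
            have "\<bar>F i x - F i y\<bar> < \<delta>"
              using y t that by blast
            then show ?thesis
              using t(2)[rule_format, OF that] \<delta>[OF t(1)] by linarith
          qed
          moreover have "x \<in> topspace X"
            using x elim compactin_subset_topspace by blast
          ultimately show "x \<in> U"
            using GU t T by blast
        qed
      qed
    next
      fix U assume U: "openin X U" "K \<inter> U \<noteq> {}"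
      then obtain y where y: "y \<in> K" "y \<in> U" by blast
      then obtain G \<epsilon> where G: "finite G" "G \<subseteq> I" "\<epsilon> > 0"
          "\<And>x. x \<in> topspace X \<Longrightarrow> (\<forall>i\<in>G. \<bar>F i x - F i y\<bar> < \<epsilon>) \<Longrightarrow> x \<in> U"
        using initial_topology_nhd[OF X U(1)] by metis
      from R[rule_format, OF G(1-3)] Ks show "\<forall>\<^sub>F n in H. Ks n \<inter> U \<noteq> {}"
      proof eventually_elim
        case (elim n)
        then obtain x where x: "x \<in> Ks n" "\<forall>i\<in>G. \<bar>F i x - F i y\<bar> < \<epsilon>"
          using y by blast
        moreover have "x \<in> topspace X"
          using x elim compactin_subset_topspace by blast
        ultimately show ?case
          using G(4) by blast
      qed
    qed
  qed
qed

text \<open>If countably many functions \<open>E\<close> control all the \<open>F\<close> uniformly,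
  the map \<open>x \<mapsto> (E a x)\<close> goes into a countable product of lines, which is
  metrizable. There sequential compactness yields compactness of the image, and finite subcovers are
  pulled back.\<close>

lemma initial_topology_compact_space:
  fixes F :: "'i \<Rightarrow> 'a \<Rightarrow> real" and E :: "'j::countable \<Rightarrow> 'a \<Rightarrow> real"
  assumes X: "initial_topology X F I"
    and E: "\<And>G \<epsilon>. finite G \<Longrightarrow> G \<subseteq> I \<Longrightarrow> \<epsilon> > 0 \<Longrightarrow> \<exists>H \<delta>. finite H \<and> \<delta> > 0 \<and>
      (\<forall>x\<in>topspace X. \<forall>y\<in>topspace X.
        (\<forall>a\<in>H. \<bar>E a y - E a x\<bar> < \<delta>) \<longrightarrow> (\<forall>i\<in>G. \<bar>F i y - F i x\<bar> < \<epsilon>))"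
    and seq: "\<And>s :: nat \<Rightarrow> 'a. (\<And>n. s n \<in> topspace X) \<Longrightarrow>
      \<exists>r x. strict_mono r \<and> x \<in> topspace X \<and> (\<forall>a. (\<lambda>n. E a (s (r n))) \<longlonglongrightarrow> E a x)"
  shows "compact_space X"
proof -
  define e where "e x = (\<lambda>a. E a x)" for x
  have "seq_compact (e ` topspace X)"
  proof (rule seq_compactI)
    fix f assume f: "\<forall>n::nat. f n \<in> e ` topspace X"
    then have "\<forall>n. \<exists>x. x \<in> topspace X \<and> f n = e x"
      by blast
    from choice[OF this] obtain s where s: "\<And>n. s n \<in> topspace X" "\<And>n. f n = e (s n)"
      by blast
    obtain r x where r: "strict_mono r" "x \<in> topspace X" "\<And>a. (\<lambda>n. E a (s (r n))) \<longlonglongrightarrow> E a x"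
      using seq s(1) by blast
    have "(f \<circ> r) \<longlonglongrightarrow> e x"
    proof -
      have "limitin (product_topology (\<lambda>i. euclideanreal) UNIV) (f \<circ> r) (e x) sequentially"
        unfolding limitin_componentwise using r(3) by (simp add: s(2)) (simp add: e_def)
      then show ?thesis
        by (simp only: euclidean_product_topology limitin_canonical_iff)
    qed
    then show "\<exists>l\<in>e ` topspace X. \<exists>r. strict_mono r \<and> (f \<circ> r) \<longlonglongrightarrow> l"
      using r by blast
  qed
  then have comp: "compact (e ` topspace X)"
    by (simp add: compact_eq_seq_compact_metric)
  show ?thesis
    unfolding compact_space_alt
  proof (intro allI impI, elim conjE)
    fix \<U> assume op: "\<forall>U\<in>\<U>. openin X U" and cov: "topspace X \<subseteq> \<Union> \<U>"
    \<comment> \<open>Moves the cover to the image: near \<open>e x\<close>, closeness in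
      \<open>E\<close> already forces membership in one member of the cover.\<close>
    have "\<exists>V. open V \<and> e x \<in> V \<and> (\<exists>U\<in>\<U>. \<forall>y\<in>topspace X. e y \<in> V \<longrightarrow> y \<in> U)"
      if x: "x \<in> topspace X" for x
    proof -
      obtain U where U: "U \<in> \<U>" "x \<in> U" using x cov by blast
      then obtain G \<epsilon> where G: "finite G" "G \<subseteq> I" "\<epsilon> > 0"
          "\<And>y. y \<in> topspace X \<Longrightarrow> (\<forall>i\<in>G. \<bar>F i y - F i x\<bar> < \<epsilon>) \<Longrightarrow> y \<in> U"
        using initial_topology_nhd[OF X, of U x] op by metis
      obtain H \<delta> where H: "finite H" "\<delta> > 0" "\<And>y. y \<in> topspace X \<Longrightarrow>
          (\<forall>a\<in>H. \<bar>E a y - E a x\<bar> < \<delta>) \<Longrightarrow> (\<forall>i\<in>G. \<bar>F i y - F i x\<bar> < \<epsilon>)"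
        using E[OF G(1-3)] x by blast
      define V where "V = (\<Inter>a\<in>H. {f. \<bar>f a - E a x\<bar> < \<delta>})"
      have "open {f::'j \<Rightarrow> real. \<bar>f a - E a x\<bar> < \<delta>}" for a
        by (intro open_Collect_less continuous_intros continuous_on_product_coordinates)
      then have "open V"
        unfolding V_def using H(1) by blast
      moreover have "e x \<in> V"
        using H(2) by (auto simp: V_def e_def)
      moreover have "\<forall>y\<in>topspace X. e y \<in> V \<longrightarrow> y \<in> U"
        using G(4) H(3) by (auto simp: V_def e_def)
      ultimately show ?thesis using U(1) by blast
    qed
    then obtain V U where VU: "\<And>x. x \<in> topspace X \<Longrightarrow> open (V x) \<and> e x \<in> V x \<and> U x \<in> \<U> \<and>
        (\<forall>y\<in>topspace X. e y \<in> V x \<longrightarrow> y \<in> U x)"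
      by metis
    have "e ` topspace X \<subseteq> (\<Union>x\<in>topspace X. V x)" using VU by blast
    then obtain T where T: "T \<subseteq> topspace X" "finite T" "e ` topspace X \<subseteq> (\<Union>x\<in>T. V x)"
      using compactE_image[OF comp, of "topspace X" V] VU by blast
    have "topspace X \<subseteq> \<Union> (U ` T)"
    proof
      fix y assume y: "y \<in> topspace X"
      then obtain x where "x \<in> T" "e y \<in> V x" using T by blast
      then show "y \<in> \<Union> (U ` T)" using VU T y by blast
    qed
    moreover have "finite (U ` T)" "U ` T \<subseteq> \<U>" using T VU by auto
    ultimately show "\<exists>\<F>. finite \<F> \<and> \<F> \<subseteq> \<U> \<and> topspace X \<subseteq> \<Union> \<F>" by blast
  qed
qed

section \<open>Initial topologies from subbases, subspaces and finite products\<close>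

lemma generate_topology_on_finite_INT:
  assumes "finite G" "G \<noteq> {}" "\<And>i. i \<in> G \<Longrightarrow> generate_topology_on S (B i)"
  shows "generate_topology_on S (\<Inter>i\<in>G. B i)"
  using assms
  by (induction G rule: finite_ne_induct) (auto intro: generate_topology_on.Int)

lemma initial_topology_generated_by:
  fixes F :: "'i \<Rightarrow> 'a \<Rightarrow> real"
  assumes "I \<noteq> {}"
  shows "initial_topology (topology_generated_by {{x \<in> P. F i x \<in> U} | i U. i \<in> I \<and> open U}) F I"
    (is "initial_topology (topology_generated_by ?S) F I")
proof -
  have top: "topspace (topology_generated_by ?S) = P"
  proof
    obtain i where "i \<in> I" using assms by blast
    then have "{x \<in> P. F i x \<in> UNIV} \<in> ?S"
      by blast
    then show "P \<subseteq> topspace (topology_generated_by ?S)"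
      unfolding topology_generated_by_topspace by blast
  qed (auto simp: topology_generated_by_topspace)
  have gen: "generate_topology_on ?S U \<longleftrightarrow> U \<subseteq> P \<and>
     (\<forall>x\<in>U. \<exists>G \<epsilon>. finite G \<and> G \<subseteq> I \<and> \<epsilon> > 0 \<and>
        (\<forall>y\<in>P. (\<forall>i\<in>G. \<bar>F i y - F i x\<bar> < \<epsilon>) \<longrightarrow> y \<in> U))" (is "_ \<longleftrightarrow> ?R U") for U
  proof
    assume "generate_topology_on ?S U"
    then show "?R U"
    proof induction
      case (Int a b)
      show ?case
      proof (intro conjI ballI)
        fix x assume x: "x \<in> a \<inter> b"
        have "x \<in> a" "x \<in> b" using x by auto
        obtain G \<epsilon> where G: "finite G" "G \<subseteq> I" "\<epsilon> > 0"
            "\<And>y. y \<in> P \<Longrightarrow> (\<forall>i\<in>G. \<bar>F i y - F i x\<bar> < \<epsilon>) \<Longrightarrow> y \<in> a"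
          using Int.IH(1)[THEN conjunct2, rule_format, OF \<open>x \<in> a\<close>] by blast
        obtain G' \<epsilon>' where G': "finite G'" "G' \<subseteq> I" "\<epsilon>' > 0"
            "\<And>y. y \<in> P \<Longrightarrow> (\<forall>i\<in>G'. \<bar>F i y - F i x\<bar> < \<epsilon>') \<Longrightarrow> y \<in> b"
          using Int.IH(2)[THEN conjunct2, rule_format, OF \<open>x \<in> b\<close>] by blast
        show "\<exists>G \<epsilon>. finite G \<and> G \<subseteq> I \<and> \<epsilon> > 0 \<and>
            (\<forall>y\<in>P. (\<forall>i\<in>G. \<bar>F i y - F i x\<bar> < \<epsilon>) \<longrightarrow> y \<in> a \<inter> b)"
        proof (intro exI[of _ "G \<union> G'"] exI[of _ "min \<epsilon> \<epsilon>'"] conjI ballI impI)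
          show "finite (G \<union> G')" "G \<union> G' \<subseteq> I" "0 < min \<epsilon> \<epsilon>'"
            using G G' by auto
        next
          fix y assume "y \<in> P" and y: "\<forall>i\<in>G \<union> G'. \<bar>F i y - F i x\<bar> < min \<epsilon> \<epsilon>'"
          then show "y \<in> a \<inter> b"
            by (intro IntI G(4) G'(4)) auto
        qed
      qed (use Int in auto)
    next
      case (UN K)
      show ?case
      proof (intro conjI ballI)
        fix x assume "x \<in> \<Union>K"
        then obtain k where k: "k \<in> K" "x \<in> k" by blast
        obtain G \<epsilon> where G: "finite G" "G \<subseteq> I" "\<epsilon> > 0"
            "\<And>y. y \<in> P \<Longrightarrow> (\<forall>i\<in>G. \<bar>F i y - F i x\<bar> < \<epsilon>) \<Longrightarrow> y \<in> k"
          using UN.IH[OF k(1), THEN conjunct2, rule_format, OF k(2)] by blast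
        then show "\<exists>G \<epsilon>. finite G \<and> G \<subseteq> I \<and> \<epsilon> > 0 \<and>
            (\<forall>y\<in>P. (\<forall>i\<in>G. \<bar>F i y - F i x\<bar> < \<epsilon>) \<longrightarrow> y \<in> \<Union>K)"
          using k by blast
      qed (use UN in blast)
    next
      case (Basis s)
      then obtain i U where i: "s = {x \<in> P. F i x \<in> U}" "i \<in> I" "open U" by blast
      show ?case
      proof (intro conjI ballI)
        fix x assume "x \<in> s"
        then obtain \<epsilon> where "\<epsilon> > 0" "\<And>t. dist t (F i x) < \<epsilon> \<Longrightarrow> t \<in> U"
          using i unfolding open_dist by blast
        then show "\<exists>G \<epsilon>. finite G \<and> G \<subseteq> I \<and> \<epsilon> > 0 \<and>
            (\<forall>y\<in>P. (\<forall>i\<in>G. \<bar>F i y - F i x\<bar> < \<epsilon>) \<longrightarrow> y \<in> s)"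
          using i by (intro exI[of _ "{i}"] exI[of _ \<epsilon>]) (auto simp: dist_real_def)
      qed (use i in auto)
    qed simp
  next
    assume R: "?R U"
    define B where "B i x e = {y \<in> P. F i y \<in> ball (F i x) e}" for i x e
    have B: "generate_topology_on ?S (B i x e)" if "i \<in> I" for i x e
    proof (rule generate_topology_on.Basis)
      show "B i x e \<in> ?S"
        unfolding B_def using that open_ball by blast
    qed
    \<comment> \<open>The additional index keeps the intersection nonvoid when \<open>G\<close> is
      empty; an intersection over no index would be the whole type and not lie in
      \<open>P\<close>.\<close>
    obtain i0 where i0: "i0 \<in> I" using assms by blast
    have "\<exists>V. generate_topology_on ?S V \<and> x \<in> V \<and> V \<subseteq> U" if x: "x \<in> U" for x
    proof -
      obtain G \<epsilon> where G: "finite G" "G \<subseteq> I" "\<epsilon> > 0"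
            "\<And>y. y \<in> P \<Longrightarrow> (\<forall>i\<in>G. \<bar>F i y - F i x\<bar> < \<epsilon>) \<Longrightarrow> y \<in> U"
        using R[THEN conjunct2, rule_format, OF x] by blast
      have "generate_topology_on ?S (\<Inter>i\<in>insert i0 G. B i x \<epsilon>)"
        using G i0 B by (intro generate_topology_on_finite_INT) auto
      moreover have "x \<in> (\<Inter>i\<in>insert i0 G. B i x \<epsilon>)"
        using R x G(3) by (auto simp: B_def)
      moreover have "(\<Inter>i\<in>insert i0 G. B i x \<epsilon>) \<subseteq> U"
        using G(4) by (auto simp: B_def dist_real_def abs_minus_commute)
      ultimately show ?thesis by blast
    qed
    then have "U = \<Union> {V. generate_topology_on ?S V \<and> V \<subseteq> U}"
      by blast
    then show "generate_topology_on ?S U"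
      by (metis (mono_tags, lifting) generate_topology_on.UN mem_Collect_eq)
  qed
  show ?thesis
    unfolding initial_topology_def top openin_topology_generated_by_iff gen
    by (intro allI refl)
qed

lemma initial_topology_subtopology:
  assumes X: "initial_topology X F I"
  shows "initial_topology (subtopology X S) F I"
  unfolding initial_topology_def
proof (intro allI iffI)
  fix U assume "openin (subtopology X S) U"
  then obtain T where T: "openin X T" "U = T \<inter> S" by (auto simp: openin_subtopology)
  show "U \<subseteq> topspace (subtopology X S) \<and> (\<forall>x\<in>U. \<exists>G \<epsilon>. finite G \<and> G \<subseteq> I \<and> \<epsilon> > 0 \<and>
        (\<forall>y\<in>topspace (subtopology X S). (\<forall>i\<in>G. \<bar>F i y - F i x\<bar> < \<epsilon>) \<longrightarrow> y \<in> U))"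
  proof (intro conjI ballI)
    show "U \<subseteq> topspace (subtopology X S)"
      using T openin_subset by auto
    fix x assume "x \<in> U"
    then obtain G \<epsilon> where "finite G" "G \<subseteq> I" "\<epsilon> > 0"
        "\<And>y. y \<in> topspace X \<Longrightarrow> (\<forall>i\<in>G. \<bar>F i y - F i x\<bar> < \<epsilon>) \<Longrightarrow> y \<in> T"
      using initial_topology_nhd[OF X T(1)] T by (metis IntD1)
    then show "\<exists>G \<epsilon>. finite G \<and> G \<subseteq> I \<and> \<epsilon> > 0 \<and>
        (\<forall>y\<in>topspace (subtopology X S). (\<forall>i\<in>G. \<bar>F i y - F i x\<bar> < \<epsilon>) \<longrightarrow> y \<in> U)"
      using T by (intro exI[of _ G] exI[of _ \<epsilon>]) auto
  qed
next
  fix U assume U: "U \<subseteq> topspace (subtopology X S) \<and> (\<forall>x\<in>U. \<exists>G \<epsilon>. finite G \<and> G \<subseteq> I \<and> \<epsilon> > 0 \<and>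
        (\<forall>y\<in>topspace (subtopology X S). (\<forall>i\<in>G. \<bar>F i y - F i x\<bar> < \<epsilon>) \<longrightarrow> y \<in> U))"
  have "\<exists>T. openin (subtopology X S) T \<and> x \<in> T \<and> T \<subseteq> U" if x: "x \<in> U" for x
  proof -
    obtain G \<epsilon> where G: "finite G" "G \<subseteq> I" "\<epsilon> > 0"
        "\<And>y. y \<in> topspace (subtopology X S) \<Longrightarrow> (\<forall>i\<in>G. \<bar>F i y - F i x\<bar> < \<epsilon>) \<Longrightarrow> y \<in> U"
      using U[THEN conjunct2, rule_format, OF x] by blast
    have "openin (subtopology X S) ({y \<in> topspace X. \<forall>i\<in>G. \<bar>F i y - F i x\<bar> < \<epsilon>} \<inter> S)"
      using initial_topology_openin_ball[OF X G(1,2)] by (rule openin_subtopology_Int)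
    moreover have "{y \<in> topspace X. \<forall>i\<in>G. \<bar>F i y - F i x\<bar> < \<epsilon>} \<inter> S \<subseteq> U"
      using G(4) by auto
    moreover have "x \<in> {y \<in> topspace X. \<forall>i\<in>G. \<bar>F i y - F i x\<bar> < \<epsilon>} \<inter> S"
      using U[THEN conjunct1] x G(3) by auto
    ultimately show ?thesis
      by blast
  qed
  then show "openin (subtopology X S) U"
    by (subst openin_subopen) blast
qed

lemma initial_topology_powertop_real:
  assumes "finite I"
  shows "initial_topology (powertop_real I) (\<lambda>i M. M i) I"
  unfolding initial_topology_def
proof (intro allI iffI)
  fix S assume S: "openin (powertop_real I) S"
  show "S \<subseteq> topspace (powertop_real I) \<and> (\<forall>x\<in>S. \<exists>G \<epsilon>. finite G \<and> G \<subseteq> I \<and> \<epsilon> > 0 \<and>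
        (\<forall>y\<in>topspace (powertop_real I). (\<forall>i\<in>G. \<bar>y i - x i\<bar> < \<epsilon>) \<longrightarrow> y \<in> S))"
  proof (intro conjI ballI)
    fix x assume "x \<in> S"
    then obtain U where U: "\<And>i. i \<in> I \<Longrightarrow> open (U i)" "x \<in> Pi\<^sub>E I U" "Pi\<^sub>E I U \<subseteq> S"
      using S[unfolded openin_product_topology_alt, rule_format, OF \<open>x \<in> S\<close>] by auto
    have "\<exists>e>0. \<forall>t. \<bar>t - x i\<bar> < e \<longrightarrow> t \<in> U i" if "i \<in> I" for i
      using U(1)[OF that] U(2) that unfolding open_dist dist_real_def by blast
    then obtain e where e: "\<And>i. i \<in> I \<Longrightarrow> e i > 0 \<and> (\<forall>t. \<bar>t - x i\<bar> < e i \<longrightarrow> t \<in> U i)"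
      by metis
    define \<epsilon> where "\<epsilon> = Min (insert 1 (e ` I))"
    have "\<epsilon> > 0"
      unfolding \<epsilon>_def using e assms by (subst Min_gr_iff) auto
    moreover have "\<epsilon> \<le> e i" if "i \<in> I" for i
      unfolding \<epsilon>_def using that assms by (intro Min_le) auto
    ultimately show "\<exists>G \<epsilon>. finite G \<and> G \<subseteq> I \<and> \<epsilon> > 0 \<and>
        (\<forall>y\<in>topspace (powertop_real I). (\<forall>i\<in>G. \<bar>y i - x i\<bar> < \<epsilon>) \<longrightarrow> y \<in> S)"
      using assms e U(3) by (intro exI[of _ I] exI[of _ \<epsilon>])
        (force simp: PiE_iff less_le_trans intro!: subsetD[OF U(3)])
  qed (use S openin_subset in blast)
next
  fix S assume S: "S \<subseteq> topspace (powertop_real I) \<and> (\<forall>x\<in>S. \<exists>G \<epsilon>. finite G \<and> G \<subseteq> I \<and> \<epsilon> > 0 \<and>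
        (\<forall>y\<in>topspace (powertop_real I). (\<forall>i\<in>G. \<bar>y i - x i\<bar> < \<epsilon>) \<longrightarrow> y \<in> S))"
  show "openin (powertop_real I) S"
    unfolding openin_product_topology_alt
  proof
    fix x assume x: "x \<in> S"
    then obtain G \<epsilon> where G: "finite G" "G \<subseteq> I" "\<epsilon> > 0"
        "\<And>y. y \<in> topspace (powertop_real I) \<Longrightarrow> (\<forall>i\<in>G. \<bar>y i - x i\<bar> < \<epsilon>) \<Longrightarrow> y \<in> S"
      using S[THEN conjunct2, rule_format, OF x] by blast
    have "Pi\<^sub>E I (\<lambda>i. ball (x i) \<epsilon>) \<subseteq> S"
    proof
      fix y assume y: "y \<in> Pi\<^sub>E I (\<lambda>i. ball (x i) \<epsilon>)"
      have "\<bar>y i - x i\<bar> < \<epsilon>" if "i \<in> G" for i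
        using y that G(2) by (auto simp: PiE_iff dist_real_def abs_minus_commute)
      with y show "y \<in> S"
        by (intro G(4)) (auto simp: PiE_iff)
    qed
    moreover have "x \<in> Pi\<^sub>E I (\<lambda>i. ball (x i) \<epsilon>)"
      using S x G(3) by (auto simp: PiE_iff)
    ultimately show "\<exists>U. finite {i \<in> I. U i \<noteq> topspace euclideanreal} \<and>
        (\<forall>i\<in>I. openin euclideanreal (U i)) \<and> x \<in> Pi\<^sub>E I U \<and> Pi\<^sub>E I U \<subseteq> S"
      using assms by (intro exI[of _ "\<lambda>i. ball (x i) \<epsilon>"]) auto
  qed
qed

section \<open>A space-filling curve and weak compactness on the unit square\<close>

text \<open>The digits are read along the orbit of the doubling map, and
  \<open>(1/2) ^ n * r n\<close> is the remainder after \<open>n\<close> of them. The point 1 is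
  fixed by the map and receives the digits 1, 1, 1, and so on.\<close>

lemma binary_expansion:
  fixes x :: real
  assumes "x \<in> {0..1}"
  obtains b :: "nat \<Rightarrow> real" where "\<And>n. b n \<in> {0, 1}" "(\<lambda>n. (1/2) ^ Suc n * b n) sums x"
proof -
  define d :: "real \<Rightarrow> real" where "d r = (if r \<ge> 1/2 then 1 else 0)" for r
  define r where "r n = ((\<lambda>r. 2 * r - d r) ^^ n) x" for n
  define b where "b n = d (r n)" for n
  have r_Suc: "r (Suc n) = 2 * r n - b n" for n
    by (simp add: r_def b_def)
  have r01: "r n \<in> {0..1}" for n
  proof (induction n)
    case (Suc n)
    then show ?case
      by (auto simp: r_Suc b_def d_def)
  qed (use assms in \<open>simp add: r_def\<close>)
  have part: "(\<Sum>i<n. (1/2) ^ Suc i * b i) = x - (1/2) ^ n * r n" for n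
  proof (induction n)
    case (Suc n)
    then show ?case
      by (simp add: r_Suc field_simps)
  qed (simp add: r_def)
  have "(\<lambda>n. (1/2) ^ n * r n) \<longlonglongrightarrow> 0"
  proof (rule tendsto_sandwich[of "\<lambda>_. 0" _ _ "\<lambda>n. (1/2) ^ n"])
    show "(\<lambda>n. (1/2::real) ^ n) \<longlonglongrightarrow> 0"
      by (rule LIMSEQ_power_zero) simp
    show "\<forall>\<^sub>F n in sequentially. 0 \<le> (1/2) ^ n * r n"
      using r01 by (auto intro!: always_eventually)
    show "\<forall>\<^sub>F n in sequentially. (1/2) ^ n * r n \<le> (1/2) ^ n"
      using r01 by (auto intro!: always_eventually mult_left_le)
  qed simp
  then have "(\<lambda>n. x - (1/2) ^ n * r n) \<longlonglongrightarrow> x - 0"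
    by (intro tendsto_diff tendsto_const)
  then have "(\<lambda>n. (1/2) ^ Suc n * b n) sums x"
    unfolding sums_def part by simp
  moreover have "b n \<in> {0, 1}" for n
    by (simp add: b_def d_def)
  ultimately show thesis
    by (intro that)
qed

text \<open>The wave of Schoenberg's curve, of period 2, equal to 0 on \<open>[0,1/3]\<close> and to
  1 on \<open>[2/3,1]\<close>. A clipped cosine replaces the usual piecewise linear function, so
  that periodicity and continuity are those of \<open>cos\<close>; the shift 1/2 fits its values at
  \<open>pi/3\<close> and \<open>2 * pi/3\<close>.\<close>

definition schoenberg_wave :: "real \<Rightarrow> real" where
  "schoenberg_wave t = max 0 (min 1 (1/2 - cos (pi * t)))"

lemma schoenberg_wave_shift: "schoenberg_wave (t + 2 * of_int m) = schoenberg_wave t"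
proof -
  have "cos (pi * (t + 2 * of_int m)) = cos (pi * t + 2 * pi * of_int m)"
    by (simp add: algebra_simps)
  also have "\<dots> = cos (pi * t)"
    by (simp only: cos_add cos_int_2pin sin_int_2pin)
  finally show ?thesis
    by (simp add: schoenberg_wave_def)
qed

lemma schoenberg_wave_low: "t \<in> {0..1/3} \<Longrightarrow> schoenberg_wave t = 0"
proof -
  assume t: "t \<in> {0..1/3}"
  have "cos (pi / 3) \<le> cos (pi * t)"
    using t by (intro cos_monotone_0_pi_le) (auto simp: field_simps)
  then show ?thesis
    by (simp add: schoenberg_wave_def cos_60)
qed

lemma schoenberg_wave_high: "t \<in> {2/3..1} \<Longrightarrow> schoenberg_wave t = 1"
proof -
  assume t: "t \<in> {2/3..1}"
  have "cos (pi * t) \<le> cos (pi - pi / 3)"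
    using t by (intro cos_monotone_0_pi_le) (auto simp: field_simps)
  also have "cos (pi - pi / 3) = - (1/2)"
    unfolding cos_pi_minus by (simp add: cos_60)
  finally show ?thesis
    by (simp add: schoenberg_wave_def)
qed

definition schoenberg_coord :: "(nat \<Rightarrow> real) \<Rightarrow> real \<Rightarrow> real" where
  "schoenberg_coord a t = (\<Sum>n. (1/2) ^ Suc n * schoenberg_wave (a n * t))"

lemma schoenberg_wave_bounds: "0 \<le> schoenberg_wave t" "schoenberg_wave t \<le> 1"
  by (auto simp: schoenberg_wave_def)

lemma schoenberg_summand_bounds:
  "0 \<le> (1/2) ^ Suc n * schoenberg_wave t" "(1/2) ^ Suc n * schoenberg_wave t \<le> (1/2) ^ Suc n"
  using schoenberg_wave_bounds[of t] by (auto intro!: mult_left_le)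

lemma schoenberg_summable: "summable (\<lambda>n. (1/2) ^ Suc n * schoenberg_wave (a n * t))"
  by (rule summable_comparison_test'[OF sums_summable[OF power_half_series], of 0])
     (use schoenberg_summand_bounds in \<open>simp add: abs_of_nonneg\<close>)

lemma schoenberg_coord_bounds: "schoenberg_coord a t \<in> {0..1}"
proof -
  have "schoenberg_coord a t \<le> (\<Sum>n. (1/2) ^ Suc n)"
    unfolding schoenberg_coord_def
    using schoenberg_summand_bounds schoenberg_summable sums_summable[OF power_half_series]
    by (intro suminf_le) auto
  also have "\<dots> = 1"
    using power_half_series by (rule sums_unique[symmetric])
  finally show ?thesis
    using suminf_nonneg[OF schoenberg_summable, of a t] schoenberg_summand_bounds(1)
    by (simp add: schoenberg_coord_def)
qed

lemma continuous_schoenberg_coord: "continuous_on UNIV (schoenberg_coord a)"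
proof (rule uniform_limit_theorem)
  show "uniform_limit UNIV (\<lambda>n t. \<Sum>i<n. (1/2) ^ Suc i * schoenberg_wave (a i * t))
          (schoenberg_coord a) sequentially"
    unfolding schoenberg_coord_def
    using schoenberg_summand_bounds sums_summable[OF power_half_series]
    by (intro Weierstrass_m_test[where M = "\<lambda>n. (1/2) ^ Suc n"]) (auto simp: abs_of_nonneg)
  show "\<forall>\<^sub>F n in sequentially.
      continuous_on UNIV (\<lambda>t. \<Sum>i<n. (1/2) ^ Suc i * schoenberg_wave (a i * t))"
    unfolding schoenberg_wave_def by (intro always_eventually allI continuous_intros)
qed simp

text \<open>The witness is the Cantor point with ternary digits \<open>2 * b n\<close>. Multiplying
  by \<open>3 ^ k\<close> shifts the digits, and the leading digit 0 or 2 of the tail puts it into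
  \<open>[0,1/3]\<close> or \<open>[2/3,1]\<close>, where the wave returns
  \<open>b k\<close>.\<close>

lemma ternary_schoenberg:
  fixes b :: "nat \<Rightarrow> real"
  assumes b: "\<And>n. b n \<in> {0, 1}"
  obtains t where "t \<in> {0..1}" "\<And>k. schoenberg_wave (3 ^ k * t) = b k"
proof -
  have geo: "(\<lambda>m. 2 * (1/3::real) ^ Suc m) sums 1"
    using geometric_sums[of "1/3::real"] sums_mult[of "\<lambda>m. (1/3) ^ m" "3/2" "2/3::real"] by simp
  define T where "T k = (\<Sum>m. 2 * (1/3) ^ Suc m * b (m + k))" for k
  have le: "0 \<le> 2 * (1/3) ^ Suc m * b (m + k)" "2 * (1/3) ^ Suc m * b (m + k) \<le> 2 * (1/3) ^ Suc m"
      for m k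
    using b[of "m + k"] by auto
  have smm: "summable (\<lambda>m. 2 * (1/3) ^ Suc m * b (m + k))" for k
    by (rule summable_comparison_test'[OF sums_summable[OF geo], of 0])
       (use le in \<open>simp add: abs_of_nonneg\<close>)
  have T01: "T k \<in> {0..1}" for k
  proof -
    have "T k \<le> (\<Sum>m. 2 * (1/3) ^ Suc m)"
      unfolding T_def using le smm sums_summable[OF geo] by (intro suminf_le) auto
    also have "\<dots> = 1"
      using geo by (rule sums_unique[symmetric])
    finally show ?thesis
      using suminf_nonneg[OF smm, of k] le(1) by (simp add: T_def)
  qed
  have T_rec: "3 * T k = 2 * b k + T (Suc k)" for k
  proof -
    have "T k = 2/3 * b k + (\<Sum>m. 2 * (1/3) ^ Suc (Suc m) * b (Suc m + k))"
      unfolding T_def using suminf_split_head[OF smm[of k]] by simp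
    also have "(\<Sum>m. 2 * (1/3) ^ Suc (Suc m) * b (Suc m + k)) =
        (\<Sum>m. 1/3 * (2 * (1/3) ^ Suc m * b (m + Suc k)))"
      by simp
    also have "\<dots> = 1/3 * T (Suc k)"
      unfolding T_def by (rule suminf_mult[OF smm])
    finally show ?thesis by simp
  qed
  \<comment> \<open>What is discarded in front of the ternary point is an even integer because all
    digits are even; the period 2 of the wave ignores it.\<close>
  have shift: "\<exists>m::int. 3 ^ k * T 0 = T k + 2 * of_int m" for k
  proof (induction k)
    case 0
    show ?case by (rule exI[of _ 0]) simp
  next
    case (Suc k)
    then obtain m :: int where m: "3 ^ k * T 0 = T k + 2 * of_int m" by blast
    obtain i :: int where i: "b k = of_int i"
      using b[of k] by (metis insertE of_int_0 of_int_1 singletonD)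
    have "3 ^ Suc k * T 0 = T (Suc k) + 2 * of_int (i + 3 * m)"
      using T_rec[of k] i m by simp
    then show ?case by blast
  qed
  have "schoenberg_wave (3 ^ k * T 0) = b k" for k
  proof -
    have "schoenberg_wave (3 ^ k * T 0) = schoenberg_wave (T k)"
      using shift[of k] schoenberg_wave_shift by metis
    also have "\<dots> = b k"
    proof (cases "b k = 0")
      case True
      then show ?thesis
        using T_rec[of k] T01[of "Suc k"] by (simp add: schoenberg_wave_low)
    next
      case False
      then have "b k = 1" using b[of k] by auto
      then show ?thesis
        using T_rec[of k] T01[of "Suc k"] by (simp add: schoenberg_wave_high)
    qed
    finally show ?thesis .
  qed
  then show thesis
    using T01[of 0] by (intro that)
qed

text \<open>The coordinates read the digits at even and at odd places of one sequence, so
  interleaving the expansions of \<open>x\<close> and \<open>y\<close> hits \<open>(x, y)\<close>.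
  The curve lives on the whole line with values in the square, since weak convergence on the line
  tests \<open>g (c t)\<close> at every real \<open>t\<close>.\<close>

lemma space_filling_curve:
  obtains c :: "real \<Rightarrow> real \<times> real"
  where "continuous_on UNIV c" "range c \<subseteq> unit_square" "unit_square \<subseteq> c ` {0..1}"
proof
  let ?c = "\<lambda>t. (schoenberg_coord (\<lambda>n. 3 ^ (2 * n)) t, schoenberg_coord (\<lambda>n. 3 ^ (2 * n + 1)) t)"
  show "continuous_on UNIV ?c"
    by (intro continuous_on_Pair continuous_schoenberg_coord)
  show "range ?c \<subseteq> unit_square"
    using schoenberg_coord_bounds by blast
  show "unit_square \<subseteq> ?c ` {0..1}"
  proof
    fix z :: "real \<times> real" assume "z \<in> unit_square"
    then obtain x y where z: "z = (x, y)" "x \<in> {0..1}" "y \<in> {0..1}" by auto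
    obtain p where p: "\<And>n. p n \<in> {0, 1::real}" "(\<lambda>n. (1/2) ^ Suc n * p n) sums x"
      using binary_expansion[OF z(2)] by blast
    obtain q where q: "\<And>n. q n \<in> {0, 1::real}" "(\<lambda>n. (1/2) ^ Suc n * q n) sums y"
      using binary_expansion[OF z(3)] by blast
    define b where "b n = (if even n then p (n div 2) else q (n div 2))" for n
    have "b n \<in> {0, 1}" for n
      unfolding b_def by (cases "even n") (simp_all only: if_True if_False p(1) q(1)
          not_False_eq_True)
    then obtain t where t: "t \<in> {0..1}"
        "\<And>k. schoenberg_wave (3 ^ k * t) = b k"
      using ternary_schoenberg[of b] by blast
    have "?c t = z"
      unfolding schoenberg_coord_def t(2) z(1)
      using sums_unique[OF p(2)] sums_unique[OF q(2)] by (simp add: b_def)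
    then show "z \<in> ?c ` {0..1}"
      using t(1) by blast
  qed
qed

section \<open>Borel probability measures on the unit square\<close>

lemma unit_square_borel: "unit_square \<in> sets borel"
  by (intro borel_closed closed_Times closed_atLeastAtMost)

lemma prob_measures_squareD:
  assumes "\<nu> \<in> prob_measures_square"
  shows "prob_space \<nu>" "sets \<nu> = sets (restrict_space borel unit_square)" "space \<nu> = unit_square"
proof -
  show "prob_space \<nu>" and sets: "sets \<nu> = sets (restrict_space borel unit_square)"
    using assms by (auto simp: prob_measures_square_def)
  show "space \<nu> = unit_square"
    using sets_eq_imp_space_eq[OF sets] by (simp add: space_restrict_space)
qed

lemma prob_measures_square_measurable:
  assumes "\<nu> \<in> prob_measures_square"
  shows "measurable \<nu> N = measurable (restrict_space borel unit_square) N"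
  using prob_measures_squareD(2)[OF assms] by (intro measurable_cong_sets) auto

lemma prob_measures_square_measurable_borel:
  assumes "\<nu> \<in> prob_measures_square" "f \<in> measurable borel N"
  shows "f \<in> measurable \<nu> N"
  unfolding prob_measures_square_measurable[OF assms(1)]
  using assms(2) by (rule measurable_restrict_space1)

lemma prob_measures_square_measurable_continuous:
  fixes g :: "real \<times> real \<Rightarrow> 'b::topological_space"
  assumes "\<nu> \<in> prob_measures_square" "continuous_on unit_square g"
  shows "g \<in> borel_measurable \<nu>"
  unfolding prob_measures_square_measurable[OF assms(1)]
  using assms(2) by (rule borel_measurable_continuous_on_restrict)

lemma continuous_on_unit_square_bounded:
  assumes "continuous_on unit_square (g :: real \<times> real \<Rightarrow> real)"
  obtains B where "B > 0" "\<And>z. z \<in> unit_square \<Longrightarrow> \<bar>g z\<bar> \<le> B"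
proof -
  have "compact (g ` unit_square)"
    using assms by (intro compact_continuous_image compact_Times) auto
  then have "bounded (g ` unit_square)"
    by (rule compact_imp_bounded)
  then obtain B where "B > 0" "\<forall>x\<in>g ` unit_square. norm x \<le> B"
    by (auto simp: bounded_pos)
  then show thesis
    using that by auto
qed

lemma prob_measures_square_integrable:
  assumes "\<nu> \<in> prob_measures_square" "f \<in> borel_measurable \<nu>"
    and B: "\<And>z. z \<in> unit_square \<Longrightarrow> \<bar>f z\<bar> \<le> (B::real)"
  shows "integrable \<nu> f"
proof -
  interpret prob_space \<nu>
    using prob_measures_squareD[OF assms(1)] by simp
  show ?thesis
    using assms(2) B prob_measures_squareD[OF assms(1)]
    by (intro integrable_const_bound[of _ B]) auto
qed

lemma prob_measures_square_integrable_continuous: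
  assumes "\<nu> \<in> prob_measures_square" "continuous_on unit_square (g :: real \<times> real \<Rightarrow> real)"
  shows "integrable \<nu> g"
  using continuous_on_unit_square_bounded[OF assms(2)]
    prob_measures_square_measurable_continuous[OF assms]
    prob_measures_square_integrable[OF assms(1)] by metis

text \<open>The section \<open>s\<close> need not be continuous. Only \<open>c (s z) = z\<close> is
  used: it turns the integral of \<open>g\<close> into that of \<open>g \<circ> c\<close> against
  the measure on the line, and continuity is asked of \<open>g \<circ> c\<close> alone. Tightness on
  the line is automatic, since all mass lies in \<open>[0,1]\<close>.\<close>

lemma prob_measures_square_seq_compact:
  fixes \<nu> :: "nat \<Rightarrow> (real \<times> real) measure"
  assumes \<nu>: "\<And>n. \<nu> n \<in> prob_measures_square"
  obtains r \<kappa> where "strict_mono r" "\<kappa> \<in> prob_measures_square"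
    "\<And>g :: real \<times> real \<Rightarrow> real. continuous_on unit_square g \<Longrightarrow>
       (\<lambda>n. LINT z|\<nu> (r n). g z) \<longlonglongrightarrow> (LINT z|\<kappa>. g z)"
proof -
  obtain c :: "real \<Rightarrow> real \<times> real" where c: "continuous_on UNIV c"
    and c_range: "range c \<subseteq> unit_square" and c_onto: "unit_square \<subseteq> c ` {0..1}"
    by (rule space_filling_curve)
  \<comment> \<open>Taking the least preimage makes the section Borel: \<open>s z \<le> a\<close>
    holds exactly when some preimage in \<open>[0,1]\<close> is at most \<open>a\<close>, so the
    sublevel set is the image of a compact set.\<close>
  define s where "s z = Inf {t \<in> {0..1}. c t = z}" for z
  have s: "s z \<in> {0..1}" "c (s z) = z" and s_le: "\<And>t. t \<in> {0..1} \<Longrightarrow> c t = z \<Longrightarrow> s z \<le> t"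
    if z: "z \<in> unit_square" for z
  proof -
    have "closed (c -` {z} \<inter> {0..1})"
      using continuous_closed_vimage[of "{z}" c] c
      by (intro closed_Int) (auto simp: continuous_on_eq_continuous_at)
    then have "closed {t \<in> {0..1}. c t = z}"
      by (simp add: vimage_def Int_def conj_commute)
    moreover have "{t \<in> {0..1}. c t = z} \<noteq> {}"
      using z c_onto by force
    moreover have bdd: "bdd_below {t \<in> {0..1}. c t = z}"
      by (auto simp: bdd_below_def)
    ultimately have "s z \<in> {t \<in> {0..1}. c t = z}"
      unfolding s_def by (intro closed_contains_Inf)
    then show "s z \<in> {0..1}" "c (s z) = z" by auto
    show "s z \<le> t" if "t \<in> {0..1}" "c t = z" for t
      unfolding s_def using that bdd by (intro cInf_lower) auto
  qed
  have s_meas: "s \<in> borel_measurable (restrict_space borel unit_square)"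
    unfolding borel_measurable_iff_le
  proof
    fix a
    have eq: "{z \<in> space (restrict_space borel unit_square). s z \<le> a} = c ` ({0..1} \<inter> {..a})"
      (is "?A = ?B")
    proof
      show "?A \<subseteq> ?B"
      proof
        fix z assume "z \<in> ?A"
        then have "z \<in> unit_square" "s z \<le> a" by (simp_all add: space_restrict_space)
        then show "z \<in> ?B"
          using s(1,2)[of z] by (intro image_eqI[of _ _ "s z"]) simp_all
      qed
      show "?B \<subseteq> ?A"
      proof
        fix z assume "z \<in> ?B"
        then obtain t where t: "t \<in> {0..1}" "t \<le> a" "z = c t" by auto
        have "z \<in> unit_square" using t(3) c_range by blast
        moreover have "s z \<le> a"
          using s_le[OF \<open>z \<in> unit_square\<close> t(1) t(3)[symmetric]] t(2) by linarith
        ultimately show "z \<in> ?A"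
          by (simp add: space_restrict_space)
      qed
    qed
    have "compact (c ` ({0..1} \<inter> {..a}))"
      by (intro compact_continuous_image compact_Int_closed continuous_on_subset[OF c]
          compact_Icc closed_atMost subset_UNIV)
    then have "closed (c ` ({0..1} \<inter> {..a}))"
      by (rule compact_imp_closed)
    then show "{z \<in> space (restrict_space borel unit_square). s z \<le> a}
        \<in> sets (restrict_space borel unit_square)"
      unfolding eq using c_range unit_square_borel by (subst sets_restrict_space_iff) auto
  qed
  have s_meas': "s \<in> borel_measurable (\<nu> n)" for n
    unfolding prob_measures_square_measurable[OF \<nu>] by (rule s_meas)
  define m where "m n = distr (\<nu> n) borel s" for n
  have m: "real_distribution (m n)" for n
    unfolding m_def using prob_space.real_distribution_distr[OF _ s_meas']
        prob_measures_squareD(1)[OF \<nu>]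
    by blast
  have "tight m"
    unfolding tight_def
  proof (intro conjI allI impI m)
    fix \<epsilon> :: real assume "\<epsilon> > 0"
    \<comment> \<open>Tightness speaks of intervals open on the left, so the left end must lie below
      0.\<close>
    have "measure (m n) {-1<..1} > 1 - \<epsilon>" for n
    proof -
      interpret prob_space "\<nu> n" using prob_measures_squareD(1)[OF \<nu>] .
      have "s -` {-1<..1} \<inter> space (\<nu> n) = space (\<nu> n)"
        using s(1) prob_measures_squareD(3)[OF \<nu>] by fastforce
      then have "measure (m n) {-1<..1} = 1"
        unfolding m_def by (subst measure_distr[OF s_meas']) (auto simp: prob_space)
      then show ?thesis using \<open>\<epsilon> > 0\<close> by simp
    qed
    then show "\<exists>a b. a < b \<and> (\<forall>n. 1 - \<epsilon> < measure (m n) {a<..b})"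
      by (intro exI[of _ "-1"] exI[of _ 1]) auto
  qed
  then obtain r M where r: "strict_mono (r :: nat \<Rightarrow> nat)" and M: "real_distribution M"
    and conv: "weak_conv_m (m \<circ> id \<circ> r) M"
    using tight_imp_convergent_subsubsequence[OF \<open>tight m\<close> strict_mono_id] by blast
  interpret M: real_distribution M by fact
  define \<kappa> where "\<kappa> = distr M (restrict_space borel unit_square) c"
  have c_meas: "c \<in> measurable M (restrict_space borel unit_square)"
  proof (intro measurable_restrict_space2)
    show "c \<in> space M \<rightarrow> unit_square"
      using c_range by blast
    show "c \<in> borel_measurable M"
      unfolding measurable_cong_sets[OF M.events_eq_borel refl] using c
          by (rule borel_measurable_continuous_onI)
  qed
  have \<kappa>: "\<kappa> \<in> prob_measures_square"
    using M.prob_space_distr[OF c_meas] by (simp add: \<kappa>_def prob_measures_square_def)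
  show thesis
  proof (rule that[OF r \<kappa>])
    fix g :: "real \<times> real \<Rightarrow> real" assume g: "continuous_on unit_square g"
    obtain B where B: "\<And>z. z \<in> unit_square \<Longrightarrow> \<bar>g z\<bar> \<le> B"
      using continuous_on_unit_square_bounded[OF g] by metis
    have gc: "continuous_on UNIV (\<lambda>t. g (c t))"
      by (rule continuous_on_compose2[OF g c c_range])
    have "(\<lambda>n. LINT t|(m \<circ> id \<circ> r) n. g (c t)) \<longlonglongrightarrow> (LINT t|M. g (c t))"
    proof (rule weak_conv_imp_integral_bdd_continuous_conv[OF _ M conv])
      show "real_distribution ((m \<circ> id \<circ> r) n)" for n using m by simp
      show "isCont (\<lambda>t. g (c t)) x" for x using gc by (simp add: continuous_on_eq_continuous_at)
      show "norm (g (c x)) \<le> B" for x using B[of "c x"] c_range by (simp add: range_subsetD)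
    qed
    moreover have "(LINT t|(m \<circ> id \<circ> r) n. g (c t)) = (LINT z|\<nu> (r n). g z)" for n
    proof -
      have "(LINT t|(m \<circ> id \<circ> r) n. g (c t)) = (LINT z|\<nu> (r n). g (c (s z)))"
        unfolding comp_def id_def m_def using gc
        by (intro integral_distr[OF s_meas']) (rule borel_measurable_continuous_onI)
      also have "\<dots> = (LINT z|\<nu> (r n). g z)"
        using s(2) prob_measures_squareD(3)[OF \<nu>] by (intro Bochner_Integration.integral_cong) auto
      finally show ?thesis .
    qed
    moreover have "(LINT t|M. g (c t)) = (LINT z|\<kappa>. g z)"
      unfolding \<kappa>_def using borel_measurable_continuous_on_restrict[OF g]
      by (intro integral_distr[OF c_meas, symmetric])
    ultimately show "(\<lambda>n. LINT z|\<nu> (r n). g z) \<longlonglongrightarrow> (LINT z|\<kappa>. g z)"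
      by simp
  qed
qed

text \<open>Regularity squeezes \<open>A\<close> between a compact and an open set for each measure,
  and a Urysohn function differs from the indicator only in between. One \<open>g\<close> has to
  serve all the measures, because later the same function must be close for Lebesgue measure and for
  both marginals.\<close>

lemma finite_borel_measure_approx_set:
  fixes \<M> :: "'a::euclidean_space measure set"
  assumes \<M>: "finite \<M>" "\<And>M. M \<in> \<M> \<Longrightarrow> finite_measure M \<and> sets M = sets borel"
    and A: "A \<in> sets borel" and "\<epsilon> > 0"
  obtains g :: "'a \<Rightarrow> real" where "continuous_on UNIV g" "\<And>x. g x \<in> {0..1}"
    "\<And>M. M \<in> \<M> \<Longrightarrow> (LINT x|M. \<bar>indicator A x - g x\<bar>) \<le> \<epsilon>"
proof -
  have "\<exists>K U. compact K \<and> open U \<and> K \<subseteq> A \<and> A \<subseteq> U \<and> measure M (U - K) \<le> \<epsilon>"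
    if M: "M \<in> \<M>" for M
  proof -
    interpret finite_measure M using \<M>(2)[OF M] by simp
    have s: "sets M = sets borel" using \<M>(2)[OF M] by simp
    have "\<epsilon>/2 > 0" using \<open>\<epsilon> > 0\<close> by simp
    have fin: "emeasure M A \<noteq> top" by simp
    have "\<exists>K\<in>{K. K \<subseteq> A \<and> compact K}. emeasure M A < emeasure M K + ennreal (\<epsilon>/2)"
    proof (rule SUP_approx_ennreal[OF \<open>\<epsilon>/2 > 0\<close>])
      show "emeasure M A = (SUP K\<in>{K. K \<subseteq> A \<and> compact K}. emeasure M K)"
        using inner_regular[OF s _ A] by simp
    qed (use fin in auto)
    then obtain K where K: "K \<subseteq> A" "compact K" "emeasure M A < emeasure M K + ennreal (\<epsilon>/2)"
        by blast
    have "\<exists>U\<in>{U. A \<subseteq> U \<and> open U}. emeasure M U < emeasure M A + ennreal (\<epsilon>/2)"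
    proof (rule INF_approx_ennreal)
      show "emeasure M A = (INF U\<in>{U. A \<subseteq> U \<and> open U}. emeasure M U)"
        using outer_regular[OF s _ A] by simp
    qed (use fin \<open>\<epsilon>/2 > 0\<close> in auto)
    then obtain U where U: "A \<subseteq> U" "open U" "emeasure M U < emeasure M A + ennreal (\<epsilon>/2)" by blast
    have sets: "K \<in> sets M" "U \<in> sets M" "A \<in> sets M"
      using K U A s by (auto simp: compact_imp_closed)
    have "measure M A < measure M K + \<epsilon>/2" "measure M U < measure M A + \<epsilon>/2"
      using K(3) U(3) \<open>\<epsilon> > 0\<close>
      by (auto simp: emeasure_eq_measure ennreal_plus[symmetric] ennreal_less_iff simp del:
          ennreal_plus)
    moreover have "measure M (U - K) = measure M U - measure M K"
      using sets K U by (intro finite_measure_Diff) auto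
    ultimately show ?thesis
      using K U by (intro exI[of _ K] exI[of _ U]) auto
  qed
  then obtain K U where KU: "\<And>M. M \<in> \<M> \<Longrightarrow> compact (K M) \<and> open (U M) \<and> K M \<subseteq> A \<and> A \<subseteq> U M \<and>
      measure M (U M - K M) \<le> \<epsilon>"
    by metis
  \<comment> \<open>Finiteness of the family keeps the union closed and the intersection open.
    Passing to them only narrows the gap for each single measure.\<close>
  define K' where "K' = (\<Union>M\<in>\<M>. K M)"
  define U' where "U' = (\<Inter>M\<in>\<M>. U M)"
  have K': "closed K'" "K' \<subseteq> A" and U': "open U'" "A \<subseteq> U'"
    using KU \<M>(1) by (auto simp: K'_def U'_def compact_imp_closed)
  obtain g :: "'a \<Rightarrow> real" where g: "continuous_on UNIV g" "\<And>x. g x \<in> closed_segment 1 0"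
      "\<And>x. x \<in> K' \<Longrightarrow> g x = 1" "\<And>x. x \<in> - U' \<Longrightarrow> g x = 0"
    by (rule Urysohn_local[of UNIV K' "- U'" 1 "0::real"]) (use K' U' in auto)
  have g01: "g x \<in> {0..1}" for x
    using g(2)[of x] by (auto simp: closed_segment_eq_real_ivl split: if_splits)
  show thesis
  proof (rule that[OF g(1) g01])
    fix M assume M: "M \<in> \<M>"
    interpret finite_measure M using \<M>(2)[OF M] by simp
    have s: "sets M = sets borel" using \<M>(2)[OF M] by simp
    have meas: "g \<in> borel_measurable M" "(\<lambda>x. indicator A x - g x) \<in> borel_measurable M"
      using borel_measurable_continuous_onI[OF g(1)] A s
      by (auto simp: measurable_cong_sets[OF s refl])
    have "(LINT x|M. \<bar>indicator A x - g x\<bar>) \<le> (LINT x|M. indicator (U M - K M) x)"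
    proof (rule integral_mono_AE)
      show "integrable M (\<lambda>x. \<bar>indicator A x - g x\<bar>)"
        by (rule integrable_const_bound[of _ 1])
           (use meas g01 in \<open>auto simp: indicator_def\<close>)
      show "integrable M (indicator (U M - K M) :: 'a \<Rightarrow> real)"
        using KU[OF M] s by (intro integrable_real_indicator) (auto simp: compact_imp_closed
            less_top[symmetric])
      show "AE x in M. \<bar>indicator A x - g x\<bar> \<le> indicator (U M - K M) x"
      proof (rule AE_I2)
        fix x
        consider "x \<in> K M" | "x \<notin> U M" | "x \<in> U M - K M" by blast
        then show "\<bar>indicator A x - g x\<bar> \<le> indicator (U M - K M) x"
        proof cases
          case 1
          then have "g x = 1" "x \<in> A" using g(3) M KU[OF M] by (auto simp: K'_def)
          then show ?thesis by simp
        next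
          case 2
          then have "g x = 0" "x \<notin> A" using g(4) M KU[OF M] by (auto simp: U'_def)
          then show ?thesis by simp
        next
          case 3
          then show ?thesis using g01[of x] by (auto simp: indicator_def)
        qed
      qed
    qed
    also have "\<dots> = measure M (U M - K M)"
      using sets_eq_imp_space_eq[OF s] by simp
    also have "\<dots> \<le> \<epsilon>" using KU[OF M] by simp
    finally show "(LINT x|M. \<bar>indicator A x - g x\<bar>) \<le> \<epsilon>" .
  qed
qed

text \<open>The approximation applied to the pair of measures yields one continuous \<open>g\<close>
  that is near the indicator for both of them.\<close>

lemma finite_borel_measure_eqI:
  fixes M N :: "'a::euclidean_space measure"
  assumes M: "finite_measure M" "sets M = sets borel" and N: "finite_measure N" "sets N =
      sets borel"
    and eq: "\<And>g :: 'a \<Rightarrow> real. continuous_on UNIV g \<Longrightarrow> (\<And>x. g x \<in> {0..1}) \<Longrightarrow>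
      (LINT x|M. g x) = (LINT x|N. g x)"
  shows "M = N"
proof (rule measure_eqI)
  show "sets M = sets N"
    using M N by simp
  fix A assume "A \<in> sets M"
  then have A: "A \<in> sets borel"
    using M by simp
  have close: "\<bar>measure L A - (LINT x|L. g x)\<bar> \<le> \<epsilon>"
    if L: "finite_measure L" "sets L = sets borel" and g: "continuous_on UNIV g" "\<And>x. g x \<in> {0..1}"
      and le: "(LINT x|L. \<bar>indicator A x - g x\<bar>) \<le> \<epsilon>" for L :: "'a measure" and g \<epsilon>
  proof -
    interpret finite_measure L by fact
    have "g \<in> borel_measurable L"
      unfolding measurable_cong_sets[OF L(2) refl]
          by (rule borel_measurable_continuous_onI[OF g(1)])
    then have "integrable L g"
      using g(2) by (intro integrable_const_bound[of _ 1] AE_I2) simp_all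
    moreover have "integrable L (indicator A :: 'a \<Rightarrow> real)"
      using A L(2) by (intro integrable_real_indicator) (simp_all add: less_top[symmetric])
    ultimately have "measure L A - (LINT x|L. g x) = (LINT x|L. indicator A x - g x)"
      using sets_eq_imp_space_eq[OF L(2)] by simp
    then show ?thesis
      using integral_abs_bound[of L "\<lambda>x. indicator A x - g x"] le by linarith
  qed
  have "\<bar>measure M A - measure N A\<bar> \<le> \<epsilon>" if "\<epsilon> > 0" for \<epsilon>
  proof -
    have fin: "finite {M, N}" "\<And>L. L \<in> {M, N} \<Longrightarrow> finite_measure L \<and> sets L = sets borel"
      using M N by auto
    have "\<epsilon>/2 > 0" using that by simp
    obtain g :: "'a \<Rightarrow> real" where g: "continuous_on UNIV g" "\<And>x. g x \<in> {0..1}"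
      and le: "\<And>L. L \<in> {M, N} \<Longrightarrow> (LINT x|L. \<bar>indicator A x - g x\<bar>) \<le> \<epsilon>/2"
      using finite_borel_measure_approx_set[OF fin A \<open>\<epsilon>/2 > 0\<close>] by blast
    have "\<bar>measure M A - (LINT x|M. g x)\<bar> \<le> \<epsilon>/2" "\<bar>measure N A - (LINT x|N. g x)\<bar> \<le> \<epsilon>/2"
      using close[OF M g le] close[OF N g le] by simp_all
    then show ?thesis
      using eq[OF g] by linarith
  qed
  then have "\<bar>measure M A - measure N A\<bar> \<le> 0"
    by (rule field_le_epsilon) simp
  then show "emeasure M A = emeasure N A"
    using M(1) N(1) by (simp add: finite_measure.emeasure_eq_measure)
qed

section \<open>The measures \<open>\<Phi>(f,\<mu>)\<close>\<close>

text \<open>Including the square into the plane reduces this to Borel measures on a Euclidean space,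
  so test functions continuous on the whole plane are enough.\<close>

lemma prob_measures_square_eqI:
  assumes \<nu>: "\<nu> \<in> prob_measures_square" and \<kappa>: "\<kappa> \<in> prob_measures_square"
    and eq: "\<And>g :: real \<times> real \<Rightarrow> real. continuous_on UNIV g \<Longrightarrow> (LINT z|\<nu>. g z) = (LINT z|\<kappa>. g z)"
  shows "\<nu> = \<kappa>"
proof -
  have id: "(\<lambda>z. z) \<in> measurable \<tau> borel" if "\<tau> \<in> prob_measures_square" for \<tau>
    using that by (rule prob_measures_square_measurable_borel) simp
  have fin: "finite_measure (distr \<tau> borel (\<lambda>z. z))" if "\<tau> \<in> prob_measures_square" for \<tau>
    using prob_space.prob_space_distr[OF prob_measures_squareD(1)[OF that] id[OF that]]
    by (rule prob_space.finite_measure)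
  have borel_eq: "distr \<nu> borel (\<lambda>z. z) = distr \<kappa> borel (\<lambda>z. z)"
  proof (rule finite_borel_measure_eqI[OF fin[OF \<nu>] _ fin[OF \<kappa>]])
    fix g :: "real \<times> real \<Rightarrow> real" assume g: "continuous_on UNIV g"
    then have "g \<in> borel_measurable borel"
      by (rule borel_measurable_continuous_onI)
    then show "(LINT z|distr \<nu> borel (\<lambda>z. z). g z) = (LINT z|distr \<kappa> borel (\<lambda>z. z). g z)"
      using eq[OF g] by (simp add: integral_distr id \<nu> \<kappa>)
  qed simp_all
  show ?thesis
  proof (rule measure_eqI)
    show "sets \<nu> = sets \<kappa>"
      using prob_measures_squareD(2)[OF \<nu>] prob_measures_squareD(2)[OF \<kappa>] by simp
    fix A assume "A \<in> sets \<nu>"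
    then have A: "A \<in> sets borel" "A \<subseteq> unit_square"
      unfolding prob_measures_squareD(2)[OF \<nu>]
      using sets_restrict_space_iff[of unit_square borel A] unit_square_borel by auto
    have "emeasure \<tau> A = emeasure (distr \<tau> borel (\<lambda>z. z)) A" if "\<tau> \<in> prob_measures_square" for \<tau>
      using A prob_measures_squareD(3)[OF that]
      by (subst emeasure_distr[OF id[OF that]]) (simp_all add: Int_absorb2)
    then show "emeasure \<nu> A = emeasure \<kappa> A"
      using \<nu> \<kappa> borel_eq by simp
  qed
qed

section \<open>Lebesgue measure on the interval and the square, symmetry and Fubini\<close>

lemma leb1_simps [simp]: "space leb1 = unit_interval" "sets leb1 =
    sets (restrict_space borel unit_interval)"
  by (simp_all add: leb1_def space_restrict_space sets_restrict_space)

lemma measurable_leb1: "measurable leb1 N = measurable (restrict_space borel unit_interval) N"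
  by (rule measurable_cong_sets) simp_all

lemma prob_space_leb1: "prob_space leb1"
  by (rule prob_spaceI) (simp add: leb1_def emeasure_restrict_space space_restrict_space)

lemma leb1_integrable:
  fixes f :: "real \<Rightarrow> real"
  assumes "f \<in> borel_measurable leb1" "\<And>x. x \<in> unit_interval \<Longrightarrow> \<bar>f x\<bar> \<le> B"
  shows "integrable leb1 f"
proof -
  interpret prob_space leb1 by (rule prob_space_leb1)
  show ?thesis
    using assms by (intro integrable_const_bound[of _ B]) auto
qed

text \<open>Each inclusion is measurability of the identity, written as a pair of projections,
  between the two spaces. Second countability makes the pairing of Borel functions Borel.\<close>

lemma sets_restrict_space_Times:
  fixes A :: "'a::second_countable_topology set" and B :: "'b::second_countable_topology set"
  shows "sets (restrict_space borel (A \<times> B)) =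
     sets (restrict_space borel A \<Otimes>\<^sub>M restrict_space borel B)" (is "sets ?L = sets ?R")
proof
  have sp: "space ?L = A \<times> B" "space ?R = A \<times> B"
    by (simp_all add: space_restrict_space space_pair_measure)
  have "(\<lambda>z. (fst z, snd z)) \<in> measurable ?L ?R"
  proof (intro measurable_Pair measurable_restrict_space2)
    show "fst \<in> borel_measurable ?L" "snd \<in> borel_measurable ?L"
      by (intro measurable_restrict_space1 borel_measurable_continuous_onI continuous_intros)+
  qed (auto simp: sp)
  then have "(\<lambda>z. (fst z, snd z)) -` X \<inter> space ?L \<in> sets ?L" if "X \<in> sets ?R" for X
    using that by (rule measurable_sets)
  moreover have "X \<subseteq> A \<times> B" if "X \<in> sets ?R" for X
    using sets.sets_into_space[OF that] sp by simp
  ultimately show "sets ?R \<subseteq> sets ?L"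
    by (simp add: sp Int_absorb2 subset_iff)
  have "(\<lambda>z. (fst z, snd z)) \<in> measurable ?R ?L"
  proof (intro measurable_restrict_space2)
    have "fst \<in> borel_measurable ?R" "snd \<in> borel_measurable ?R"
      using measurable_fst[of "restrict_space borel A" "restrict_space borel B"]
        measurable_snd[of "restrict_space borel A" "restrict_space borel B"]
      by (simp_all add: measurable_restrict_space2_iff)
    then show "(\<lambda>z. (fst z, snd z)) \<in> borel_measurable ?R"
      by (rule borel_measurable_Pair)
  qed (auto simp: sp)
  then have "(\<lambda>z. (fst z, snd z)) -` X \<inter> space ?R \<in> sets ?R" if "X \<in> sets ?L" for X
    using that by (rule measurable_sets)
  moreover have "X \<subseteq> A \<times> B" if "X \<in> sets ?L" for X
    using sets.sets_into_space[OF that] sp by simp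
  ultimately show "sets ?L \<subseteq> sets ?R"
    by (simp add: sp Int_absorb2 subset_iff)
qed

lemma leb2_eq_pair: "leb2 = leb1 \<Otimes>\<^sub>M leb1"
proof (rule pair_measure_eqI[symmetric])
  interpret prob_space leb1 by (rule prob_space_leb1)
  show "sigma_finite_measure leb1" "sigma_finite_measure leb1"
    by unfold_locales
  show "sets (leb1 \<Otimes>\<^sub>M leb1) = sets leb2"
  proof -
    have "sets (leb1 \<Otimes>\<^sub>M leb1) = sets (restrict_space borel unit_interval \<Otimes>\<^sub>M restrict_space borel
        unit_interval)"
      by (rule sets_pair_measure_cong) simp_all
    also have "\<dots> = sets (restrict_space borel unit_square)"
      by (rule sets_restrict_space_Times[symmetric])
    also have "\<dots> = sets leb2"
      unfolding leb2_def by (simp add: sets_restrict_space)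
    finally show ?thesis .
  qed
  fix A B assume "A \<in> sets leb1" "B \<in> sets leb1"
  then have A: "A \<in> sets borel" "A \<subseteq> unit_interval" and B: "B \<in> sets borel" "B \<subseteq> unit_interval"
    using sets_restrict_space_iff[of unit_interval borel A] sets_restrict_space_iff[of
        unit_interval borel B]
    by simp_all
  have "emeasure leb2 (A \<times> B) = emeasure (lborel \<Otimes>\<^sub>M lborel) (A \<times> B)"
    unfolding leb2_def lborel_prod using A B unit_square_borel
    by (subst emeasure_restrict_space) (simp_all add: Sigma_mono)
  also have "\<dots> = emeasure lborel A * emeasure lborel B"
    using A B by (subst lborel.emeasure_pair_measure_Times) simp_all
  also have "\<dots> = emeasure leb1 A * emeasure leb1 B"
    unfolding leb1_def using A B by (simp add: emeasure_restrict_space)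
  finally show "emeasure leb1 A * emeasure leb1 B = emeasure leb2 (A \<times> B)" ..
qed

lemma leb2_prob_measures_square: "leb2 \<in> prob_measures_square"
proof -
  interpret prob_space leb1 by (rule prob_space_leb1)
  interpret pair_prob_space leb1 leb1 ..
  have "prob_space leb2"
    unfolding leb2_eq_pair by unfold_locales
  then show ?thesis
    by (simp add: prob_measures_square_def leb2_def sets_restrict_space)
qed

lemma s_graphonsD:
  assumes "\<mu> \<in> s_graphons"
  shows "\<mu> \<in> prob_measures_square" "distr \<mu> \<mu> prod.swap = \<mu>"
  using assms by (simp_all add: s_graphons_def)

lemma prob_measures_square_measurable_swap:
  assumes "\<mu> \<in> prob_measures_square"
  shows "prod.swap \<in> measurable \<mu> \<mu>"
proof -
  have "prod.swap \<in> measurable (restrict_space borel unit_square) (restrict_space borel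
      unit_square)"
  proof (intro measurable_restrict_space2 measurable_restrict_space1)
    have "continuous_on UNIV (prod.swap :: real \<times> real \<Rightarrow> _)"
      by (rule continuous_on_swap)
    then show "prod.swap \<in> borel_measurable (borel :: (real \<times> real) measure)"
      by (rule borel_measurable_continuous_onI)
  qed (auto simp: space_restrict_space)
  then show ?thesis
    using prob_measures_squareD(2)[OF assms] measurable_cong_sets by blast
qed

lemma s_graphons_integral_swap:
  fixes f :: "real \<times> real \<Rightarrow> real"
  assumes "\<mu> \<in> s_graphons" "f \<in> borel_measurable \<mu>"
  shows "(LINT z|\<mu>. f (prod.swap z)) = (LINT z|\<mu>. f z)"
  using integral_distr[OF prob_measures_square_measurable_swap[OF s_graphonsD(1)[OF assms(1)]]
      assms(2)]
    s_graphonsD(2)[OF assms(1)] by simp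

text \<open>Symmetry tested on continuous functions passes to weak limits, which is how limits of
  s-graphons are recognised as s-graphons.\<close>

lemma s_graphonsI:
  assumes \<mu>: "\<mu> \<in> prob_measures_square"
    and swap: "\<And>g :: real \<times> real \<Rightarrow> real. continuous_on UNIV g \<Longrightarrow>
      (LINT z|\<mu>. g (prod.swap z)) = (LINT z|\<mu>. g z)"
  shows "\<mu> \<in> s_graphons"
proof -
  have sw: "prod.swap \<in> measurable \<mu> \<mu>"
    using \<mu> by (rule prob_measures_square_measurable_swap)
  have "distr \<mu> \<mu> prod.swap = \<mu>"
  proof (rule prob_measures_square_eqI[OF _ \<mu>])
    show "distr \<mu> \<mu> prod.swap \<in> prob_measures_square"
      using prob_space.prob_space_distr[OF prob_measures_squareD(1)[OF \<mu>] sw]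
          prob_measures_squareD(2)[OF \<mu>]
      by (simp add: prob_measures_square_def)
    fix g :: "real \<times> real \<Rightarrow> real" assume g: "continuous_on UNIV g"
    then have "g \<in> borel_measurable \<mu>"
      by (intro prob_measures_square_measurable_continuous[OF \<mu>] continuous_on_subset[OF g]
          subset_UNIV)
    then show "(LINT z|distr \<mu> \<mu> prod.swap. g z) = (LINT z|\<mu>. g z)"
      by (simp add: integral_distr[OF sw] swap[OF g])
  qed
  then show ?thesis
    using \<mu> by (simp add: s_graphons_def)
qed

lemma leb2_s_graphons: "leb2 \<in> s_graphons"
proof -
  interpret prob_space leb1 by (rule prob_space_leb1)
  interpret pair_prob_space leb1 leb1 ..
  have "(\<lambda>(x, y). (y, x)) = (prod.swap :: real \<times> real \<Rightarrow> _)"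
    by (simp add: fun_eq_iff)
  then have "distr leb2 leb2 prod.swap = leb2"
    unfolding leb2_eq_pair using distr_pair_swap by simp
  then show ?thesis
    using leb2_prob_measures_square by (simp add: s_graphons_def)
qed

lemma leb2_integral_prod:
  fixes a b :: "real \<Rightarrow> real"
  assumes "integrable leb1 a" "integrable leb1 b"
  shows "(LINT w|leb2. a (fst w) * b (snd w)) = (LINT u|leb1. a u) * (LINT v|leb1. b v)"
    and "integrable leb2 (\<lambda>w. a (fst w) * b (snd w))"
proof -
  interpret L: prob_space leb1 by (rule prob_space_leb1)
  interpret pair_prob_space leb1 leb1 ..
  have [measurable]: "a \<in> borel_measurable leb1" "b \<in> borel_measurable leb1"
    using assms by (simp_all add: borel_measurable_integrable)
  have int: "integrable (leb1 \<Otimes>\<^sub>M leb1) (\<lambda>w. a (fst w) * b (snd w))"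
  proof (rule Fubini_integrable)
    show "(\<lambda>w. a (fst w) * b (snd w)) \<in> borel_measurable (leb1 \<Otimes>\<^sub>M leb1)"
      by measurable
  qed (use assms in \<open>simp_all add: abs_mult\<close>)
  then show "integrable leb2 (\<lambda>w. a (fst w) * b (snd w))"
    by (simp add: leb2_eq_pair)
  show "(LINT w|leb2. a (fst w) * b (snd w)) = (LINT u|leb1. a u) * (LINT v|leb1. b v)"
    unfolding leb2_eq_pair using integral_fst'[OF int] by simp
qed

lemma prob_measures_square_Fubini:
  fixes h :: "(real \<times> real) \<Rightarrow> (real \<times> real) \<Rightarrow> real"
  assumes \<nu>: "\<nu> \<in> prob_measures_square" and \<kappa>: "\<kappa> \<in> prob_measures_square"
    and h: "(\<lambda>(z, w). h z w) \<in> borel_measurable (\<nu> \<Otimes>\<^sub>M \<kappa>)"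
    and B: "\<And>z w. z \<in> unit_square \<Longrightarrow> w \<in> unit_square \<Longrightarrow> \<bar>h z w\<bar> \<le> B"
  shows "(LINT w|\<kappa>. LINT z|\<nu>. h z w) = (LINT z|\<nu>. LINT w|\<kappa>. h z w)"
proof -
  interpret N: prob_space \<nu> using \<nu> by (rule prob_measures_squareD)
  interpret K: prob_space \<kappa> using \<kappa> by (rule prob_measures_squareD)
  interpret pair_prob_space \<nu> \<kappa> ..
  have "AE x in \<nu> \<Otimes>\<^sub>M \<kappa>. norm (case x of (z, w) \<Rightarrow> h z w) \<le> B"
  proof (rule AE_I2)
    fix x assume "x \<in> space (\<nu> \<Otimes>\<^sub>M \<kappa>)"
    then have "fst x \<in> unit_square" "snd x \<in> unit_square"
      unfolding space_pair_measure prob_measures_squareD(3)[OF \<nu>] prob_measures_squareD(3)[OF \<kappa>]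
        mem_Times_iff by blast+
    from B[OF this] show "norm (case x of (z, w) \<Rightarrow> h z w) \<le> B"
      by (simp add: case_prod_beta')
  qed
  then have "integrable (\<nu> \<Otimes>\<^sub>M \<kappa>) (\<lambda>(z, w). h z w)"
    by (rule P.integrable_const_bound[OF _ h])
  then show ?thesis
    by (rule Fubini_integral)
qed

section \<open>Fairly distributed kernels and the map \<open>Phi\<close>\<close>

lemma FDD:
  assumes "f \<in> FD"
  shows "f \<in> borel_measurable (restrict_space borel unit_square)"
    and "\<And>x y. x \<in> unit_interval \<Longrightarrow> y \<in> unit_interval \<Longrightarrow> 0 \<le> f (x, y)"
    and "\<And>x. x \<in> unit_interval \<Longrightarrow> (LINT v|leb1. f (x, v)) = 1"
    and "\<And>y. y \<in> unit_interval \<Longrightarrow> (LINT u|leb1. f (u, y)) = 1"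
  using assms by (simp_all add: FD_def)

lemma FD_bound:
  assumes "f \<in> FD"
  obtains B where "B > 0" "\<And>x y. x \<in> unit_interval \<Longrightarrow> y \<in> unit_interval \<Longrightarrow> \<bar>f (x, y)\<bar> \<le> B"
proof -
  have "bounded (f ` unit_square)" using assms by (simp add: FD_def)
  then obtain B where B: "B > 0" "\<forall>x\<in>f ` unit_square. norm x \<le> B"
    unfolding bounded_pos by blast
  show thesis
  proof (rule that[OF B(1)])
    fix x y :: real assume "x \<in> unit_interval" "y \<in> unit_interval"
    then have "f (x, y) \<in> f ` unit_square" by blast
    then show "\<bar>f (x, y)\<bar> \<le> B" using B(2) by (metis real_norm_def)
  qed
qed

lemma borel_measurable_restrict_square_compose:
  fixes f :: "real \<times> real \<Rightarrow> real"
  assumes f: "f \<in> borel_measurable (restrict_space borel unit_square)"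
    and ab: "a \<in> borel_measurable M" "b \<in> borel_measurable M"
    and "\<And>x. x \<in> space M \<Longrightarrow> a x \<in> unit_interval" "\<And>x. x \<in> space M \<Longrightarrow> b x \<in> unit_interval"
  shows "(\<lambda>x. f (a x, b x)) \<in> borel_measurable M"
proof -
  have "(\<lambda>x. (a x, b x)) \<in> measurable M (restrict_space borel unit_square)"
    using assms(4,5) by (intro measurable_restrict_space2 borel_measurable_Pair ab) blast
  then show ?thesis
    using f by (rule measurable_compose)
qed

lemma FD_integrable_fst:
  assumes f: "f \<in> FD" and x: "x \<in> unit_interval"
  shows "integrable leb1 (\<lambda>u. f (x, u))"
proof -
  obtain B where "\<And>x y. x \<in> unit_interval \<Longrightarrow> y \<in> unit_interval \<Longrightarrow> \<bar>f (x, y)\<bar> \<le> B"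
    using FD_bound[OF f] by metis
  moreover have "(\<lambda>u. f (x, u)) \<in> borel_measurable leb1"
    by (rule borel_measurable_restrict_square_compose[OF FDD(1)[OF f]])
      (use x in \<open>simp_all add: measurable_leb1 measurable_restrict_space1\<close>)
  ultimately show ?thesis
    using x by (intro leb1_integrable)
qed

lemma prob_measures_square_fst_snd:
  assumes "\<nu> \<in> prob_measures_square"
  shows "fst \<in> borel_measurable \<nu>" "snd \<in> borel_measurable \<nu>"
  by (intro prob_measures_square_measurable_borel[OF assms] borel_measurable_continuous_onI
      continuous_intros)+

text \<open>The factor \<open>g\<close> is carried along so that the density (with \<open>g\<close>
  constant 1) and integrals against it are covered together.\<close>

lemma Phi_kernel_measurable:
  assumes f: "f \<in> FD" and \<mu>: "\<mu> \<in> prob_measures_square" and \<nu>: "\<nu> \<in> prob_measures_square"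
    and g: "g \<in> borel_measurable \<nu>"
  shows "(\<lambda>(z, w). f (fst z, fst w) * f (snd z, snd w) * g w :: real) \<in> borel_measurable (\<mu> \<Otimes>\<^sub>M \<nu>)"
proof -
  note [measurable] = prob_measures_square_fst_snd[OF \<mu>] prob_measures_square_fst_snd[OF \<nu>] g
  have sp: "fst (fst x) \<in> unit_interval" "snd (fst x) \<in> unit_interval"
      "fst (snd x) \<in> unit_interval" "snd (snd x) \<in> unit_interval" if "x \<in> space (\<mu> \<Otimes>\<^sub>M \<nu>)" for x
    using that unfolding space_pair_measure prob_measures_squareD(3)[OF \<mu>]
        prob_measures_squareD(3)[OF \<nu>]
      mem_Times_iff by blast+
  have "(\<lambda>x. f (fst (fst x), fst (snd x))) \<in> borel_measurable (\<mu> \<Otimes>\<^sub>M \<nu>)"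
    by (rule borel_measurable_restrict_square_compose[OF FDD(1)[OF f] _ _ sp(1) sp(3)]) measurable
  moreover have "(\<lambda>x. f (snd (fst x), snd (snd x))) \<in> borel_measurable (\<mu> \<Otimes>\<^sub>M \<nu>)"
    by (rule borel_measurable_restrict_square_compose[OF FDD(1)[OF f] _ _ sp(2) sp(4)]) measurable
  ultimately show ?thesis
    unfolding case_prod_beta' by measurable
qed

lemma phi_eq: "phi f \<mu> w = (LINT z|\<mu>. f (fst z, fst w) * f (snd z, snd w))"
  by (simp add: phi_def case_prod_beta')

lemma phi_measurable:
  assumes f: "f \<in> FD" and \<mu>: "\<mu> \<in> prob_measures_square"
  shows "phi f \<mu> \<in> borel_measurable leb2"
proof -
  interpret prob_space \<mu> using \<mu> by (rule prob_measures_squareD)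
  have "(\<lambda>(z, w). f (fst z, fst w) * f (snd z, snd w)) \<in> borel_measurable (\<mu> \<Otimes>\<^sub>M leb2)"
    using Phi_kernel_measurable[OF f \<mu> leb2_prob_measures_square, of "\<lambda>_. 1"] by simp
  then have "(\<lambda>(w, z). f (fst z, fst w) * f (snd z, snd w)) \<in> borel_measurable (leb2 \<Otimes>\<^sub>M \<mu>)"
    by (subst measurable_pair_swap_iff) (simp add: case_prod_beta')
  then have "(\<lambda>w. LINT z|\<mu>. f (fst z, fst w) * f (snd z, snd w)) \<in> borel_measurable leb2"
    by (rule borel_measurable_lebesgue_integral)
  then show ?thesis
    unfolding phi_eq[abs_def] .
qed

lemma phi_nonneg:
  assumes f: "f \<in> FD" and \<mu>: "\<mu> \<in> prob_measures_square" and w: "w \<in> unit_square"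
  shows "0 \<le> phi f \<mu> w"
  unfolding phi_eq
proof (intro integral_nonneg_AE AE_I2 mult_nonneg_nonneg)
  fix z assume "z \<in> space \<mu>"
  then have "z \<in> unit_square"
    by (simp add: prob_measures_squareD(3)[OF \<mu>])
  then show "0 \<le> f (fst z, fst w)" "0 \<le> f (snd z, snd w)"
    using w unfolding mem_Times_iff by (intro FDD(2)[OF f]; blast)+
qed

text \<open>With the Lebesgue integral inside, the kernel is integrated in its second arguments
  only. For a tensor \<open>g\<close> the inner integral then splits into two one-dimensional
  averages; this is how the total mass and the quotient matrices are computed.\<close>

lemma integral_Phi:
  assumes f: "f \<in> FD" and \<mu>: "\<mu> \<in> prob_measures_square"
    and g: "g \<in> borel_measurable leb2" "\<And>w. w \<in> unit_square \<Longrightarrow> \<bar>g w\<bar> \<le> (C::real)"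
  shows "(LINT w|Phi f \<mu>. g w) = (LINT z|\<mu>. LINT w|leb2. f (fst z, fst w) * f (snd z, snd w) * g w)"
proof -
  obtain B where "B > 0" and B: "\<And>x y. x \<in> unit_interval \<Longrightarrow> y \<in> unit_interval \<Longrightarrow> \<bar>f (x, y)\<bar> \<le> B"
    using FD_bound[OF f] by metis
  note leb2 = leb2_prob_measures_square
  have "(LINT w|Phi f \<mu>. g w) = (LINT w|leb2. phi f \<mu> w *\<^sub>R g w)"
    unfolding Phi_def using phi_nonneg[OF f \<mu>] prob_measures_squareD(3)[OF leb2]
    by (intro integral_density g phi_measurable f \<mu> AE_I2) simp
  also have "\<dots> = (LINT w|leb2. LINT z|\<mu>. f (fst z, fst w) * f (snd z, snd w) * g w)"
    by (simp add: phi_eq)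
  also have "\<dots> = (LINT z|\<mu>. LINT w|leb2. f (fst z, fst w) * f (snd z, snd w) * g w)"
  proof (rule prob_measures_square_Fubini[OF \<mu> leb2 Phi_kernel_measurable[OF f \<mu> leb2 g(1)]])
    fix z w :: "real \<times> real" assume zw: "z \<in> unit_square" "w \<in> unit_square"
    then have "\<bar>f (fst z, fst w)\<bar> \<le> B" "\<bar>f (snd z, snd w)\<bar> \<le> B"
      unfolding mem_Times_iff by (intro B; blast)+
    then show "\<bar>f (fst z, fst w) * f (snd z, snd w) * g w\<bar> \<le> B * B * C"
      unfolding abs_mult using \<open>B > 0\<close> zw by (intro mult_mono g(2)) simp_all
  qed
  finally show ?thesis .
qed

lemma Phi_prob_measures_square:
  assumes f: "f \<in> FD" and \<mu>: "\<mu> \<in> prob_measures_square"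
  shows "Phi f \<mu> \<in> prob_measures_square"
proof -
  interpret prob_space \<mu> using \<mu> by (rule prob_measures_squareD)
  have "(LINT w|Phi f \<mu>. 1::real) = (LINT z|\<mu>. LINT w|leb2. f (fst z, fst w) * f (snd z, snd w) *
      1)"
    by (rule integral_Phi[OF f \<mu>, where C = 1]) simp_all
  also have "\<dots> = (LINT z|\<mu>. 1)"
  proof (rule Bochner_Integration.integral_cong[OF refl])
    fix z assume "z \<in> space \<mu>"
    then have z: "fst z \<in> unit_interval" "snd z \<in> unit_interval"
      unfolding prob_measures_squareD(3)[OF \<mu>] mem_Times_iff by blast+
    show "(LINT w|leb2. f (fst z, fst w) * f (snd z, snd w) * 1) = 1"
      using leb2_integral_prod(1)[OF FD_integrable_fst[OF f z(1)] FD_integrable_fst[OF f z(2)]]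
        FDD(3)[OF f z(1)] FDD(3)[OF f z(2)] by simp
  qed
  finally have "measure (Phi f \<mu>) (space (Phi f \<mu>)) = 1"
    by (simp add: prob_space)
  \<comment> \<open>\<open>measure\<close> is 0 where \<open>emeasure\<close> is infinite, so the
    value 1 excludes infinite mass.\<close>
  then have "emeasure (Phi f \<mu>) (space (Phi f \<mu>)) = 1"
    by (metis emeasure_eq_ennreal_measure ennreal_1 measure_zero_top zero_neq_one)
  then have "prob_space (Phi f \<mu>)"
    by (rule prob_spaceI)
  then show ?thesis
    by (simp add: prob_measures_square_def Phi_def prob_measures_squareD(2)[OF
        leb2_prob_measures_square])
qed

text \<open>Swapping \<open>w\<close> under \<open>leb2\<close> exchanges the two kernel factors,
  and swapping \<open>z\<close> under \<mu> exchanges them back.\<close>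

lemma Phi_s_graphons:
  assumes f: "f \<in> FD" and \<mu>: "\<mu> \<in> s_graphons"
  shows "Phi f \<mu> \<in> s_graphons"
proof (rule s_graphonsI)
  note \<mu>' = s_graphonsD(1)[OF \<mu>]
  note leb2 = leb2_prob_measures_square
  show "Phi f \<mu> \<in> prob_measures_square"
    by (rule Phi_prob_measures_square[OF f \<mu>'])
  fix g :: "real \<times> real \<Rightarrow> real" assume g: "continuous_on UNIV g"
  have g': "continuous_on unit_square g" and gs': "continuous_on unit_square (\<lambda>w. g (prod.swap w))"
    by (rule continuous_on_subset[OF g subset_UNIV])
       (rule continuous_on_compose2[OF g continuous_on_swap subset_UNIV])
  obtain C where C: "\<And>z. z \<in> unit_square \<Longrightarrow> \<bar>g z\<bar> \<le> C"
    using continuous_on_unit_square_bounded[OF g'] by metis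
  have Cs: "\<bar>g (prod.swap z)\<bar> \<le> C" if "z \<in> unit_square" for z
    using that by (intro C) (simp add: mem_Times_iff)
  have gm: "g \<in> borel_measurable leb2" "(\<lambda>w. g (prod.swap w)) \<in> borel_measurable leb2"
    using prob_measures_square_measurable_continuous[OF leb2 g']
      prob_measures_square_measurable_continuous[OF leb2 gs'] by blast+
  interpret L: prob_space leb2 using leb2 by (rule prob_measures_squareD)
  have meas: "(\<lambda>(z, w). f (fst z, fst w) * f (snd z, snd w) * g w) \<in> borel_measurable (\<mu> \<Otimes>\<^sub>M leb2)"
    by (rule Phi_kernel_measurable[OF f \<mu>' leb2 gm(1)])
  have "(LINT w|Phi f \<mu>. g (prod.swap w)) =
      (LINT z|\<mu>. LINT w|leb2. f (fst z, fst w) * f (snd z, snd w) * g (prod.swap w))"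
    by (rule integral_Phi[OF f \<mu>' gm(2) Cs])
  also have "\<dots> = (LINT z|\<mu>. LINT w|leb2. f (fst (prod.swap z), fst w) * f (snd (prod.swap z), snd
      w) * g w)"
  proof (rule Bochner_Integration.integral_cong[OF refl])
    fix z assume z: "z \<in> space \<mu>"
    have zs: "prod.swap z \<in> space \<mu>"
      using z unfolding prob_measures_squareD(3)[OF \<mu>'] mem_Times_iff by simp
    have "(\<lambda>w. f (fst (prod.swap z), fst w) * f (snd (prod.swap z), snd w) * g w) \<in>
        borel_measurable leb2"
      using measurable_Pair2[OF meas zs] by simp
    from s_graphons_integral_swap[OF leb2_s_graphons this]
    show "(LINT w|leb2. f (fst z, fst w) * f (snd z, snd w) * g (prod.swap w)) =
      (LINT w|leb2. f (fst (prod.swap z), fst w) * f (snd (prod.swap z), snd w) * g w)"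
      by (simp add: mult.commute mult.left_commute)
  qed
  also have "\<dots> = (LINT z|\<mu>. LINT w|leb2. f (fst z, fst w) * f (snd z, snd w) * g w)"
    by (rule s_graphons_integral_swap[OF \<mu> L.borel_measurable_lebesgue_integral[OF meas]])
  also have "\<dots> = (LINT w|Phi f \<mu>. g w)"
    by (rule integral_Phi[OF f \<mu>' gm(1) C, symmetric])
  finally show "(LINT w|Phi f \<mu>. g (prod.swap w)) = (LINT w|Phi f \<mu>. g w)" .
qed

section \<open>Fair partitions and block kernels\<close>

lemma fair_partitionsD:
  assumes f: "f \<in> fair_partitions k" and i: "i \<in> {1..k}"
  shows "f i \<in> borel_measurable leb1" "\<And>x. x \<in> unit_interval \<Longrightarrow> 0 \<le> f i x"
    "\<And>x. x \<in> unit_interval \<Longrightarrow> f i x \<le> 1" "(LINT x|leb1. f i x) = 1 / real k"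
    "integrable leb1 (f i)"
proof -
  show "f i \<in> borel_measurable leb1" and pos: "\<And>x. x \<in> unit_interval \<Longrightarrow> 0 \<le> f i x"
    and "(LINT x|leb1. f i x) = 1 / real k"
    using f i by (simp_all add: fair_partitions_def measurable_leb1)
  show le: "f i x \<le> 1" if x: "x \<in> unit_interval" for x
  proof -
    have "f i x \<le> (\<Sum>j=1..k. f j x)"
      using f i x by (intro member_le_sum) (simp_all add: fair_partitions_def)
    also have "\<dots> = 1"
      using f x by (simp add: fair_partitions_def)
    finally show ?thesis .
  qed
  show "integrable leb1 (f i)"
    using pos le by (intro leb1_integrable[of _ 1] \<open>f i \<in> borel_measurable leb1\<close>) simp
qed

lemma fair_partitions_sum:
  "f \<in> fair_partitions k \<Longrightarrow> x \<in> unit_interval \<Longrightarrow> (\<Sum>i=1..k. f i x) = 1"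
  by (simp add: fair_partitions_def)

lemma prob_measures_square_compose:
  fixes a :: "real \<Rightarrow> real"
  assumes \<nu>: "\<nu> \<in> prob_measures_square" and a: "a \<in> borel_measurable leb1"
  shows "(\<lambda>z. a (fst z)) \<in> borel_measurable \<nu>" "(\<lambda>z. a (snd z)) \<in> borel_measurable \<nu>"
proof -
  have "fst \<in> measurable \<nu> (restrict_space borel unit_interval)"
    "snd \<in> measurable \<nu> (restrict_space borel unit_interval)"
    using prob_measures_square_fst_snd[OF \<nu>] prob_measures_squareD(3)[OF \<nu>]
    by (intro measurable_restrict_space2; force)+
  then show "(\<lambda>z. a (fst z)) \<in> borel_measurable \<nu>" "(\<lambda>z. a (snd z)) \<in> borel_measurable \<nu>"
    using a unfolding measurable_leb1 by (auto intro: measurable_compose)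
qed

lemma quotient_matrix_eq:
  "i \<in> {1..k} \<Longrightarrow> j \<in> {1..k} \<Longrightarrow>
    quotient_matrix k f \<mu> (i, j) = (LINT z|\<mu>. f i (fst z) * f j (snd z))"
  by (simp add: quotient_matrix_def case_prod_beta')

lemma fair_partitions_tensor:
  assumes \<nu>: "\<nu> \<in> prob_measures_square" and f: "f \<in> fair_partitions k" "f' \<in> fair_partitions k'"
    and ij: "i \<in> {1..k}" "j \<in> {1..k'}"
  shows "(\<lambda>z. f i (fst z) * f' j (snd z)) \<in> borel_measurable \<nu>"
    and "\<And>z. z \<in> unit_square \<Longrightarrow> 0 \<le> f i (fst z) * f' j (snd z)"
    and "\<And>z. z \<in> unit_square \<Longrightarrow> f i (fst z) * f' j (snd z) \<le> 1"
    and "integrable \<nu> (\<lambda>z. f i (fst z) * f' j (snd z))"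
proof -
  show m: "(\<lambda>z. f i (fst z) * f' j (snd z)) \<in> borel_measurable \<nu>"
    using prob_measures_square_compose[OF \<nu>] fair_partitionsD(1)[OF f(1) ij(1)]
        fair_partitionsD(1)[OF f(2) ij(2)]
    by (intro borel_measurable_times) blast+
  show nn: "0 \<le> f i (fst z) * f' j (snd z)" if "z \<in> unit_square" for z
    using that fair_partitionsD(2)[OF f(1) ij(1)] fair_partitionsD(2)[OF f(2) ij(2)]
    by (simp add: mem_Times_iff)
  show le: "f i (fst z) * f' j (snd z) \<le> 1" if "z \<in> unit_square" for z
    using that fair_partitionsD(2,3)[OF f(1) ij(1)] fair_partitionsD(2,3)[OF f(2) ij(2)]
    by (intro mult_le_one) (simp_all add: mem_Times_iff)
  show "integrable \<nu> (\<lambda>z. f i (fst z) * f' j (snd z))"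
    using nn le by (intro prob_measures_square_integrable[OF \<nu> m, of 1]) simp
qed

lemma fair_partitions_tensor_integrable:
  assumes \<nu>: "\<nu> \<in> prob_measures_square" and p: "p \<in> fair_partitions k"
    and g: "continuous_on unit_square g" and ij: "i \<in> {1..k}" "j \<in> {1..k}"
  shows "integrable \<nu> (\<lambda>w. p i (fst w) * p j (snd w) * g w)"
proof -
  obtain C where C: "\<And>z. z \<in> unit_square \<Longrightarrow> \<bar>g z\<bar> \<le> C"
    using continuous_on_unit_square_bounded[OF g] by metis
  note t = fair_partitions_tensor[OF \<nu> p p ij]
  show ?thesis
  proof (rule prob_measures_square_integrable[OF \<nu>])
    show "(\<lambda>w. p i (fst w) * p j (snd w) * g w) \<in> borel_measurable \<nu>"
      using t(1) prob_measures_square_measurable_continuous[OF \<nu> g] by (rule borel_measurable_times)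
    show "\<bar>p i (fst w) * p j (snd w) * g w\<bar> \<le> 1 * C" if w: "w \<in> unit_square" for w
      unfolding abs_mult[of "p i (fst w) * p j (snd w)"] using t(2,3)[OF w] C[OF w]
      by (intro mult_mono) simp_all
  qed
qed

lemma fair_partitions_integrable_mult:
  assumes p: "p \<in> fair_partitions k" and ab: "a \<in> {1..k}" "b \<in> {1..k}"
  shows "integrable leb1 (\<lambda>u. p a u * p b u)"
  using fair_partitionsD(2,3)[OF p ab(1)] fair_partitionsD(2,3)[OF p ab(2)]
  by (intro leb1_integrable[of _ 1] borel_measurable_times fair_partitionsD(1)[OF p] ab)
    (simp add: abs_mult mult_le_one)

lemma quotient_matrix_range:
  assumes \<nu>: "\<nu> \<in> prob_measures_square" and f: "f \<in> fair_partitions k"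
    and ij: "i \<in> {1..k}" "j \<in> {1..k}"
  shows "quotient_matrix k f \<nu> (i, j) \<in> {0..1}"
proof -
  interpret prob_space \<nu> using \<nu> by (rule prob_measures_squareD)
  note t = fair_partitions_tensor[OF \<nu> f f ij]
  have "0 \<le> (LINT z|\<nu>. f i (fst z) * f j (snd z))"
    using t(2) by (intro integral_nonneg_AE AE_I2) (simp add: prob_measures_squareD(3)[OF \<nu>])
  moreover have "(LINT z|\<nu>. f i (fst z) * f j (snd z)) \<le> 1"
    using t(3,4) by (intro integral_le_const AE_I2) (simp_all add: prob_measures_squareD(3)[OF \<nu>])
  ultimately show ?thesis
    by (simp add: quotient_matrix_eq[OF ij])
qed

lemma integral_double_sum:
  fixes h :: "'i \<Rightarrow> 'j \<Rightarrow> 'a \<Rightarrow> real"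
  assumes "\<And>i j. i \<in> A \<Longrightarrow> j \<in> B \<Longrightarrow> integrable M (h i j)"
  shows "(LINT x|M. (\<Sum>i\<in>A. \<Sum>j\<in>B. h i j x * c i j)) = (\<Sum>i\<in>A. \<Sum>j\<in>B. (LINT x|M. h i j x) * c i j)"
proof -
  have "(LINT x|M. (\<Sum>i\<in>A. \<Sum>j\<in>B. h i j x * c i j)) = (\<Sum>i\<in>A. (LINT x|M. (\<Sum>j\<in>B. h i j x * c i j)))"
    using assms by (intro Bochner_Integration.integral_sum Bochner_Integration.integrable_sum
        integrable_mult_left)
  also have "\<dots> = (\<Sum>i\<in>A. \<Sum>j\<in>B. (LINT x|M. h i j x * c i j))"
    using assms by (intro sum.cong refl Bochner_Integration.integral_sum integrable_mult_left)
  finally show ?thesis by simp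
qed

lemma quotient_matrix_sum:
  assumes \<nu>: "\<nu> \<in> prob_measures_square" and f: "f \<in> fair_partitions k"
  shows "(\<Sum>i=1..k. \<Sum>j=1..k. quotient_matrix k f \<nu> (i, j)) = 1"
proof -
  interpret prob_space \<nu> using \<nu> by (rule prob_measures_squareD)
  note int = fair_partitions_tensor(4)[OF \<nu> f f]
  have "(\<Sum>i=1..k. \<Sum>j=1..k. quotient_matrix k f \<nu> (i, j)) =
      (\<Sum>i=1..k. \<Sum>j=1..k. (LINT z|\<nu>. f i (fst z) * f j (snd z)))"
    by (intro sum.cong refl quotient_matrix_eq)
  also have "\<dots> = (LINT z|\<nu>. (\<Sum>i=1..k. \<Sum>j=1..k. f i (fst z) * f j (snd z)))"
    using integral_double_sum[of "{1..k}" "{1..k}" \<nu> "\<lambda>i j z. f i (fst z) * f j (snd z)" "\<lambda>_ _.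
        1", OF int]
    by simp
  also have "\<dots> = (LINT z|\<nu>. 1)"
  proof (rule Bochner_Integration.integral_cong[OF refl])
    fix z assume "z \<in> space \<nu>"
    then show "(\<Sum>i=1..k. \<Sum>j=1..k. f i (fst z) * f j (snd z)) = 1"
      using fair_partitions_sum[OF f, of "fst z"] fair_partitions_sum[OF f, of "snd z"]
      by (simp add: prob_measures_squareD(3)[OF \<nu>] mem_Times_iff sum_product[symmetric])
  qed
  finally show ?thesis
    by (simp add: prob_space)
qed

section \<open>Averages of fair partitions and block kernels\<close>

definition partition_average ::
  "(real \<times> real \<Rightarrow> real) \<Rightarrow> (nat \<Rightarrow> real \<Rightarrow> real) \<Rightarrow> nat \<Rightarrow> real \<Rightarrow> real" where
  "partition_average f p i x = (LINT u|leb1. f (x, u) * p i u)"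

lemma integrable_FD_fair_partition:
  assumes f: "f \<in> FD" and p: "p \<in> fair_partitions k" and i: "i \<in> {1..k}" and x: "x \<in> unit_interval"
  shows "integrable leb1 (\<lambda>u. f (x, u) * p i u)"
proof -
  obtain B where "B > 0" and B: "\<And>x y. x \<in> unit_interval \<Longrightarrow> y \<in> unit_interval \<Longrightarrow> \<bar>f (x, y)\<bar> \<le> B"
    using FD_bound[OF f] by metis
  have "(\<lambda>u. f (x, u) * p i u) \<in> borel_measurable leb1"
    using FD_integrable_fst[OF f x] fair_partitionsD(1)[OF p i]
    by (intro borel_measurable_times) (rule borel_measurable_integrable)
  moreover have "\<bar>f (x, u) * p i u\<bar> \<le> B * 1" if u: "u \<in> unit_interval" for u
    unfolding abs_mult using B[OF x u] fair_partitionsD(2,3)[OF p i u] \<open>B > 0\<close>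
    by (intro mult_mono) simp_all
  ultimately show ?thesis
    by (rule leb1_integrable)
qed

text \<open>The kernel acts as a doubly stochastic operator: the integral 1 over the second variable
  preserves the sum 1 of the partition, and the integral 1 over the first variable preserves the
  means \<open>1/k\<close>.\<close>

lemma partition_average_fair:
  assumes f: "f \<in> FD" and p: "p \<in> fair_partitions k"
  shows "partition_average f p \<in> fair_partitions k"
proof -
  interpret L: prob_space leb1 by (rule prob_space_leb1)
  interpret pair_prob_space leb1 leb1 ..
  obtain B where "B > 0" and B: "\<And>x y. x \<in> unit_interval \<Longrightarrow> y \<in> unit_interval \<Longrightarrow> \<bar>f (x, y)\<bar> \<le> B"
    using FD_bound[OF f] by metis
  note leb2 = leb2_prob_measures_square
  have meas: "(\<lambda>(x, u). f (x, u) * p i u) \<in> borel_measurable (leb1 \<Otimes>\<^sub>M leb1)" if i: "i \<in> {1..k}"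
      for i
  proof -
    have "(\<lambda>z. p i (snd z)) \<in> borel_measurable leb2"
      using prob_measures_square_compose(2)[OF leb2 fair_partitionsD(1)[OF p i]] .
    moreover have "f \<in> borel_measurable leb2"
      unfolding prob_measures_square_measurable[OF leb2] by (rule FDD(1)[OF f])
    ultimately show ?thesis
      unfolding leb2_eq_pair[symmetric] case_prod_beta' prod.collapse
      by (rule borel_measurable_times[rotated])
  qed
  have int: "integrable (leb1 \<Otimes>\<^sub>M leb1) (\<lambda>(x, u). f (x, u) * p i u)" if i: "i \<in> {1..k}" for i
    unfolding leb2_eq_pair[symmetric]
  proof (rule prob_measures_square_integrable[OF leb2])
    show "(\<lambda>(x, u). f (x, u) * p i u) \<in> borel_measurable leb2"
      unfolding leb2_eq_pair by (rule meas[OF i])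
    fix z assume "z \<in> unit_square"
    then obtain x u where z: "z = (x, u)" "x \<in> unit_interval" "u \<in> unit_interval" by blast
    show "\<bar>case z of (x, u) \<Rightarrow> f (x, u) * p i u\<bar> \<le> B * 1"
      unfolding z(1) prod.case abs_mult
      using B[OF z(2,3)] fair_partitionsD(2,3)[OF p i z(3)] \<open>B > 0\<close>
      by (intro mult_mono) simp_all
  qed
  show ?thesis
    unfolding fair_partitions_def
  proof (intro CollectI conjI ballI)
    fix i assume i: "i \<in> {1..k}"
    show "partition_average f p i \<in> borel_measurable (restrict_space borel unit_interval)"
      unfolding partition_average_def[abs_def] measurable_leb1[symmetric]
      by (rule L.borel_measurable_lebesgue_integral[OF meas[OF i]])
    show "0 \<le> partition_average f p i x" if x: "x \<in> unit_interval" for x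
      unfolding partition_average_def
      using FDD(2)[OF f x] fair_partitionsD(2)[OF p i]
      by (intro integral_nonneg_AE AE_I2 mult_nonneg_nonneg) simp_all
    have "(LINT x|leb1. partition_average f p i x) = (LINT u|leb1. LINT x|leb1. f (x, u) * p i u)"
      unfolding partition_average_def by (rule Fubini_integral[OF int[OF i], symmetric])
    also have "\<dots> = (LINT u|leb1. p i u)"
      using FDD(4)[OF f] by (intro Bochner_Integration.integral_cong refl) simp
    finally show "(LINT x|leb1. partition_average f p i x) = 1 / real k"
      using fair_partitionsD(4)[OF p i] by simp
  next
    fix x :: real assume x: "x \<in> unit_interval"
    have "(\<Sum>i=1..k. partition_average f p i x) = (LINT u|leb1. (\<Sum>i=1..k. f (x, u) * p i u))"
      unfolding partition_average_def
      using integrable_FD_fair_partition[OF f p _ x]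
      by (intro Bochner_Integration.integral_sum[symmetric])
    also have "\<dots> = (LINT u|leb1. f (x, u))"
      using fair_partitions_sum[OF p]
      by (intro Bochner_Integration.integral_cong refl) (simp add: sum_distrib_left[symmetric])
    finally show "(\<Sum>i=1..k. partition_average f p i x) = 1"
      using FDD(3)[OF f x] by simp
  qed
qed

text \<open>An adjointness: the kernel is moved from the measure to the partition. In this way
  quotient matrices of elements of the shape of \<mu> become generators of its
  \<open>k\<close>-shape.\<close>

lemma quotient_matrix_Phi:
  assumes f: "f \<in> FD" and p: "p \<in> fair_partitions k" and \<mu>: "\<mu> \<in> prob_measures_square"
  shows "quotient_matrix k p (Phi f \<mu>) = quotient_matrix k (partition_average f p) \<mu>"
proof
  fix ij :: "nat \<times> nat"
  show "quotient_matrix k p (Phi f \<mu>) ij = quotient_matrix k (partition_average f p) \<mu> ij"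
  proof (cases "ij \<in> {1..k} \<times> {1..k}")
    case True
    then obtain i j where ij: "ij = (i, j)" "i \<in> {1..k}" "j \<in> {1..k}" by blast
    note t = fair_partitions_tensor[OF leb2_prob_measures_square p p ij(2,3)]
    have "(LINT w|Phi f \<mu>. p i (fst w) * p j (snd w)) =
        (LINT z|\<mu>. LINT w|leb2. f (fst z, fst w) * f (snd z, snd w) * (p i (fst w) * p j (snd w)))"
      using t by (intro integral_Phi[OF f \<mu>, of _ 1]) simp_all
    also have "\<dots> = (LINT z|\<mu>. partition_average f p i (fst z) * partition_average f p j (snd z))"
    proof (rule Bochner_Integration.integral_cong[OF refl])
      fix z assume "z \<in> space \<mu>"
      then have z: "fst z \<in> unit_interval" "snd z \<in> unit_interval"
        by (simp_all add: prob_measures_squareD(3)[OF \<mu>] mem_Times_iff)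
      show "(LINT w|leb2. f (fst z, fst w) * f (snd z, snd w) * (p i (fst w) * p j (snd w))) =
          partition_average f p i (fst z) * partition_average f p j (snd z)"
        unfolding partition_average_def
          leb2_integral_prod(1)[OF integrable_FD_fair_partition[OF f p ij(2) z(1)]
            integrable_FD_fair_partition[OF f p ij(3) z(2)], symmetric]
        by (simp add: mult_ac)
    qed
    finally show ?thesis
      unfolding ij(1) quotient_matrix_eq[OF ij(2,3)] .
  qed (auto simp: quotient_matrix_def)
qed

definition cont_fair_partitions :: "nat \<Rightarrow> (nat \<Rightarrow> real \<Rightarrow> real) set" where
  "cont_fair_partitions k = {f \<in> fair_partitions k. \<forall>i\<in>{1..k}. continuous_on unit_interval (f i)}"

lemma continuous_on_tensor:
  assumes "p \<in> cont_fair_partitions k" "i \<in> {1..k}" "j \<in> {1..k}"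
  shows "continuous_on unit_square (\<lambda>z. p i (fst z) * p j (snd z))"
  using assms
  by (intro continuous_on_mult
      continuous_on_compose2[OF _ continuous_on_fst[OF continuous_on_id], of unit_interval "p i"]
      continuous_on_compose2[OF _ continuous_on_snd[OF continuous_on_id], of unit_interval "p j"])
    (auto simp: cont_fair_partitions_def)

text \<open>Mass at \<open>x\<close> goes to class \<open>i\<close> with weight \<open>f i x\<close>
  and is spread there with density \<open>k * p i\<close>, which has integral 1 because
  \<open>p i\<close> has mean \<open>1/k\<close>.\<close>

definition block_kernel ::
  "nat \<Rightarrow> (nat \<Rightarrow> real \<Rightarrow> real) \<Rightarrow> (nat \<Rightarrow> real \<Rightarrow> real) \<Rightarrow> real \<times> real \<Rightarrow> real" where
  "block_kernel k f p = (\<lambda>(x, u). real k * (\<Sum>i=1..k. f i x * p i u))"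

text \<open>Since the weight \<open>p i \<otimes> p j\<close> has mass \<open>1/k^2\<close>, the
  squared factor turns the inner integral into a mean of \<open>g\<close> over block
  \<open>(i, j)\<close>; the functional is the sum of these means weighted by the entries of
  \<open>M\<close>.\<close>

definition block_functional ::
  "nat \<Rightarrow> (nat \<Rightarrow> real \<Rightarrow> real) \<Rightarrow> (real \<times> real \<Rightarrow> real) \<Rightarrow> (nat \<times> nat \<Rightarrow> real) \<Rightarrow> real" where
  "block_functional k p g M = (real k)\<^sup>2 *
     (\<Sum>i=1..k. \<Sum>j=1..k. M (i, j) * (LINT w|leb2. p i (fst w) * p j (snd w) * g w))"

text \<open>In each variable one family contributes its mean \<open>1/k\<close>, cancelled by the
  factor \<open>k\<close>, and the other its sum 1.\<close>

lemma block_kernel_FDC: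
  assumes k: "k \<ge> 1" and f: "f \<in> cont_fair_partitions k" and p: "p \<in> cont_fair_partitions k"
  shows "block_kernel k f p \<in> FDC"
proof -
  have f': "f \<in> fair_partitions k" and p': "p \<in> fair_partitions k"
    using f p by (simp_all add: cont_fair_partitions_def)
  have "continuous_on unit_square (\<lambda>z. f i (fst z))" "continuous_on unit_square (\<lambda>z. p i (snd z))"
    if i: "i \<in> {1..k}" for i
  proof -
    have "continuous_on unit_interval (f i)" "continuous_on unit_interval (p i)"
      using f p i by (simp_all add: cont_fair_partitions_def)
    moreover have "fst ` unit_square \<subseteq> unit_interval" "snd ` unit_square \<subseteq> unit_interval"
      by auto
    ultimately show "continuous_on unit_square (\<lambda>z. f i (fst z))"
        "continuous_on unit_square (\<lambda>z. p i (snd z))"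
      using continuous_on_compose2[OF _ continuous_on_fst[OF continuous_on_id], of unit_interval
          "f i" unit_square]
        continuous_on_compose2[OF _ continuous_on_snd[OF continuous_on_id], of unit_interval "p i"
            unit_square]
      by blast+
  qed
  then have cont: "continuous_on unit_square (block_kernel k f p)"
    unfolding block_kernel_def case_prod_beta'
    by (intro continuous_intros)
  have "block_kernel k f p \<in> FD"
    unfolding FD_def
  proof (intro CollectI conjI ballI)
    show "block_kernel k f p \<in> borel_measurable (restrict_space borel unit_square)"
      by (rule borel_measurable_continuous_on_restrict[OF cont])
    obtain B where "\<And>z. z \<in> unit_square \<Longrightarrow> \<bar>block_kernel k f p z\<bar> \<le> B"
      using continuous_on_unit_square_bounded[OF cont] by metis
    then show "bounded (block_kernel k f p ` unit_square)"
      unfolding bounded_iff by (intro exI[of _ B]) auto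
    show "0 \<le> block_kernel k f p z" if "z \<in> unit_square" for z
      unfolding block_kernel_def case_prod_beta' using that
      by (intro mult_nonneg_nonneg sum_nonneg fair_partitionsD(2)[OF f'] fair_partitionsD(2)[OF p'])
        (simp_all add: mem_Times_iff)
  next
    fix x :: real assume x: "x \<in> unit_interval"
    have "(LINT v|leb1. block_kernel k f p (x, v)) =
        real k * (LINT v|leb1. (\<Sum>i=1..k. f i x * p i v))"
      unfolding block_kernel_def prod.case by (rule integral_mult_right_zero)
    also have "(LINT v|leb1. (\<Sum>i=1..k. f i x * p i v)) = (\<Sum>i=1..k. (LINT v|leb1. f i x * p i v))"
      by (intro Bochner_Integration.integral_sum integrable_mult_right fair_partitionsD(5)[OF p'])
    also have "real k * \<dots> = (\<Sum>i=1..k. f i x)"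
      unfolding sum_distrib_left
      by (intro sum.cong refl) (use fair_partitionsD(4)[OF p'] k in simp)
    finally show "(LINT v|leb1. block_kernel k f p (x, v)) = 1"
      using fair_partitions_sum[OF f' x] by simp
  next
    fix x :: real assume x: "x \<in> unit_interval"
    have "(LINT v|leb1. block_kernel k f p (v, x)) =
        real k * (LINT v|leb1. (\<Sum>i=1..k. f i v * p i x))"
      unfolding block_kernel_def prod.case by (rule integral_mult_right_zero)
    also have "(LINT v|leb1. (\<Sum>i=1..k. f i v * p i x)) = (\<Sum>i=1..k. (LINT v|leb1. f i v * p i x))"
      by (intro Bochner_Integration.integral_sum integrable_mult_left fair_partitionsD(5)[OF f'])
    also have "real k * \<dots> = (\<Sum>i=1..k. p i x)"
      unfolding sum_distrib_left
      by (intro sum.cong refl) (use fair_partitionsD(4)[OF f'] k in simp)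
    finally show "(LINT v|leb1. block_kernel k f p (v, x)) = 1"
      using fair_partitions_sum[OF p' x] by simp
  qed
  with cont show ?thesis
    by (simp add: FDC_def)
qed

text \<open>The kernel is separable, so \<open>f\<close> and \<mu> enter only through the quotient
  matrix. Close quotient matrices for two different measures therefore give close integrals, which
  is the bridge between measures.\<close>

lemma integral_Phi_block_kernel:
  assumes k: "k \<ge> 1" and f: "f \<in> cont_fair_partitions k" and p: "p \<in> cont_fair_partitions k"
    and \<mu>: "\<mu> \<in> prob_measures_square" and g: "continuous_on unit_square g"
  shows "(LINT w|Phi (block_kernel k f p) \<mu>. g w) = block_functional k p g (quotient_matrix k f \<mu>)"
proof -
  have f': "f \<in> fair_partitions k" and p': "p \<in> fair_partitions k"
    using f p by (simp_all add: cont_fair_partitions_def)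
  have F: "block_kernel k f p \<in> FD"
    using block_kernel_FDC[OF k f p] by (simp add: FDC_def)
  note leb2 = leb2_prob_measures_square
  obtain C where C: "\<And>z. z \<in> unit_square \<Longrightarrow> \<bar>g z\<bar> \<le> C"
    using continuous_on_unit_square_bounded[OF g] by metis
  have gm: "g \<in> borel_measurable leb2"
    by (rule prob_measures_square_measurable_continuous[OF leb2 g])
  define c where "c i j = (LINT w|leb2. p i (fst w) * p j (snd w) * g w)" for i j
  note int = fair_partitions_tensor_integrable[OF leb2 p' g]
  have "(LINT w|Phi (block_kernel k f p) \<mu>. g w) =
      (LINT z|\<mu>. LINT w|leb2. block_kernel k f p (fst z, fst w) * block_kernel k f p (snd z, snd
          w) * g w)"
    by (rule integral_Phi[OF F \<mu> gm C])
  also have "\<dots> = (LINT z|\<mu>. (real k)\<^sup>2 * (\<Sum>i=1..k. \<Sum>j=1..k. f i (fst z) * f j (snd z) * c i j))"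
  proof (rule Bochner_Integration.integral_cong[OF refl])
    fix z
    have "(LINT w|leb2. block_kernel k f p (fst z, fst w) * block_kernel k f p (snd z, snd w) * g
        w) =
        (LINT w|leb2. (real k)\<^sup>2 * (\<Sum>i=1..k. \<Sum>j=1..k. p i (fst w) * p j (snd w) * g w * (f i (fst
            z) * f j (snd z))))"
    proof (rule Bochner_Integration.integral_cong[OF refl])
      fix w
      have "block_kernel k f p (fst z, fst w) * block_kernel k f p (snd z, snd w) * g w =
          (real k)\<^sup>2 * ((\<Sum>i=1..k. f i (fst z) * p i (fst w)) * (\<Sum>j=1..k. f j (snd z) * p j (snd
              w))) * g w"
        by (simp add: block_kernel_def power2_eq_square)
      also have "\<dots> = (real k)\<^sup>2 * (\<Sum>i=1..k. \<Sum>j=1..k. p i (fst w) * p j (snd w) * g w * (f i (fst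
          z) * f j (snd z)))"
        unfolding sum_product by (simp add: sum_distrib_left sum_distrib_right mult_ac)
      finally show "block_kernel k f p (fst z, fst w) * block_kernel k f p (snd z, snd w) * g w =
          (real k)\<^sup>2 * (\<Sum>i=1..k. \<Sum>j=1..k. p i (fst w) * p j (snd w) * g w * (f i (fst z) * f j
              (snd z)))" .
    qed
    also have "\<dots> = (real k)\<^sup>2 * (\<Sum>i=1..k. \<Sum>j=1..k. f i (fst z) * f j (snd z) * c i j)"
    proof -
      have "(LINT w|leb2. (\<Sum>i=1..k. \<Sum>j=1..k. p i (fst w) * p j (snd w) * g w * (f i (fst z) * f j
          (snd z)))) =
          (\<Sum>i=1..k. \<Sum>j=1..k. c i j * (f i (fst z) * f j (snd z)))"
        unfolding c_def by (rule integral_double_sum[OF int])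
      then show ?thesis
        unfolding integral_mult_right_zero by (simp only: mult.commute)
    qed
    finally show "(LINT w|leb2. block_kernel k f p (fst z, fst w) * block_kernel k f p (snd z, snd
        w) * g w) =
        (real k)\<^sup>2 * (\<Sum>i=1..k. \<Sum>j=1..k. f i (fst z) * f j (snd z) * c i j)" .
  qed
  also have "\<dots> = (real k)\<^sup>2 * (\<Sum>i=1..k. \<Sum>j=1..k. (LINT z|\<mu>. f i (fst z) * f j (snd z)) * c i j)"
    unfolding integral_mult_right_zero
    by (rule arg_cong[OF integral_double_sum[OF fair_partitions_tensor(4)[OF \<mu> f' f']],
          where f = "\<lambda>x. (real k)\<^sup>2 * x"])
  also have "\<dots> = block_functional k p g (quotient_matrix k f \<mu>)"
    unfolding block_functional_def c_def
    by (intro arg_cong[where f = "(*) _"] sum.cong refl) (simp add: quotient_matrix_eq)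
  finally show ?thesis .
qed

text \<open>Going to the matrix of \<open>p\<close> and back replaces \<open>g\<close> by its block
  means, blended by \<open>p\<close> itself. Only blocks whose support contains \<open>z\<close>
  contribute at \<open>z\<close>; there \<open>g\<close> varies by at most \<epsilon>, and the
  weights sum to 1. The bound is pointwise in \<open>z\<close>, so it holds for every probability
  measure.\<close>

lemma block_functional_quotient_matrix_approx:
  assumes k: "k \<ge> 1" and p: "p \<in> fair_partitions k" and \<nu>: "\<nu> \<in> prob_measures_square"
    and g: "continuous_on unit_square g"
    and loc: "\<And>i x u. i \<in> {1..k} \<Longrightarrow> x \<in> unit_interval \<Longrightarrow> u \<in> unit_interval \<Longrightarrow>
      p i x \<noteq> 0 \<Longrightarrow> p i u \<noteq> 0 \<Longrightarrow> \<bar>x - u\<bar> \<le> \<eta>"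
    and osc: "\<And>z w. z \<in> unit_square \<Longrightarrow> w \<in> unit_square \<Longrightarrow> \<bar>fst z - fst w\<bar> \<le> \<eta> \<Longrightarrow>
      \<bar>snd z - snd w\<bar> \<le> \<eta> \<Longrightarrow> \<bar>g z - g w\<bar> \<le> \<epsilon>"
  shows "\<bar>block_functional k p g (quotient_matrix k p \<nu>) - (LINT z|\<nu>. g z)\<bar> \<le> \<epsilon>"
proof -
  interpret prob_space \<nu> using \<nu> by (rule prob_measures_squareD)
  note leb2 = leb2_prob_measures_square
  define c where "c i j = (LINT w|leb2. p i (fst w) * p j (snd w) * g w)" for i j
  note int = fair_partitions_tensor_integrable[OF leb2 p g]
  have int1: "integrable leb2 (\<lambda>w. p i (fst w) * p j (snd w))"
    and LINT1: "(real k)\<^sup>2 * (LINT w|leb2. p i (fst w) * p j (snd w)) = 1"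
    if ij: "i \<in> {1..k}" "j \<in> {1..k}" for i j
    using leb2_integral_prod[OF fair_partitionsD(5)[OF p ij(1)] fair_partitionsD(5)[OF p ij(2)]]
      fair_partitionsD(4)[OF p ij(1)] fair_partitionsD(4)[OF p ij(2)] k
    by (simp_all add: power2_eq_square)
  \<comment> \<open>The blend of block means of \<open>g\<close>; its integral against \<nu> is the
    functional.\<close>
  define Q where "Q z = (\<Sum>i=1..k. \<Sum>j=1..k. p i (fst z) * p j (snd z) * ((real k)\<^sup>2 * c i j))" for z
  have Q_int: "integrable \<nu> Q"
    unfolding Q_def using fair_partitions_tensor(4)[OF \<nu> p p]
        by (intro Bochner_Integration.integrable_sum integrable_mult_left)
  have bf: "block_functional k p g (quotient_matrix k p \<nu>) = (LINT z|\<nu>. Q z)"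
  proof -
    have "(LINT z|\<nu>. Q z) = (\<Sum>i=1..k. \<Sum>j=1..k. (LINT z|\<nu>. p i (fst z) * p j (snd z)) * ((real k)\<^sup>2
        * c i j))"
      unfolding Q_def by (rule integral_double_sum[OF fair_partitions_tensor(4)[OF \<nu> p p]])
    also have "\<dots> = (\<Sum>i=1..k. \<Sum>j=1..k. quotient_matrix k p \<nu> (i, j) * ((real k)\<^sup>2 * c i j))"
      by (intro sum.cong refl) (simp add: quotient_matrix_eq)
    finally show ?thesis
      unfolding block_functional_def c_def by (simp add: sum_distrib_left mult_ac)
  qed
  have one: "(\<Sum>i=1..k. \<Sum>j=1..k. p i (fst z) * p j (snd z)) = 1" if "z \<in> unit_square" for z
    using that fair_partitions_sum[OF p, of "fst z"] fair_partitions_sum[OF p, of "snd z"]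
    by (simp add: mem_Times_iff sum_product[symmetric])
  have Q_close: "\<bar>Q z - g z\<bar> \<le> \<epsilon>" if z: "z \<in> unit_square" for z
  proof -
    \<comment> \<open>A vanishing weight makes both sides 0. Otherwise \<open>z\<close> lies in the
      support of the block, so every \<open>w\<close> that matters for the block mean is within
      \<eta> of \<open>z\<close> in each coordinate.\<close>
    have term_le: "p i (fst z) * p j (snd z) * \<bar>(real k)\<^sup>2 * c i j - g z\<bar> \<le>
        p i (fst z) * p j (snd z) * \<epsilon>"
      if ij: "i \<in> {1..k}" "j \<in> {1..k}" for i j
    proof (cases "p i (fst z) * p j (snd z) = 0")
      case False
      note t = fair_partitions_tensor[OF leb2 p p ij]
      have "\<bar>(real k)\<^sup>2 * c i j - g z\<bar> =
          \<bar>(real k)\<^sup>2 * c i j - (real k)\<^sup>2 * (LINT w|leb2. p i (fst w) * p j (snd w)) * g z\<bar>"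
        by (simp add: LINT1[OF ij])
      also have "\<dots> = (real k)\<^sup>2 * \<bar>c i j - (LINT w|leb2. p i (fst w) * p j (snd w)) * g z\<bar>"
        unfolding mult.assoc right_diff_distrib[symmetric] abs_mult by simp
      also have "\<dots> = (real k)\<^sup>2 * \<bar>LINT w|leb2. p i (fst w) * p j (snd w) * (g w - g z)\<bar>"
        using int[OF ij] int1[OF ij] by (simp add: c_def right_diff_distrib)
      also have "\<dots> \<le> (real k)\<^sup>2 * (LINT w|leb2. p i (fst w) * p j (snd w) * \<epsilon>)"
      proof (rule mult_left_mono)
        have "\<bar>LINT w|leb2. p i (fst w) * p j (snd w) * (g w - g z)\<bar> \<le>
            (LINT w|leb2. \<bar>p i (fst w) * p j (snd w) * (g w - g z)\<bar>)"
          by (rule integral_abs_bound)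
        also have "\<dots> \<le> (LINT w|leb2. p i (fst w) * p j (snd w) * \<epsilon>)"
        proof (rule integral_mono)
          show "integrable leb2 (\<lambda>w. \<bar>p i (fst w) * p j (snd w) * (g w - g z)\<bar>)"
            unfolding right_diff_distrib using int[OF ij] int1[OF ij]
            by (intro integrable_abs Bochner_Integration.integrable_diff integrable_mult_left)
          show "integrable leb2 (\<lambda>w. p i (fst w) * p j (snd w) * \<epsilon>)"
            using int1[OF ij] by (rule integrable_mult_left)
          fix w assume "w \<in> space leb2"
          then have w: "w \<in> unit_square"
            by (simp add: prob_measures_squareD(3)[OF leb2])
          show "\<bar>p i (fst w) * p j (snd w) * (g w - g z)\<bar> \<le> p i (fst w) * p j (snd w) * \<epsilon>"
          proof (cases "p i (fst w) * p j (snd w) = 0")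
            case nz: False
            have "\<bar>fst w - fst z\<bar> \<le> \<eta>" "\<bar>snd w - snd z\<bar> \<le> \<eta>"
              using loc[OF ij(1), of "fst w" "fst z"] loc[OF ij(2), of "snd w" "snd z"] False nz z w
              by (simp_all add: mem_Times_iff)
            then have "\<bar>g w - g z\<bar> \<le> \<epsilon>"
              using osc w z by blast
            then show ?thesis
              using t(2)[OF w] by (simp add: abs_mult[of "p i (fst w) * p j (snd w)"]
                mult_left_mono)
          next
            case True
            then show ?thesis by (simp only: mult_zero_left abs_zero)
          qed
        qed
        finally show "\<bar>LINT w|leb2. p i (fst w) * p j (snd w) * (g w - g z)\<bar> \<le>
            (LINT w|leb2. p i (fst w) * p j (snd w) * \<epsilon>)" .
      qed simp
      also have "\<dots> = \<epsilon>"
        using LINT1[OF ij] by simp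
      finally show ?thesis
        using fair_partitions_tensor(2)[OF leb2 p p ij z] by (intro mult_left_mono)
    next
      case True
      then show ?thesis by (simp only: mult_zero_left)
    qed
    \<comment> \<open>The weights at \<open>z\<close> sum to 1, so \<open>g z\<close> may be
      distributed over the terms.\<close>
    have "Q z - g z = (\<Sum>i=1..k. \<Sum>j=1..k. p i (fst z) * p j (snd z) * ((real k)\<^sup>2 * c i j - g z))"
      using one[OF z] by (simp add: Q_def right_diff_distrib sum_subtractf
          sum_distrib_right[symmetric])
    also have "\<bar>\<dots>\<bar> \<le> (\<Sum>i=1..k. \<Sum>j=1..k. \<bar>p i (fst z) * p j (snd z) * ((real k)\<^sup>2 * c i j - g z)\<bar>)"
      by (rule order_trans[OF sum_abs sum_mono[OF sum_abs]])
    also have "\<dots> \<le> (\<Sum>i=1..k. \<Sum>j=1..k. p i (fst z) * p j (snd z) * \<epsilon>)"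
    proof (intro sum_mono)
      fix i j assume ij: "i \<in> {1..k}" "j \<in> {1..k}"
      show "\<bar>p i (fst z) * p j (snd z) * ((real k)\<^sup>2 * c i j - g z)\<bar> \<le>
          p i (fst z) * p j (snd z) * \<epsilon>"
        using term_le[OF ij] fair_partitions_tensor(2)[OF leb2 p p ij z]
        by (simp add: abs_mult[of "p i (fst z) * p j (snd z)"])
    qed
    also have "\<dots> = \<epsilon>"
      using one[OF z] by (simp add: sum_distrib_right[symmetric])
    finally show ?thesis .
  qed
  have g_int: "integrable \<nu> g"
    by (rule prob_measures_square_integrable_continuous[OF \<nu> g])
  have "\<bar>block_functional k p g (quotient_matrix k p \<nu>) - (LINT z|\<nu>. g z)\<bar> = \<bar>LINT z|\<nu>. Q z - g z\<bar>"
    using Q_int g_int by (simp add: bf)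
  also have "\<dots> \<le> (LINT z|\<nu>. \<bar>Q z - g z\<bar>)"
    by (rule integral_abs_bound)
  also have "\<dots> \<le> \<epsilon>"
    using Q_int g_int Q_close
    by (intro integral_le_const AE_I2 integrable_abs Bochner_Integration.integrable_diff)
      (simp_all add: prob_measures_squareD(3)[OF \<nu>])
  finally show ?thesis .
qed

section \<open>Trapezoidal partitions\<close>

text \<open>Half of this square is a differentiable antiderivative of the positive part, so a ramp
  can be integrated in one piece without splitting the interval at its kinks.\<close>

lemma DERIV_max_zero_square: "DERIV (\<lambda>x::real. (max 0 x)\<^sup>2) x :> 2 * max 0 x"
proof -
  consider "x > 0" | "x < 0" | "x = 0" by linarith
  then show ?thesis
  proof cases
    case 1
    have "((\<lambda>x. x\<^sup>2) has_real_derivative 2 * x) (at x)"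
      by (auto intro!: derivative_eq_intros)
    then have "((\<lambda>x. (max 0 x)\<^sup>2) has_real_derivative 2 * x) (at x)"
      by (rule has_field_derivative_transform_within_open[where S = "{0<..}"]) (use 1 in auto)
    then show ?thesis using 1 by simp
  next
    case 2
    have "((\<lambda>x. 0) has_real_derivative 0) (at x)"
      by simp
    then have "((\<lambda>x. (max 0 x)\<^sup>2) has_real_derivative 0) (at x)"
      by (rule has_field_derivative_transform_within_open[where S = "{..<0}"]) (use 2 in auto)
    then show ?thesis using 2 by simp
  next
    case 3
    have "((\<lambda>h::real. max 0 h) \<longlongrightarrow> max 0 0) (at 0)"
      by (intro tendsto_intros)
    moreover have "\<forall>\<^sub>F h in at (0::real). max 0 h = (max 0 h)\<^sup>2 / h"
      by (auto simp: eventually_at_filter max_def power2_eq_square)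
    ultimately have "((\<lambda>h::real. (max 0 h)\<^sup>2 / h) \<longlongrightarrow> max 0 0) (at 0)"
      by (rule Lim_transform_eventually)
    then show ?thesis
      using 3 by (simp add: DERIV_def)
  qed
qed

lemma LINT_leb1_FTC:
  fixes f F :: "real \<Rightarrow> real"
  assumes "\<And>x. DERIV F x :> f x" "continuous_on UNIV f"
  shows "(LINT x|leb1. f x) = F 1 - F 0"
proof -
  have "(LINT x|leb1. f x) = (LINT x|lborel. indicator {0..1} x *\<^sub>R f x)"
    unfolding leb1_def by (rule integral_restrict_space) simp
  also have "\<dots> = (LINT x|lborel. f x * indicator {0..1} x)"
    by (simp add: mult.commute)
  also have "\<dots> = F 1 - F 0"
    using assms by (intro integral_FTC_Icc_real) (simp_all add: continuous_on_eq_continuous_at)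
  finally show ?thesis .
qed

text \<open>A jump at \<open>c\<close> made linear over \<open>[c - d/2, c + d/2]\<close>. The
  transition is symmetric about \<open>c\<close>, so as long as it stays inside \<open>[0,1]\<close>
  it has the same integral as the jump.\<close>

definition ramp :: "real \<Rightarrow> real \<Rightarrow> real \<Rightarrow> real" where
  "ramp d c u = max 0 (min 1 ((u - c) / d + 1/2))"

lemma continuous_on_ramp: "continuous_on S (ramp d c)"
  unfolding ramp_def divide_inverse by (intro continuous_intros)

lemma LINT_ramp:
  assumes d: "d > 0" and c: "d/2 \<le> c" "c \<le> 1 - d/2"
  shows "(LINT u|leb1. ramp d c u) = 1 - c"
proof -
  define s where "s u = (u - c) / d + 1/2" for u
  \<comment> \<open>The ramp is the positive part of \<open>s\<close> minus that of
    \<open>s - 1\<close>; half the squares are antiderivatives of these, and \<open>d\<close> undoes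
    the inner derivative \<open>1/d\<close>.\<close>
  define F where "F u = d/2 * ((max 0 (s u))\<^sup>2 - (max 0 (s u - 1))\<^sup>2)" for u
  have s_deriv: "DERIV s u :> 1/d" "DERIV (\<lambda>u. s u - 1) u :> 1/d" for u
    unfolding s_def using d by (auto intro!: derivative_eq_intros)
  have "DERIV F u :> ramp d c u" for u
  proof -
    have "DERIV F u :> d/2 * (2 * max 0 (s u) * (1/d) - 2 * max 0 (s u - 1) * (1/d))"
      unfolding F_def
      by (intro DERIV_cmult DERIV_diff DERIV_chain2[OF DERIV_max_zero_square] s_deriv)
    also have "d/2 * (2 * max 0 (s u) * (1/d) - 2 * max 0 (s u - 1) * (1/d)) =
        max 0 (s u) - max 0 (s u - 1)"
      using d by (simp add: field_simps)
    also have "\<dots> = ramp d c u"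
      unfolding ramp_def s_def[symmetric] by (simp add: max_def min_def)
    finally show ?thesis .
  qed
  then have "(LINT u|leb1. ramp d c u) = F 1 - F 0"
    by (intro LINT_leb1_FTC continuous_on_ramp)
  moreover have "F 0 = 0"
  proof -
    have "s 0 \<le> 0"
      using d c by (simp add: s_def field_simps)
    then show ?thesis
      by (simp add: F_def)
  qed
  moreover have "F 1 = 1 - c"
  proof -
    have "s 1 - 1 \<ge> 0"
      using d c by (simp add: s_def field_simps)
    then have "F 1 = d * s 1 - d/2"
      by (simp add: F_def power2_eq_square algebra_simps)
    also have "d * s 1 = 1 - c + d/2"
      using d by (simp add: s_def distrib_left)
    finally show ?thesis by simp
  qed
  ultimately show ?thesis by simp
qed

text \<open>The ends are constants: a ramp centred at 0 or 1 would leave the interval with half of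
  its transition, which would spoil the integral and the telescoping sum.\<close>

definition soft_step :: "nat \<Rightarrow> real \<Rightarrow> nat \<Rightarrow> real \<Rightarrow> real" where
  "soft_step k d j u = (if j = 0 then 1 else if j \<ge> k then 0 else ramp d (j / k) u)"

text \<open>A continuous version of the indicator of \<open>[(i-1)/k, i/k]\<close>; as differences
  of consecutive steps these functions telescope to 1. For \<open>d \<le> 1/k\<close> the
  transitions at neighbouring grid points meet at most in an endpoint.\<close>

definition trapezoid :: "nat \<Rightarrow> real \<Rightarrow> nat \<Rightarrow> real \<Rightarrow> real" where
  "trapezoid k d i u = soft_step k d (i - 1) u - soft_step k d i u"

lemma continuous_on_soft_step: "continuous_on S (soft_step k d j)"
  by (cases "j = 0"; cases "j \<ge> k") (simp_all add: soft_step_def[abs_def] continuous_on_ramp)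

lemma soft_step_range: "soft_step k d j u \<in> {0..1}"
  by (auto simp: soft_step_def ramp_def)

context
  fixes k :: nat and d :: real
  assumes k: "k \<ge> 1" and d: "0 < d" "d \<le> 1 / real k"
begin

lemma soft_step_eq_1:
  assumes "u \<in> unit_interval" "j / k + d/2 \<le> u"
  shows "soft_step k d j u = 1"
proof -
  have "j < k"
  proof (rule ccontr)
    assume "\<not> j < k"
    then have "1 \<le> real j / k" using k by simp
    then show False using assms d by simp
  qed
  moreover have "(u - j / k) / d + 1/2 \<ge> 1"
    using assms d(1) by (simp add: field_simps)
  ultimately show ?thesis
    by (simp add: soft_step_def ramp_def)
qed

lemma soft_step_eq_0:
  assumes "u \<in> unit_interval" "u \<le> j / k - d/2"
  shows "soft_step k d j u = 0"
proof -
  have "j \<noteq> 0"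
  proof
    assume "j = 0"
    then show False using assms d by simp
  qed
  moreover have "(u - j / k) / d + 1/2 \<le> 0"
    using assms d(1) by (simp add: field_simps)
  ultimately show ?thesis
    by (simp add: soft_step_def ramp_def)
qed

lemma soft_step_Suc_le: "soft_step k d (Suc j) u \<le> soft_step k d j u"
proof (cases "j = 0 \<or> Suc j \<ge> k")
  case True
  then show ?thesis
    using soft_step_range[of k d j u] soft_step_range[of k d "Suc j" u]
    by (auto simp: soft_step_def)
next
  case False
  have "(u - Suc j / k) / d \<le> (u - j / k) / d"
    using d(1) by (intro divide_right_mono diff_left_mono) (simp_all add: divide_right_mono)
  with False show ?thesis
    by (simp add: soft_step_def ramp_def max_def min_def)
qed

lemma LINT_soft_step:
  assumes "j \<le> k"
  shows "(LINT u|leb1. soft_step k d j u) = 1 - j / k"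
proof -
  interpret prob_space leb1 by (rule prob_space_leb1)
  consider "j = 0" | "j = k" | "0 < j" "j < k" using assms by linarith
  then show ?thesis
  proof cases
    case 1
    then show ?thesis
      by (simp add: soft_step_def prob_space[unfolded leb1_simps])
  next
    case 2
    then show ?thesis
      using k by (simp add: soft_step_def)
  next
    case 3
    have "1 / real k \<le> j / k" "j / k \<le> 1 - 1 / real k"
      using 3 by (auto simp: field_simps)
    then have "(LINT u|leb1. ramp d (j / k) u) = 1 - j / k"
      using d by (intro LINT_ramp) linarith+
    then show ?thesis
      using 3 by (simp add: soft_step_def)
  qed
qed

lemma continuous_on_trapezoid: "continuous_on S (trapezoid k d i)"
  unfolding trapezoid_def by (intro continuous_on_diff continuous_on_soft_step)

text \<open>The sum telescopes between the two constant steps, and the means are differences of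
  \<open>1 - j/k\<close> at consecutive \<open>j\<close>.\<close>

lemma trapezoid_cont_fair: "trapezoid k d \<in> cont_fair_partitions k"
  unfolding cont_fair_partitions_def fair_partitions_def
proof (intro CollectI conjI ballI continuous_on_trapezoid)
  fix i assume i: "i \<in> {1..k}"
  show "trapezoid k d i \<in> borel_measurable (restrict_space borel unit_interval)"
    by (intro borel_measurable_continuous_on_restrict continuous_on_trapezoid)
  show "0 \<le> trapezoid k d i x" for x
    using soft_step_Suc_le[of "i - 1" x] i by (simp add: trapezoid_def)
  have int: "integrable leb1 (soft_step k d j)" for j
  proof (rule leb1_integrable)
    show "soft_step k d j \<in> borel_measurable leb1"
      unfolding measurable_leb1
      by (intro borel_measurable_continuous_on_restrict continuous_on_soft_step)
    show "\<bar>soft_step k d j x\<bar> \<le> 1" for x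
      using soft_step_range[of k d j x] by simp
  qed
  have "(LINT x|leb1. trapezoid k d i x) = (LINT x|leb1. soft_step k d (i - 1) x) - (LINT x|leb1.
      soft_step k d i x)"
    unfolding trapezoid_def by (rule Bochner_Integration.integral_diff[OF int int])
  also have "\<dots> = 1 / k"
  proof -
    have "i - 1 \<le> k" "i \<le> k" using i by auto
    from this[THEN LINT_soft_step] show ?thesis
      using i k by (simp only: of_nat_diff) (simp add: of_nat_diff field_simps)
  qed
  finally show "(LINT x|leb1. trapezoid k d i x) = 1 / real k" .
next
  fix x
  have "(\<Sum>i=1..k. trapezoid k d i x) = (\<Sum>i<k. soft_step k d i x - soft_step k d (Suc i) x)"
    by (simp add: sum.atLeast1_atMost_eq trapezoid_def)
  also have "\<dots> = soft_step k d 0 x - soft_step k d k x"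
    by (rule sum_lessThan_telescope')
  finally show "(\<Sum>i=1..k. trapezoid k d i x) = 1"
    using k by (simp add: soft_step_def)
qed

lemma trapezoid_support:
  assumes i: "i \<in> {1..k}" and u: "u \<in> unit_interval" and nz: "trapezoid k d i u \<noteq> 0"
  shows "u \<in> {real (i - 1) / k - d/2 .. real i / k + d/2}"
proof -
  have le: "real (i - 1) / k \<le> real i / k"
    by (intro divide_right_mono) simp_all
  have False if "u < real (i - 1) / k - d/2"
    using nz soft_step_eq_0[OF u, of "i - 1"] soft_step_eq_0[OF u, of i] that le
    by (simp add: trapezoid_def)
  moreover have False if "u > real i / k + d/2"
    using nz soft_step_eq_1[OF u, of "i - 1"] soft_step_eq_1[OF u, of i] that le
    by (simp add: trapezoid_def)
  ultimately show ?thesis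
    by force
qed

text \<open>The support has length at most \<open>1/k + d\<close>, and \<open>d\<close> is at most
  \<open>1/k\<close>.\<close>

lemma trapezoid_local:
  assumes i: "i \<in> {1..k}" and xu: "x \<in> unit_interval" "u \<in> unit_interval"
    and nz: "trapezoid k d i x \<noteq> 0" "trapezoid k d i u \<noteq> 0"
  shows "\<bar>x - u\<bar> \<le> 2 / k"
proof -
  have "real i / k - real (i - 1) / k = 1 / k"
    using i by (simp add: of_nat_diff field_simps)
  then show ?thesis
    using trapezoid_support[OF i xu(1) nz(1)] trapezoid_support[OF i xu(2) nz(2)] d
    by (simp add: abs_le_iff)
qed

lemma LINT_indicator_Icc_leb1_le:
  assumes "a \<le> b"
  shows "(LINT u|leb1. indicator {a..b} u) \<le> b - a"
proof -
  have "(LINT u|leb1. indicator {a..b} u) = measure leb1 ({a..b} \<inter> unit_interval)"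
    by simp
  also have "\<dots> = measure lborel ({a..b} \<inter> unit_interval)"
    unfolding leb1_def by (rule measure_restrict_space) auto
  also have "\<dots> \<le> measure lborel {a..b}"
    by (rule measure_mono_fmeasurable) (auto intro: fmeasurable_compact)
  finally show ?thesis
    using assms by simp
qed

text \<open>With \<open>i\<close> fixed, \<open>k\<close> times the Gram entries are nonnegative and
  sum to 1, because the partition sums to 1 and \<open>trapezoid k d i\<close> has mean
  \<open>1/k\<close>. So only the diagonal entry needs an estimate, and its defect comes from the
  two transition windows.\<close>

lemma trapezoid_gram:
  assumes a: "a \<in> {1..k}" and i: "i \<in> {1..k}"
  shows "real k * (LINT u|leb1. trapezoid k d a u * trapezoid k d i u) \<in> {0..1}"
    and "\<bar>real k * (LINT u|leb1. trapezoid k d a u * trapezoid k d i u) - (if a =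
        i then 1 else 0)\<bar> \<le> 2 * k * d"
proof -
  have p: "trapezoid k d \<in> fair_partitions k"
    using trapezoid_cont_fair by (simp add: cont_fair_partitions_def)
  define A where "A b = real k * (LINT u|leb1. trapezoid k d b u * trapezoid k d i u)" for b
  note int = fair_partitions_integrable_mult[OF p]
  have A_nonneg: "0 \<le> A b" if "b \<in> {1..k}" for b
    unfolding A_def using fair_partitionsD(2)[OF p that] fair_partitionsD(2)[OF p i]
    by (intro mult_nonneg_nonneg integral_nonneg_AE AE_I2) simp_all
  have A_sum: "(\<Sum>b=1..k. A b) = 1"
  proof -
    have "(\<Sum>b=1..k. A b) = real k * (LINT u|leb1. (\<Sum>b=1..k. trapezoid k d b u * trapezoid k d i u))"
      unfolding A_def sum_distrib_left[symmetric]
      using int i by (subst Bochner_Integration.integral_sum) simp_all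
    also have "(LINT u|leb1. (\<Sum>b=1..k. trapezoid k d b u * trapezoid k d i u)) =
        (LINT u|leb1. trapezoid k d i u)"
      by (rule Bochner_Integration.integral_cong[OF refl])
        (simp only: sum_distrib_right[symmetric] fair_partitions_sum[OF p] leb1_simps mult_1)
    finally show ?thesis
      using fair_partitionsD(4)[OF p i] k by simp
  qed
  have A_diag: "A i \<ge> 1 - 2 * k * d"
  proof -
    define I :: "real \<Rightarrow> real \<Rightarrow> real" where "I c = indicator {c - d/2 .. c + d/2}" for c
    have int_I: "integrable leb1 (I c)" for c
      unfolding I_def by (intro leb1_integrable[of _ 1]) (auto simp: measurable_leb1 intro!:
          measurable_restrict_space1)
    have "(LINT u|leb1. trapezoid k d i u) - (LINT u|leb1. trapezoid k d i u * trapezoid k d i u) =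
        (LINT u|leb1. trapezoid k d i u - trapezoid k d i u * trapezoid k d i u)"
      using fair_partitionsD(5)[OF p i] int[OF i i] by simp
    \<comment> \<open>The function minus its square vanishes wherever the trapezoid is 0 or 1, hence
      outside two windows of length \<open>d\<close>, and is at most 1 inside them.\<close>
    also have "\<dots> \<le> (LINT u|leb1. I (real (i - 1) / k) u + I (real i / k) u)"
    proof (rule integral_mono)
      show "integrable leb1 (\<lambda>u. trapezoid k d i u - trapezoid k d i u * trapezoid k d i u)"
        using fair_partitionsD(5)[OF p i] int[OF i i] by simp
      show "integrable leb1 (\<lambda>u. I (real (i - 1) / k) u + I (real i / k) u)"
        using int_I by simp
      fix u assume "u \<in> space leb1"
      then have u: "u \<in> unit_interval" by simp
      have tr: "0 \<le> trapezoid k d i u" "trapezoid k d i u \<le> 1"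
        using fair_partitionsD(2,3)[OF p i u] by simp_all
      show "trapezoid k d i u - trapezoid k d i u * trapezoid k d i u \<le> I (real (i - 1) / k) u +
          I (real i / k) u"
      proof (cases "\<bar>u - real (i - 1) / k\<bar> \<le> d/2 \<or> \<bar>u - real i / k\<bar> \<le> d/2")
        case True
        have "I c u = 1" if "\<bar>u - c\<bar> \<le> d/2" for c
        proof -
          have "u \<in> {c - d/2 .. c + d/2}"
            using that unfolding abs_le_iff by (simp add: algebra_simps)
          then show ?thesis
            by (simp add: I_def)
        qed
        moreover have "0 \<le> I c u" for c
          by (simp add: I_def)
        ultimately have "1 \<le> I (real (i - 1) / k) u + I (real i / k) u"
          using True by (metis add.commute add_increasing order_refl)
        moreover have "trapezoid k d i u - trapezoid k d i u * trapezoid k d i u \<le> 1"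
          using tr mult_nonneg_nonneg[OF tr(1) tr(1)] by linarith
        ultimately show ?thesis by linarith
      next
        case False
        have "soft_step k d j u \<in> {0, 1}" if "\<not> \<bar>u - real j / k\<bar> \<le> d/2" for j
        proof -
          have "u \<le> real j / k - d/2 \<or> real j / k + d/2 \<le> u"
            using that by linarith
          then show ?thesis
            using soft_step_eq_0[OF u, of j] soft_step_eq_1[OF u, of j] by blast
        qed
        then have "soft_step k d (i - 1) u \<in> {0, 1}" "soft_step k d i u \<in> {0, 1}"
          using False by blast+
        then have "trapezoid k d i u \<in> {0, 1}"
          using tr by (auto simp: trapezoid_def)
        then show ?thesis
          by (auto simp: I_def)
      qed
    qed
    also have "\<dots> = (LINT u|leb1. I (real (i - 1) / k) u) + (LINT u|leb1. I (real i / k) u)"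
      using int_I by (rule Bochner_Integration.integral_add[OF _ int_I])
    also have "\<dots> \<le> d + d"
      unfolding I_def using LINT_indicator_Icc_leb1_le[of "c - d/2" "c + d/2" for c] d
      by (intro add_mono) (force intro: order_trans)+
    finally have "1 / k - (LINT u|leb1. trapezoid k d i u * trapezoid k d i u) \<le> 2 * d"
      using fair_partitionsD(4)[OF p i] by simp
    then have "real k * (1 / k - (LINT u|leb1. trapezoid k d i u * trapezoid k d i u)) \<le>
        real k * (2 * d)"
      by (rule mult_left_mono) simp
    then show ?thesis
      using k by (simp add: A_def right_diff_distrib mult_ac)
  qed
  have A_le: "A b \<le> 1" if "b \<in> {1..k}" for b
    using member_le_sum[of b "{1..k}" A] A_nonneg that A_sum by simp
  show "real k * (LINT u|leb1. trapezoid k d a u * trapezoid k d i u) \<in> {0..1}"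
    using A_nonneg[OF a] A_le[OF a] by (simp add: A_def)
  have "\<bar>A a - (if a = i then 1 else 0)\<bar> \<le> 2 * k * d"
  proof (cases "a = i")
    case True
    then show ?thesis
      using A_diag A_le[OF i] by simp
  next
    case False
    \<comment> \<open>An off-diagonal entry competes with the diagonal one for total mass 1, so it
      is bounded by the diagonal defect.\<close>
    have "(\<Sum>b\<in>{a, i}. A b) \<le> (\<Sum>b=1..k. A b)"
      using a i A_nonneg by (intro sum_mono2) auto
    then have "A a + A i \<le> 1"
      using False A_sum by simp
    then show ?thesis
      using A_diag A_nonneg[OF a] False by simp
  qed
  then show "\<bar>real k * (LINT u|leb1. trapezoid k d a u * trapezoid k d i u) - (if a =
      i then 1 else 0)\<bar> \<le> 2 * k * d"
    by (simp add: A_def)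
qed

end

text \<open>The left matrix is \<open>M\<close> multiplied on both sides by \<open>A\<close>, which
  is \<open>k\<close> times the Gram matrix of \<open>p\<close> and close to the identity. The error
  is averaged with the entries of \<open>M\<close> as weights; these are nonnegative of sum 1, so
  the bound grows neither with \<open>k\<close> nor with \<mu>.\<close>

lemma quotient_matrix_Phi_block_kernel:
  assumes k: "k \<ge> 1" and f: "f \<in> cont_fair_partitions k" and p: "p \<in> cont_fair_partitions k"
    and \<mu>: "\<mu> \<in> prob_measures_square"
    and gram: "\<And>a i. a \<in> {1..k} \<Longrightarrow> i \<in> {1..k} \<Longrightarrow> real k * (LINT u|leb1. p a u * p i u) \<in> {0..1}"
      "\<And>a i. a \<in> {1..k} \<Longrightarrow> i \<in> {1..k} \<Longrightarrow>
        \<bar>real k * (LINT u|leb1. p a u * p i u) - (if a = i then 1 else 0)\<bar> \<le> \<eta>"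
    and ij: "i \<in> {1..k}" "j \<in> {1..k}"
  shows "\<bar>quotient_matrix k p (Phi (block_kernel k f p) \<mu>) (i, j) - quotient_matrix k f \<mu> (i, j)\<bar>
      \<le> 2 * \<eta>"
proof -
  have f': "f \<in> fair_partitions k" and p': "p \<in> fair_partitions k"
    using f p by (simp_all add: cont_fair_partitions_def)
  define M where "M = quotient_matrix k f \<mu>"
  define A where "A a b = real k * (LINT u|leb1. p a u * p b u)" for a b
  define \<delta> where "\<delta> a b = (if a = b then 1 else 0 :: real)" for a b :: nat
  note cont = continuous_on_tensor[OF p ij]
  note int = fair_partitions_integrable_mult[OF p']
  have "quotient_matrix k p (Phi (block_kernel k f p) \<mu>) (i, j) =
      block_functional k p (\<lambda>w. p i (fst w) * p j (snd w)) M"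
    unfolding quotient_matrix_eq[OF ij] M_def by (rule integral_Phi_block_kernel[OF k f p \<mu> cont])
  also have "\<dots> = (\<Sum>a=1..k. \<Sum>b=1..k. M (a, b) * (A a i * A b j))"
    unfolding block_functional_def sum_distrib_left
  proof (intro sum.cong refl)
    fix a b assume ab: "a \<in> {1..k}" "b \<in> {1..k}"
    have "(LINT w|leb2. p a (fst w) * p b (snd w) * (p i (fst w) * p j (snd w))) =
        (LINT w|leb2. (p a (fst w) * p i (fst w)) * (p b (snd w) * p j (snd w)))"
      by (simp only: mult_ac)
    also have "\<dots> = (LINT u|leb1. p a u * p i u) * (LINT v|leb1. p b v * p j v)"
      by (rule leb2_integral_prod(1)[OF int int]) (use ab ij in simp_all)
    finally show "(real k)\<^sup>2 * (M (a, b) * (LINT w|leb2. p a (fst w) * p b (snd w) * (p i (fst w)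
        * p j (snd w)))) =
        M (a, b) * (A a i * A b j)"
      by (simp add: A_def power2_eq_square)
  qed
  finally have q: "quotient_matrix k p (Phi (block_kernel k f p) \<mu>) (i, j) =
      (\<Sum>a=1..k. \<Sum>b=1..k. M (a, b) * (A a i * A b j))" .
  have inner: "(\<Sum>b=1..k. M (a, b) * (\<delta> a i * \<delta> b j)) = (if a = i then M (i, j) else 0)" for a
  proof -
    have "(\<Sum>b=1..k. M (a, b) * (\<delta> a i * \<delta> b j)) = (\<Sum>b=1..k. if b = j then M (a, b) * \<delta> a i else 0)"
      by (rule sum.cong) (simp_all add: \<delta>_def)
    then show ?thesis
      using ij(2) by (simp add: \<delta>_def)
  qed
  have m: "M (i, j) = (\<Sum>a=1..k. \<Sum>b=1..k. M (a, b) * (\<delta> a i * \<delta> b j))"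
    unfolding inner using ij(1) by simp
  have "\<bar>quotient_matrix k p (Phi (block_kernel k f p) \<mu>) (i, j) - M (i, j)\<bar> =
      \<bar>\<Sum>a=1..k. \<Sum>b=1..k. M (a, b) * (A a i * A b j - \<delta> a i * \<delta> b j)\<bar>"
    unfolding q m right_diff_distrib sum_subtractf ..
  also have "\<dots> \<le> (\<Sum>a=1..k. \<Sum>b=1..k. \<bar>M (a, b) * (A a i * A b j - \<delta> a i * \<delta> b j)\<bar>)"
    by (rule order_trans[OF sum_abs sum_mono[OF sum_abs]])
  also have "\<dots> \<le> (\<Sum>a=1..k. \<Sum>b=1..k. M (a, b) * (2 * \<eta>))"
  proof (rule sum_mono, rule sum_mono)
    fix a b assume ab: "a \<in> {1..k}" "b \<in> {1..k}"
    have M: "0 \<le> M (a, b)"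
      using quotient_matrix_range[OF \<mu> f' ab] by (simp add: M_def)
    have "A a i \<in> {0..1}"
      unfolding A_def by (rule gram(1)[OF ab(1) ij(1)])
    then have A: "\<bar>A a i\<bar> \<le> 1" "\<bar>A a i - \<delta> a i\<bar> \<le> \<eta>" "\<bar>A b j - \<delta> b j\<bar> \<le> \<eta>"
      using gram(2)[OF ab(1) ij(1)] gram(2)[OF ab(2) ij(2)] unfolding A_def \<delta>_def by auto
    \<comment> \<open>One factor is changed at a time. The factors left over, \<open>A a i\<close>
      and \<open>\<delta> b j\<close>, are at most 1, so each change costs \<eta>.\<close>
    have "A a i * A b j - \<delta> a i * \<delta> b j = A a i * (A b j - \<delta> b j) + \<delta> b j * (A a i - \<delta> a i)"
      by (simp add: algebra_simps)
    then have "\<bar>A a i * A b j - \<delta> a i * \<delta> b j\<bar> \<le> \<bar>A a i\<bar> * \<bar>A b j - \<delta> b j\<bar> +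
        \<bar>\<delta> b j\<bar> * \<bar>A a i - \<delta> a i\<bar>"
      using abs_triangle_ineq[of "A a i * (A b j - \<delta> b j)" "\<delta> b j * (A a i - \<delta> a i)"]
      by (simp only: abs_mult)
    also have "\<dots> \<le> 1 * \<eta> + 1 * \<eta>"
      using A by (intro add_mono mult_mono) (simp_all add: \<delta>_def)
    finally show "\<bar>M (a, b) * (A a i * A b j - \<delta> a i * \<delta> b j)\<bar> \<le> M (a, b) * (2 * \<eta>)"
      unfolding abs_mult[of "M (a, b)"] using M by (simp add: mult_left_mono)
  qed
  also have "\<dots> = 2 * \<eta>"
    unfolding sum_distrib_right[symmetric] M_def quotient_matrix_sum[OF \<mu> f'] by simp
  finally show ?thesis
    by (simp add: M_def)
qed

text \<open>A finite family has a common modulus of uniform continuity, so one grid serves every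
  function in it and every measure.\<close>

lemma uniform_block_approximation:
  fixes G :: "(real \<times> real \<Rightarrow> real) set"
  assumes G: "finite G" "\<And>g. g \<in> G \<Longrightarrow> continuous_on unit_square g" and "\<epsilon> > 0"
  obtains k where "k \<ge> 1"
    "\<And>\<nu> g. \<nu> \<in> prob_measures_square \<Longrightarrow> g \<in> G \<Longrightarrow>
      \<bar>block_functional k (trapezoid k (1 / real k)) g (quotient_matrix k (trapezoid k (1 / real
          k)) \<nu>)
        - (LINT z|\<nu>. g z)\<bar> \<le> \<epsilon>"
proof -
  have "\<exists>\<eta>>0. \<forall>z\<in>unit_square. \<forall>w\<in>unit_square. dist w z < \<eta> \<longrightarrow> dist (g w) (g z) < \<epsilon>"
    if "g \<in> G" for g
    using compact_uniformly_continuous[OF G(2)[OF that]] \<open>\<epsilon> > 0\<close>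
    unfolding uniformly_continuous_on_def by (simp add: compact_Times)
  then obtain \<eta> where \<eta>: "\<And>g. g \<in> G \<Longrightarrow> \<eta> g > 0"
    and osc: "\<And>g z w. g \<in> G \<Longrightarrow> z \<in> unit_square \<Longrightarrow> w \<in> unit_square \<Longrightarrow>
      dist w z < \<eta> g \<Longrightarrow> dist (g w) (g z) < \<epsilon>"
    by metis
  define \<rho> where "\<rho> = Min (insert 1 (\<eta> ` G))"
  have "\<rho> > 0"
    unfolding \<rho>_def using G(1) \<eta> by (subst Min_gr_iff) auto
  have \<rho>: "\<rho> \<le> \<eta> g" if "g \<in> G" for g
    unfolding \<rho>_def using that G(1) by (intro Min_le) auto
  \<comment> \<open>Supports have length at most \<open>2/k\<close> in each coordinate, and a
    distance in the plane is at most the sum of the coordinate distances; together this is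
    \<open>4/k\<close>.\<close>
  obtain k :: nat where k: "k > 4 / \<rho>"
    using reals_Archimedean2 by blast
  have "k \<ge> 1"
    using k \<open>\<rho> > 0\<close> by (cases k) (simp_all add: not_less)
  then have kd: "0 < 1 / real k" "1 / real k \<le> 1 / real k" by simp_all
  have small: "2 / real k + 2 / real k < \<rho>"
    using k \<open>\<rho> > 0\<close> \<open>k \<ge> 1\<close> by (simp add: field_simps)
  show thesis
  proof (rule that[OF \<open>k \<ge> 1\<close>])
    fix \<nu> g assume \<nu>: "\<nu> \<in> prob_measures_square" and g: "g \<in> G"
    show "\<bar>block_functional k (trapezoid k (1 / real k)) g (quotient_matrix k (trapezoid k (1 /
        real k)) \<nu>)
        - (LINT z|\<nu>. g z)\<bar> \<le> \<epsilon>"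
    proof (rule block_functional_quotient_matrix_approx[OF \<open>k \<ge> 1\<close> _ \<nu> G(2)[OF g], where \<eta> =
        "2 / k"])
      show "trapezoid k (1 / real k) \<in> fair_partitions k"
        using trapezoid_cont_fair[OF \<open>k \<ge> 1\<close> kd] by (simp add: cont_fair_partitions_def)
      show "\<bar>x - u\<bar> \<le> 2 / k" if "i \<in> {1..k}" "x \<in> unit_interval" "u \<in> unit_interval"
        "trapezoid k (1 / real k) i x \<noteq> 0" "trapezoid k (1 / real k) i u \<noteq> 0" for i x u
        by (rule trapezoid_local[OF \<open>k \<ge> 1\<close> kd that])
      fix z w :: "real \<times> real"
      assume zw: "z \<in> unit_square" "w \<in> unit_square" "\<bar>fst z - fst w\<bar> \<le> 2 / k" "\<bar>snd z - snd w\<bar> \<le>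
          2 / k"
      have "dist w z \<le> dist (fst w) (fst z) + dist (snd w) (snd z)"
        unfolding dist_prod_def by (rule sqrt_sum_squares_le_sum) simp_all
      also have "\<dots> < \<eta> g"
        using zw small \<rho>[OF g] by (simp add: dist_real_def abs_minus_commute)
      finally show "\<bar>g z - g w\<bar> \<le> \<epsilon>"
        using osc[OF g zw(1,2)] by (simp add: dist_real_def abs_minus_commute less_imp_le)
    qed
  qed
qed

lemma block_functional_lipschitz:
  fixes G :: "(real \<times> real \<Rightarrow> real) set"
  assumes "finite G" "\<epsilon> > 0"
  obtains \<delta> where "\<delta> > 0"
    "\<And>M M' g. g \<in> G \<Longrightarrow> (\<And>i j. i \<in> {1..k} \<Longrightarrow> j \<in> {1..k} \<Longrightarrow> \<bar>M (i, j) - M' (i, j)\<bar> < \<delta>) \<Longrightarrow>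
      \<bar>block_functional k p g M - block_functional k p g M'\<bar> \<le> \<epsilon>"
proof -
  define B where "B g = (real k)\<^sup>2 * (\<Sum>i=1..k. \<Sum>j=1..k. \<bar>LINT w|leb2. p i (fst w) * p j (snd w) *
      g w\<bar>)" for g
  have B0: "0 \<le> B g" for g
    unfolding B_def by (intro mult_nonneg_nonneg sum_nonneg) simp_all
  \<comment> \<open>\<open>B g\<close> is a Lipschitz constant for \<open>g\<close>; the sum bounds
    all of them, and the added 1 keeps the denominator positive.\<close>
  define \<delta> where "\<delta> = \<epsilon> / (1 + (\<Sum>g\<in>G. B g))"
  have pos: "1 + (\<Sum>g\<in>G. B g) > 0"
    using sum_nonneg[of G B] B0 by (simp add: add_pos_nonneg)
  show thesis
  proof (rule that)
    show "\<delta> > 0"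
      using pos \<open>\<epsilon> > 0\<close> by (simp add: \<delta>_def)
    fix M M' :: "nat \<times> nat \<Rightarrow> real" and g
    assume g: "g \<in> G" and MM: "\<And>i j. i \<in> {1..k} \<Longrightarrow> j \<in> {1..k} \<Longrightarrow> \<bar>M (i, j) - M' (i, j)\<bar> < \<delta>"
    define c where "c i j = (LINT w|leb2. p i (fst w) * p j (snd w) * g w)" for i j
    have "block_functional k p g M - block_functional k p g M' =
        (real k)\<^sup>2 * (\<Sum>i=1..k. \<Sum>j=1..k. (M (i, j) - M' (i, j)) * c i j)"
      unfolding block_functional_def c_def left_diff_distrib sum_subtractf right_diff_distrib ..
    also have "\<bar>\<dots>\<bar> \<le> (real k)\<^sup>2 * (\<Sum>i=1..k. \<Sum>j=1..k. \<bar>(M (i, j) - M' (i, j)) * c i j\<bar>)"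
      unfolding abs_mult[of "(real k)\<^sup>2"]
      by (simp add: mult_left_mono order_trans[OF sum_abs sum_mono[OF sum_abs]])
    also have "\<dots> \<le> (real k)\<^sup>2 * (\<Sum>i=1..k. \<Sum>j=1..k. \<delta> * \<bar>c i j\<bar>)"
      using MM by (intro mult_left_mono sum_mono) (simp_all add: abs_mult mult_right_mono
          less_imp_le)
    also have "\<dots> = \<delta> * B g"
      by (simp add: B_def c_def sum_distrib_left mult_ac)
    also have "\<dots> \<le> \<delta> * (1 + (\<Sum>g\<in>G. B g))"
      using member_le_sum[of g G B] g B0 assms(1) \<open>\<delta> > 0\<close> by (intro mult_left_mono) auto
    also have "\<dots> = \<epsilon>"
      using pos by (simp add: \<delta>_def)
    finally show "\<bar>block_functional k p g M - block_functional k p g M'\<bar> \<le> \<epsilon>" .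
  qed
qed

section \<open>Continuous approximation of fair partitions\<close>

text \<open>A discrete layer-cake formula: exactly \<open>\<lfloor>n * t\<rfloor>\<close> of the
  levels \<open>m/n\<close> with \<open>m \<ge> 1\<close> lie at or below \<open>t\<close>.\<close>

lemma level_sets_approx:
  fixes t :: real
  assumes t: "t \<in> {0..1}" and n: "n \<ge> 1"
  shows "\<bar>t - (\<Sum>m=1..n. indicator {real m / n..} t) / n\<bar> \<le> 1 / n"
proof -
  define N where "N = nat \<lfloor>n * t\<rfloor>"
  have nt: "0 \<le> n * t" "n * t \<le> n"
    using t n by (auto intro: mult_left_le)
  have N: "real N \<le> n * t" "n * t < real N + 1"
    using nt by (simp_all add: N_def)
  have "N \<le> n"
    using N(1) nt(2) by linarith
  have "real m / n \<le> t \<longleftrightarrow> m \<le> N" for m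
  proof -
    have "real m / n \<le> t \<longleftrightarrow> real m \<le> n * t"
      using n by (simp add: divide_le_eq mult.commute)
    also have "\<dots> \<longleftrightarrow> m \<le> N"
      using nt(1) by (simp add: N_def le_nat_floor le_nat_iff le_floor_iff)
    finally show ?thesis .
  qed
  then have "(\<Sum>m=1..n. indicator {real m / n..} t :: real) = (\<Sum>m=1..n. if m \<in> {1..N} then 1 else 0)"
    by (intro sum.cong) (simp_all add: indicator_def)
  also have "\<dots> = (\<Sum>m\<in>{1..n} \<inter> {1..N}. 1)"
    by (rule sum.inter_restrict[symmetric]) simp
  also have "{1..n} \<inter> {1..N} = {1..N}"
    using \<open>N \<le> n\<close> by auto
  finally have "(\<Sum>m=1..n. indicator {real m / n..} t :: real) = real N"
    by simp
  moreover have "\<bar>t - real N / n\<bar> \<le> 1 / n"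
  proof -
    have "t - real N / n = (n * t - real N) / n"
      using n by (simp add: field_simps)
    also have "\<bar>\<dots>\<bar> = \<bar>n * t - real N\<bar> / n"
      by simp
    also have "\<dots> \<le> 1 / n"
      using N by (intro divide_right_mono) auto
    finally show ?thesis .
  qed
  ultimately show ?thesis by simp
qed

text \<open>Reduces functions to sets through their level sets. The level sets are averaged, so the
  continuous substitutes stay in \<open>[0,1]\<close> and their errors do not add up.\<close>

lemma borel_prob_approx_continuous:
  fixes \<M> :: "'a::euclidean_space measure set" and f :: "'a \<Rightarrow> real"
  assumes \<M>: "finite \<M>" "\<And>M. M \<in> \<M> \<Longrightarrow> prob_space M \<and> sets M = sets borel"
    and f: "f \<in> borel_measurable borel" "\<And>x. f x \<in> {0..1}" and "\<epsilon> > 0"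
  obtains g :: "'a \<Rightarrow> real" where "continuous_on UNIV g" "\<And>x. g x \<in> {0..1}"
    "\<And>M. M \<in> \<M> \<Longrightarrow> (LINT x|M. \<bar>f x - g x\<bar>) \<le> \<epsilon>"
proof -
  \<comment> \<open>Half of \<epsilon> pays for rounding to \<open>n\<close> levels. The other half
    is the precision at every single level, since a mean of \<open>n\<close> such errors is no
    larger.\<close>
  obtain n :: nat where n: "real n > 2 / \<epsilon>"
    using reals_Archimedean2 by blast
  have "n \<ge> 1"
    using n \<open>\<epsilon> > 0\<close> by (cases n) (simp_all add: not_less)
  have n_inv: "1 / n \<le> \<epsilon> / 2"
    using n \<open>\<epsilon> > 0\<close> \<open>n \<ge> 1\<close> by (simp add: field_simps)
  define A where "A m = f -` {real m / n..}" for m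
  have A: "A m \<in> sets borel" for m
    using measurable_sets[OF f(1), of "{real m / n..}"] by (simp add: A_def)
  have "\<forall>m. \<exists>g :: 'a \<Rightarrow> real. continuous_on UNIV g \<and> (\<forall>x. g x \<in> {0..1}) \<and>
      (\<forall>M\<in>\<M>. (LINT x|M. \<bar>indicator (A m) x - g x\<bar>) \<le> \<epsilon>/2)"
  proof
    fix m
    have "finite_measure M \<and> sets M = sets borel" if "M \<in> \<M>" for M
      using \<M>(2)[OF that] by (simp add: prob_space.finite_measure)
    note M = this
    have "\<epsilon>/2 > 0" using \<open>\<epsilon> > 0\<close> by simp
    obtain g :: "'a \<Rightarrow> real" where "continuous_on UNIV g" "\<And>x. g x \<in> {0..1}"
      "\<And>M. M \<in> \<M> \<Longrightarrow> (LINT x|M. \<bar>indicator (A m) x - g x\<bar>) \<le> \<epsilon>/2"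
      using finite_borel_measure_approx_set[OF \<M>(1) M A[of m] \<open>\<epsilon>/2 > 0\<close>] by blast
    then show "\<exists>g :: 'a \<Rightarrow> real. continuous_on UNIV g \<and> (\<forall>x. g x \<in> {0..1}) \<and>
      (\<forall>M\<in>\<M>. (LINT x|M. \<bar>indicator (A m) x - g x\<bar>) \<le> \<epsilon>/2)"
      by (intro exI[of _ g]) blast
  qed
  from choice[OF this] obtain g :: "nat \<Rightarrow> 'a \<Rightarrow> real"
    where g: "\<And>m. continuous_on UNIV (g m)" "\<And>m x. g m x \<in> {0..1}"
      "\<And>m M. M \<in> \<M> \<Longrightarrow> (LINT x|M. \<bar>indicator (A m) x - g m x\<bar>) \<le> \<epsilon>/2"
    by blast
  define h where "h x = (\<Sum>m=1..n. g m x) / n" for x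
  have h01: "h x \<in> {0..1}" for x
  proof -
    have "(\<Sum>m=1..n. g m x) \<le> (\<Sum>m=1..n. 1)"
      using g(2) by (intro sum_mono) simp
    moreover have "0 \<le> (\<Sum>m=1..n. g m x)"
      using g(2) by (intro sum_nonneg) simp
    ultimately show ?thesis
      using \<open>n \<ge> 1\<close> by (simp add: h_def)
  qed
  have h_cont: "continuous_on UNIV h"
    unfolding h_def divide_inverse by (intro continuous_intros g(1))
  show thesis
  proof (rule that[OF h_cont h01])
    fix M assume M: "M \<in> \<M>"
    interpret prob_space M using \<M>(2)[OF M] by simp
    have s: "sets M = sets borel" using \<M>(2)[OF M] by simp
    note meas_eq = measurable_cong_sets[OF s refl]
    have gm: "g m \<in> borel_measurable M" for m
      unfolding meas_eq by (rule borel_measurable_continuous_onI[OF g(1)])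
    have fh: "(\<lambda>x. f x - h x) \<in> borel_measurable M"
      unfolding meas_eq by (intro borel_measurable_diff f(1) borel_measurable_continuous_onI[OF
          h_cont])
    have Am: "indicator (A m) \<in> borel_measurable M" for m
      using A[of m] s by (intro borel_measurable_indicator) simp
    have int: "integrable M (\<lambda>x. \<bar>indicator (A m) x - g m x\<bar>)" for m
    proof (rule integrable_const_bound[of _ 1])
      show "AE x in M. norm \<bar>indicator (A m) x - g m x\<bar> \<le> 1"
        using g(2)[of m] by (intro AE_I2) (auto simp: indicator_def)
    qed (intro borel_measurable_abs borel_measurable_diff Am gm)
    have pw: "\<bar>f x - h x\<bar> \<le> 1 / n + (\<Sum>m=1..n. \<bar>indicator (A m) x - g m x\<bar>) / n" for x
    proof -
      have "\<bar>f x - (\<Sum>m=1..n. indicator (A m) x) / n\<bar> \<le> 1 / n"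
        using level_sets_approx[OF f(2)[of x] \<open>n \<ge> 1\<close>] by (simp add: A_def indicator_def)
      moreover have "\<bar>(\<Sum>m=1..n. indicator (A m) x) / n - h x\<bar> \<le>
          (\<Sum>m=1..n. \<bar>indicator (A m) x - g m x\<bar>) / n"
      proof -
        have "(\<Sum>m=1..n. indicator (A m) x) / n - h x = (\<Sum>m=1..n. indicator (A m) x - g m x) / n"
          by (simp add: h_def sum_subtractf diff_divide_distrib)
        then show ?thesis
          by (simp add: divide_right_mono)
      qed
      ultimately show ?thesis by linarith
    qed
    have "(LINT x|M. \<bar>f x - h x\<bar>) \<le> (LINT x|M. 1 / n + (\<Sum>m=1..n. \<bar>indicator (A m) x - g m x\<bar>) / n)"
    proof (rule integral_mono)
      show "integrable M (\<lambda>x. \<bar>f x - h x\<bar>)"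
      proof (rule integrable_const_bound[of _ 1])
        have "\<bar>f x - h x\<bar> \<le> 1" for x
          using f(2)[of x] h01[of x] unfolding atLeastAtMost_iff by linarith
        then show "AE x in M. norm \<bar>f x - h x\<bar> \<le> 1"
          by simp
      qed (intro borel_measurable_abs fh)
      show "integrable M (\<lambda>x. 1 / n + (\<Sum>m=1..n. \<bar>indicator (A m) x - g m x\<bar>) / n)"
        using int by (intro Bochner_Integration.integrable_add integrable_const
            integrable_divide_zero
          Bochner_Integration.integrable_sum)
    qed (rule pw)
    also have "\<dots> = 1 / n + (\<Sum>m=1..n. (LINT x|M. \<bar>indicator (A m) x - g m x\<bar>)) / n"
      using int by (simp add: prob_space)
    also have "\<dots> \<le> \<epsilon> / 2 + (\<Sum>m=1..n. \<epsilon> / 2) / n"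
      using n_inv g(3)[OF M] by (intro add_mono divide_right_mono sum_mono) simp_all
    also have "\<dots> = \<epsilon>"
      using \<open>n \<ge> 1\<close> by simp
    finally show "(LINT x|M. \<bar>f x - h x\<bar>) \<le> \<epsilon>" .
  qed
qed

text \<open>Lebesgue measure will control the means of the approximating functions, the two
  marginals the quotient matrix. All three are transported to the real line so that one
  approximation treats them together.\<close>

lemma fair_partitions_approx_continuous_L1:
  assumes \<mu>: "\<mu> \<in> prob_measures_square" and f: "f \<in> fair_partitions k" and "\<eta> > 0"
  obtains g :: "nat \<Rightarrow> real \<Rightarrow> real" where
    "\<And>i. continuous_on UNIV (g i)" "\<And>i x. g i x \<in> {0..1}"
    "\<And>i. i \<in> {1..k} \<Longrightarrow> (LINT x|leb1. \<bar>f i x - g i x\<bar>) \<le> \<eta>"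
    "\<And>i. i \<in> {1..k} \<Longrightarrow> (LINT z|\<mu>. \<bar>f i (fst z) - g i (fst z)\<bar>) \<le> \<eta>"
    "\<And>i. i \<in> {1..k} \<Longrightarrow> (LINT z|\<mu>. \<bar>f i (snd z) - g i (snd z)\<bar>) \<le> \<eta>"
proof -
  note fs = prob_measures_square_fst_snd[OF \<mu>]
  have idm: "(\<lambda>x. x) \<in> borel_measurable leb1"
    unfolding measurable_leb1 by (intro measurable_restrict_space1) simp
  define \<M> where "\<M> = {distr leb1 borel (\<lambda>x. x), distr \<mu> borel fst, distr \<mu> borel snd}"
  have \<M>: "finite \<M>" "\<And>M. M \<in> \<M> \<Longrightarrow> prob_space M \<and> sets M = sets borel"
    using prob_space.prob_space_distr[OF prob_space_leb1 idm]
      prob_space.prob_space_distr[OF prob_measures_squareD(1)[OF \<mu>] fs(1)]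
      prob_space.prob_space_distr[OF prob_measures_squareD(1)[OF \<mu>] fs(2)]
    by (auto simp: \<M>_def)
  \<comment> \<open>Values outside the interval are arbitrary, so they are set to 0 to obtain a
    Borel function on the line with values in \<open>[0,1]\<close>.\<close>
  define f' where "f' i x = indicator unit_interval x *\<^sub>R f i x" for i x
  have f'_eq: "f' i x = f i x" if "x \<in> unit_interval" for i x
    using that by (simp add: f'_def)
  have "\<exists>g :: real \<Rightarrow> real. continuous_on UNIV g \<and> (\<forall>x. g x \<in> {0..1}) \<and>
      (i \<in> {1..k} \<longrightarrow> (LINT x|leb1. \<bar>f i x - g x\<bar>) \<le> \<eta> \<and>
        (LINT z|\<mu>. \<bar>f i (fst z) - g (fst z)\<bar>) \<le> \<eta> \<and> (LINT z|\<mu>. \<bar>f i (snd z) - g (snd z)\<bar>) \<le> \<eta>)"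
    (is "\<exists>g. ?P i g") for i
  proof (cases "i \<in> {1..k}")
    case True
    have f'm: "f' i \<in> borel_measurable borel"
      using fair_partitionsD(1)[OF f True] unfolding measurable_leb1 f'_def[abs_def]
      by (subst (asm) borel_measurable_restrict_space_iff) simp_all
    have f'01: "f' i x \<in> {0..1}" for x
      using fair_partitionsD(2,3)[OF f True] by (cases "x \<in> unit_interval") (simp_all add: f'_def)
    obtain g :: "real \<Rightarrow> real" where g: "continuous_on UNIV g" "\<And>x. g x \<in> {0..1}"
        "\<And>M. M \<in> \<M> \<Longrightarrow> (LINT x|M. \<bar>f' i x - g x\<bar>) \<le> \<eta>"
      using borel_prob_approx_continuous[OF \<M> f'm f'01 \<open>\<eta> > 0\<close>] by blast
    have fg: "(\<lambda>x. \<bar>f' i x - g x\<bar>) \<in> borel_measurable borel"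
      by (intro borel_measurable_abs borel_measurable_diff f'm borel_measurable_continuous_onI[OF
          g(1)])
    have "(LINT x|leb1. \<bar>f i x - g x\<bar>) \<le> \<eta>"
    proof -
      have "(LINT x|leb1. \<bar>f i x - g x\<bar>) = (LINT x|leb1. \<bar>f' i x - g x\<bar>)"
        by (rule Bochner_Integration.integral_cong) (simp_all add: f'_eq)
      also have "\<dots> \<le> \<eta>"
        using g(3)[of "distr leb1 borel (\<lambda>x. x)"] by (simp add: \<M>_def integral_distr[OF idm fg])
      finally show ?thesis .
    qed
    moreover have "(LINT z|\<mu>. \<bar>f i (fst z) - g (fst z)\<bar>) \<le> \<eta>"
    proof -
      have "(LINT z|\<mu>. \<bar>f i (fst z) - g (fst z)\<bar>) = (LINT z|\<mu>. \<bar>f' i (fst z) - g (fst z)\<bar>)"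
        by (rule Bochner_Integration.integral_cong)
          (simp_all add: f'_eq prob_measures_squareD(3)[OF \<mu>] mem_Times_iff)
      also have "\<dots> \<le> \<eta>"
        using g(3)[of "distr \<mu> borel fst"] by (simp add: \<M>_def integral_distr[OF fs(1) fg])
      finally show ?thesis .
    qed
    moreover have "(LINT z|\<mu>. \<bar>f i (snd z) - g (snd z)\<bar>) \<le> \<eta>"
    proof -
      have "(LINT z|\<mu>. \<bar>f i (snd z) - g (snd z)\<bar>) = (LINT z|\<mu>. \<bar>f' i (snd z) - g (snd z)\<bar>)"
        by (rule Bochner_Integration.integral_cong)
          (simp_all add: f'_eq prob_measures_squareD(3)[OF \<mu>] mem_Times_iff)
      also have "\<dots> \<le> \<eta>"
        using g(3)[of "distr \<mu> borel snd"] by (simp add: \<M>_def integral_distr[OF fs(2) fg])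
      finally show ?thesis .
    qed
    ultimately show ?thesis
      using g(1,2) by blast
  next
    \<comment> \<open>Indices outside \<open>{1..k}\<close> get the zero function, so continuity and
      the range hold for every index without a side condition.\<close>
    case False
    then show ?thesis
      by (intro exI[of _ "\<lambda>_. 0"]) auto
  qed
  then have "\<forall>i. \<exists>g. ?P i g"
    by (rule allI)
  from choice[OF this] obtain g where "\<And>i. continuous_on UNIV (g i) \<and> (\<forall>x. g i x \<in> {0..1}) \<and>
      (i \<in> {1..k} \<longrightarrow> (LINT x|leb1. \<bar>f i x - g i x\<bar>) \<le> \<eta> \<and>
        (LINT z|\<mu>. \<bar>f i (fst z) - g i (fst z)\<bar>) \<le> \<eta> \<and> (LINT z|\<mu>. \<bar>f i (snd z) - g i (snd z)\<bar>) \<le> \<eta>)"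
    by blast
  then show thesis
    by (intro that[of g]) blast+
qed

text \<open>A family of nonnegative functions summing nearly to 1 is scaled down where its sum exceeds 1
  and topped up equally where it falls short.\<close>

definition partition_normalize :: "nat \<Rightarrow> (nat \<Rightarrow> real \<Rightarrow> real) \<Rightarrow> nat \<Rightarrow> real \<Rightarrow> real" where
  "partition_normalize k g i x =
     g i x / max 1 (\<Sum>j=1..k. g j x) + (1 - (\<Sum>j=1..k. g j x) / max 1 (\<Sum>j=1..k. g j x)) / k"

lemma partition_normalize_sum:
  assumes "k \<ge> 1"
  shows "(\<Sum>i=1..k. partition_normalize k g i x) = 1"
  using assms by (simp add: partition_normalize_def sum.distrib flip: sum_divide_distrib)

lemma partition_normalize_nonneg:
  assumes "\<And>j. 0 \<le> g j x"
  shows "0 \<le> partition_normalize k g i x"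
  unfolding partition_normalize_def using assms
  by (intro add_nonneg_nonneg divide_nonneg_nonneg) (auto simp: max_def sum_nonneg)

text \<open>If the sum \<open>s\<close> is at least 1, the entry loses the fraction
  \<open>(s - 1)/s\<close> of itself, at most \<open>s - 1\<close> because the entry is at most
  \<open>s\<close>. If \<open>s < 1\<close>, it gains only the \<open>k\<close>-th part of
  \<open>1 - s\<close>.\<close>

lemma partition_normalize_diff:
  assumes i: "i \<in> {1..k}" and g: "\<And>j. 0 \<le> g j x"
  shows "\<bar>partition_normalize k g i x - g i x\<bar> \<le> \<bar>(\<Sum>j=1..k. g j x) - 1\<bar>"
proof -
  define s where "s = (\<Sum>j=1..k. g j x)"
  have gs: "g i x \<le> s"
    unfolding s_def using i g by (intro member_le_sum) simp_all
  show ?thesis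
  proof (cases "s \<ge> 1")
    case True
    then have p_eq: "partition_normalize k g i x = g i x / s"
      unfolding partition_normalize_def s_def[symmetric] by simp
    define e where "e = (g i x / s) * (s - 1)"
    have "g i x - partition_normalize k g i x = e"
      using True p_eq by (simp add: e_def field_simps)
    moreover have le: "0 \<le> g i x / s" "g i x / s \<le> 1"
      using True g gs by simp_all
    have "0 \<le> e" "e \<le> 1 * (s - 1)"
      unfolding e_def by (intro mult_nonneg_nonneg mult_right_mono le; use True in simp)+
    ultimately have "partition_normalize k g i x - g i x = - e" "0 \<le> e" "e \<le> s - 1"
      by simp_all
    then show ?thesis
      unfolding s_def[symmetric] by simp
  next
    case False
    have "k \<ge> 1" using i by simp
    have "partition_normalize k g i x = g i x + (1 - s) / k"
      unfolding partition_normalize_def s_def[symmetric] using False by (simp add: max_def)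
    moreover have "0 \<le> (1 - s) / k"
      using False by simp
    moreover have "(1 - s) / k \<le> 1 - s"
      using False \<open>k \<ge> 1\<close> by (simp add: divide_le_eq mult_le_cancel_left1)
    ultimately show ?thesis
      unfolding s_def[symmetric] by linarith
  qed
qed

lemma continuous_partition_normalize:
  assumes "k \<ge> 1" "\<And>j. continuous_on S (g j)"
  shows "continuous_on S (partition_normalize k g i)"
  unfolding partition_normalize_def using assms(1)
  by (intro continuous_intros assms(2)) (auto simp: max_def)

text \<open>Normalising \<open>g\<close> restores the sum 1 but disturbs the means. They are
  repaired exactly by shrinking and adding constants, a change that is uniformly small and thus
  harmless for every marginal, however singular.\<close>

lemma quotient_matrix_approx_continuous:
  assumes k: "k \<ge> 1" and \<mu>: "\<mu> \<in> prob_measures_square" and f: "f \<in> fair_partitions k" and "\<epsilon> > 0"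
  obtains q where "q \<in> cont_fair_partitions k"
    "\<And>i j. i \<in> {1..k} \<Longrightarrow> j \<in> {1..k} \<Longrightarrow> \<bar>quotient_matrix k q \<mu> (i, j) - quotient_matrix k f \<mu> (i, j)\<bar>
        \<le> \<epsilon>"
proof -
  \<comment> \<open>Each of the two factors of a tensor will be within \<open>3 * t\<close> in mean,
    hence \<open>\<epsilon>/6\<close>; the cap 1/2 keeps \<open>1 - t\<close> positive.\<close>
  define t where "t = min (1/2) (\<epsilon>/6)"
  have t: "0 < t" "t \<le> 1/2" "6 * t \<le> \<epsilon>"
    using \<open>\<epsilon> > 0\<close> by (auto simp: t_def)
  \<comment> \<open>Normalising costs twice the sum of \<open>k\<close> errors, so the means of
    \<open>h\<close> end up within \<open>t/k\<close> of \<open>1/k\<close>; this relative precision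
    \<open>t\<close> is what nonnegativity of \<open>q\<close> needs.\<close>
  define \<eta> where "\<eta> = t / (2 * (real k)\<^sup>2)"
  have \<eta>: "\<eta> > 0" "2 * k * \<eta> = t / k"
    using t k by (simp_all add: \<eta>_def power2_eq_square)
  obtain g :: "nat \<Rightarrow> real \<Rightarrow> real" where g: "\<And>i. continuous_on UNIV (g i)" "\<And>i x. g i x \<in> {0..1}"
    and gf: "\<And>i. i \<in> {1..k} \<Longrightarrow> (LINT x|leb1. \<bar>f i x - g i x\<bar>) \<le> \<eta>"
      "\<And>i. i \<in> {1..k} \<Longrightarrow> (LINT z|\<mu>. \<bar>f i (fst z) - g i (fst z)\<bar>) \<le> \<eta>"
      "\<And>i. i \<in> {1..k} \<Longrightarrow> (LINT z|\<mu>. \<bar>f i (snd z) - g i (snd z)\<bar>) \<le> \<eta>"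
    using fair_partitions_approx_continuous_L1[OF \<mu> f \<eta>(1)] by blast
  define h where "h = partition_normalize k g"
  define b where "b i = (LINT x|leb1. h i x)" for i
  \<comment> \<open>Shrinking by \<open>1 - t\<close> makes room for a nonnegative constant that
    corrects the mean. The constants sum to \<open>t\<close> because the \<open>b i\<close> sum to
    1, so the total remains 1.\<close>
  define q where "q i x = (1 - t) * h i x + (1 / k - (1 - t) * b i)" for i x
  have h_cont: "continuous_on S (h i)" for S i
    unfolding h_def by (intro continuous_partition_normalize[OF k] continuous_on_subset[OF g(1)
        subset_UNIV])
  have h_nonneg: "0 \<le> h i x" for i x
    unfolding h_def using g(2) by (intro partition_normalize_nonneg) simp
  have h_sum: "(\<Sum>i=1..k. h i x) = 1" for x
    unfolding h_def by (rule partition_normalize_sum[OF k])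
  have h_le1: "h i x \<le> 1" if "i \<in> {1..k}" for i x
    using member_le_sum[of i "{1..k}" "\<lambda>i. h i x"] that h_nonneg h_sum by simp
  have h_leb: "h i \<in> borel_measurable leb1" for i
    unfolding measurable_leb1 by (rule borel_measurable_continuous_on_restrict[OF h_cont])
  have g_leb: "g i \<in> borel_measurable leb1" for i
    unfolding measurable_leb1
    by (rule borel_measurable_continuous_on_restrict[OF continuous_on_subset[OF g(1) subset_UNIV]])
  have h_int: "integrable leb1 (h i)" if "i \<in> {1..k}" for i
    using h_nonneg h_le1[OF that] by (intro leb1_integrable[OF h_leb, where B = 1]) simp
  have hf: "\<bar>f i x - h i x\<bar> \<le> 2 * (\<Sum>j=1..k. \<bar>f j x - g j x\<bar>)" if i: "i \<in> {1..k}"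
      and x: "x \<in> unit_interval" for i x
  proof -
    have "\<bar>h i x - g i x\<bar> \<le> \<bar>(\<Sum>j=1..k. g j x) - 1\<bar>"
      unfolding h_def using g(2) by (intro partition_normalize_diff[OF i]) simp
    also have "\<dots> = \<bar>\<Sum>j=1..k. g j x - f j x\<bar>"
      using fair_partitions_sum[OF f x] by (simp add: sum_subtractf)
    also have "\<dots> \<le> (\<Sum>j=1..k. \<bar>g j x - f j x\<bar>)"
      by (rule sum_abs)
    also have "\<dots> = (\<Sum>j=1..k. \<bar>f j x - g j x\<bar>)"
      by (simp add: abs_minus_commute)
    finally have "\<bar>h i x - g i x\<bar> \<le> (\<Sum>j=1..k. \<bar>f j x - g j x\<bar>)" .
    moreover have "\<bar>f i x - g i x\<bar> \<le> (\<Sum>j=1..k. \<bar>f j x - g j x\<bar>)"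
      using i by (intro member_le_sum) simp_all
    ultimately show ?thesis by linarith
  qed
  \<comment> \<open>Stated for any probability space and map into the interval, since it is used for
    Lebesgue measure with the identity and for \<mu> with each projection.\<close>
  have transfer: "(LINT z|M. \<bar>f i (\<pi> z) - h i (\<pi> z)\<bar>) \<le> t / k \<and>
      integrable M (\<lambda>z. \<bar>f i (\<pi> z) - h i (\<pi> z)\<bar>)"
    if i: "i \<in> {1..k}" and M: "prob_space M" and \<pi>: "\<And>z. z \<in> space M \<Longrightarrow> \<pi> z \<in> unit_interval"
      and meas: "\<And>a :: real \<Rightarrow> real. a \<in> borel_measurable leb1 \<Longrightarrow> (\<lambda>z. a (\<pi> z)) \<in> borel_measurable M"
      and le: "\<And>j. j \<in> {1..k} \<Longrightarrow> (LINT z|M. \<bar>f j (\<pi> z) - g j (\<pi> z)\<bar>) \<le> \<eta>"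
    for M :: "'z measure" and \<pi> i
  proof -
    interpret prob_space M by fact
    have int_g: "integrable M (\<lambda>z. \<bar>f j (\<pi> z) - g j (\<pi> z)\<bar>)" if j: "j \<in> {1..k}" for j
    proof (rule integrable_const_bound[of _ 1])
      show "AE z in M. norm \<bar>f j (\<pi> z) - g j (\<pi> z)\<bar> \<le> 1"
      proof (rule AE_I2)
        fix z assume "z \<in> space M"
        then show "norm \<bar>f j (\<pi> z) - g j (\<pi> z)\<bar> \<le> 1"
          using fair_partitionsD(2,3)[OF f j \<pi>] g(2)[of j "\<pi> z"]
          by (simp add: abs_le_iff) (smt (verit))
      qed
      show "(\<lambda>z. \<bar>f j (\<pi> z) - g j (\<pi> z)\<bar>) \<in> borel_measurable M"
        by (intro borel_measurable_abs borel_measurable_diff meas fair_partitionsD(1)[OF f j] g_leb)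
    qed
    have int_h: "integrable M (\<lambda>z. \<bar>f i (\<pi> z) - h i (\<pi> z)\<bar>)"
    proof (rule integrable_const_bound[of _ 1])
      show "AE z in M. norm \<bar>f i (\<pi> z) - h i (\<pi> z)\<bar> \<le> 1"
      proof (rule AE_I2)
        fix z assume "z \<in> space M"
        then show "norm \<bar>f i (\<pi> z) - h i (\<pi> z)\<bar> \<le> 1"
          using fair_partitionsD(2,3)[OF f i \<pi>] h_nonneg[of i "\<pi> z"] h_le1[OF i, of "\<pi> z"]
          by (simp add: abs_le_iff) (smt (verit))
      qed
      show "(\<lambda>z. \<bar>f i (\<pi> z) - h i (\<pi> z)\<bar>) \<in> borel_measurable M"
        by (intro borel_measurable_abs borel_measurable_diff meas fair_partitionsD(1)[OF f i] h_leb)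
    qed
    have "(LINT z|M. \<bar>f i (\<pi> z) - h i (\<pi> z)\<bar>) \<le> (LINT z|M. 2 * (\<Sum>j=1..k. \<bar>f j (\<pi> z) - g j (\<pi> z)\<bar>))"
    proof (rule integral_mono[OF int_h])
      show "integrable M (\<lambda>z. 2 * (\<Sum>j=1..k. \<bar>f j (\<pi> z) - g j (\<pi> z)\<bar>))"
        by (intro integrable_mult_right Bochner_Integration.integrable_sum int_g)
    qed (intro hf[OF i] \<pi>)
    also have "\<dots> = 2 * (\<Sum>j=1..k. (LINT z|M. \<bar>f j (\<pi> z) - g j (\<pi> z)\<bar>))"
      using Bochner_Integration.integral_sum[of "{1..k}" M "\<lambda>j z. \<bar>f j (\<pi> z) - g j (\<pi> z)\<bar>", OF
          int_g] by simp
    also have "\<dots> \<le> 2 * (\<Sum>j=1..k. \<eta>)"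
      by (intro mult_left_mono sum_mono le) simp_all
    also have "\<dots> = t / k"
      using \<eta>(2) by simp
    finally show ?thesis
      using int_h by blast
  qed
  have b_close: "\<bar>b i - 1 / k\<bar> \<le> t / k" if i: "i \<in> {1..k}" for i
  proof -
    have "b i - 1 / k = (LINT x|leb1. h i x - f i x)"
      using h_int[OF i] fair_partitionsD(4,5)[OF f i] by (simp add: b_def)
    then have "\<bar>b i - 1 / k\<bar> \<le> (LINT x|leb1. \<bar>h i x - f i x\<bar>)"
      using integral_abs_bound[of leb1 "\<lambda>x. h i x - f i x"] by simp
    also have "\<dots> = (LINT x|leb1. \<bar>f i x - h i x\<bar>)"
      by (simp add: abs_minus_commute)
    also have "\<dots> \<le> t / k"
      using transfer[OF i prob_space_leb1, of "\<lambda>x. x"] gf(1) by simp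
    finally show ?thesis .
  qed
  have b01: "b i \<in> {0..1}" if i: "i \<in> {1..k}" for i
  proof -
    interpret prob_space leb1 by (rule prob_space_leb1)
    have "0 \<le> b i"
      unfolding b_def using h_nonneg by (intro integral_nonneg_AE AE_I2)
    moreover have "b i \<le> 1"
      unfolding b_def using h_le1[OF i] h_int[OF i] by (intro integral_le_const AE_I2)
    ultimately show ?thesis by simp
  qed
  have q_nonneg: "0 \<le> q i x" if i: "i \<in> {1..k}" for i x
  proof -
    \<comment> \<open>The mean exceeds \<open>1/k\<close> at most by the factor
      \<open>1 + t\<close>, and \<open>(1 - t) * (1 + t) \<le> 1\<close>.\<close>
    have "(1 - t) * b i \<le> (1 - t) * (1 / k + t / k)"
      using b_close[OF i] t by (intro mult_left_mono) (simp_all add: abs_le_iff)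
    also have "\<dots> = 1 / k - t * t / k"
      using k by (simp add: field_simps)
    also have "\<dots> \<le> 1 / k"
      by simp
    finally have "0 \<le> 1 / k - (1 - t) * b i" by simp
    moreover have "0 \<le> (1 - t) * h i x"
      using t h_nonneg by (intro mult_nonneg_nonneg) simp_all
    ultimately show ?thesis
      unfolding q_def by (rule add_nonneg_nonneg[rotated])
  qed
  have b_sum: "(\<Sum>i=1..k. b i) = 1"
  proof -
    interpret prob_space leb1 by (rule prob_space_leb1)
    have "(\<Sum>i=1..k. b i) = (LINT x|leb1. (\<Sum>i=1..k. h i x))"
      unfolding b_def by (rule Bochner_Integration.integral_sum[symmetric]) (rule h_int)
    then show ?thesis
      unfolding h_sum using prob_space by simp
  qed
  have q: "q \<in> cont_fair_partitions k"
    unfolding cont_fair_partitions_def fair_partitions_def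
  proof (intro CollectI conjI ballI)
    fix i assume i: "i \<in> {1..k}"
    show "continuous_on unit_interval (q i)"
      unfolding q_def by (intro continuous_intros h_cont)
    then show "q i \<in> borel_measurable (restrict_space borel unit_interval)"
      by (rule borel_measurable_continuous_on_restrict)
    show "0 \<le> q i x" for x
      by (rule q_nonneg[OF i])
    interpret prob_space leb1 by (rule prob_space_leb1)
    have "(LINT x|leb1. q i x) = (1 - t) * b i + (1 / k - (1 - t) * b i)"
      unfolding q_def using h_int[OF i] prob_space by (simp add: b_def)
    then show "(LINT x|leb1. q i x) = 1 / real k"
      by simp
  next
    fix x
    have "(\<Sum>i=1..k. q i x) = (1 - t) * (\<Sum>i=1..k. h i x) +
        ((\<Sum>i=1..k. 1 / k) - (1 - t) * (\<Sum>i=1..k. b i))"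
      by (simp add: q_def sum.distrib sum_subtractf sum_distrib_left)
    also have "\<dots> = 1"
      unfolding h_sum b_sum using k by simp
    finally show "(\<Sum>i=1..k. q i x) = 1" .
  qed
  have q': "q \<in> fair_partitions k"
    using q by (simp add: cont_fair_partitions_def)
  have qh: "\<bar>h i x - q i x\<bar> \<le> 2 * t" if i: "i \<in> {1..k}" for i x
  proof -
    \<comment> \<open>Both \<open>h i x\<close> and \<open>b i\<close> lie in \<open>[0,1]\<close>,
      so the first term is at most \<open>t\<close> at every point.\<close>
    have "h i x - q i x = t * (h i x - b i) + (b i - 1 / k)"
      by (simp add: q_def algebra_simps)
    also have "\<bar>\<dots>\<bar> \<le> t * \<bar>h i x - b i\<bar> + \<bar>b i - 1 / k\<bar>"
      using t abs_triangle_ineq[of "t * (h i x - b i)" "b i - 1 / k"] by (simp add: abs_mult)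
    also have "\<dots> \<le> t * 1 + t / k"
      using b01[OF i] h_nonneg[of i x] h_le1[OF i, of x] t b_close[OF i]
      by (intro add_mono mult_left_mono) (auto simp: abs_le_iff)
    also have "\<dots> \<le> 2 * t"
      using t k by (simp add: divide_le_eq)
    finally show ?thesis .
  qed
  have transfer_q: "(LINT z|\<mu>. \<bar>f i (\<pi> z) - q i (\<pi> z)\<bar>) \<le> 3 * t \<and>
      integrable \<mu> (\<lambda>z. \<bar>f i (\<pi> z) - q i (\<pi> z)\<bar>)"
    if i: "i \<in> {1..k}" and \<pi>: "\<pi> = fst \<or> \<pi> = snd" for i \<pi>
  proof -
    interpret prob_space \<mu> using \<mu> by (rule prob_measures_squareD)
    have meas: "(\<lambda>z. a (\<pi> z)) \<in> borel_measurable \<mu>" if "a \<in> borel_measurable leb1"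
        for a :: "real \<Rightarrow> real"
      using prob_measures_square_compose[OF \<mu> that] \<pi> by auto
    have range: "\<pi> z \<in> unit_interval" if "z \<in> space \<mu>" for z
      using that \<pi> by (auto simp: prob_measures_squareD(3)[OF \<mu>])
    have h: "(LINT z|\<mu>. \<bar>f i (\<pi> z) - h i (\<pi> z)\<bar>) \<le>
        t / k" "integrable \<mu> (\<lambda>z. \<bar>f i (\<pi> z) - h i (\<pi> z)\<bar>)"
      using transfer[of i \<mu> \<pi>, OF i prob_measures_squareD(1)[OF \<mu>] range meas]
        gf(2,3) \<pi> by auto
    have qm: "q i \<in> borel_measurable leb1"
      by (rule fair_partitionsD(1)[OF q' i])
    have pw: "\<bar>f i (\<pi> z) - q i (\<pi> z)\<bar> \<le> \<bar>f i (\<pi> z) - h i (\<pi> z)\<bar> + 2 * t" for z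
      using qh[OF i, of "\<pi> z"] by linarith
    have int_q: "integrable \<mu> (\<lambda>z. \<bar>f i (\<pi> z) - q i (\<pi> z)\<bar>)"
    proof (rule Bochner_Integration.integrable_bound)
      show "integrable \<mu> (\<lambda>z. \<bar>f i (\<pi> z) - h i (\<pi> z)\<bar> + 2 * t)"
        using h(2) by simp
      show "(\<lambda>z. \<bar>f i (\<pi> z) - q i (\<pi> z)\<bar>) \<in> borel_measurable \<mu>"
        by (intro borel_measurable_abs borel_measurable_diff meas fair_partitionsD(1)[OF f i] qm)
      show "AE z in \<mu>. norm \<bar>f i (\<pi> z) - q i (\<pi> z)\<bar> \<le> norm (\<bar>f i (\<pi> z) - h i (\<pi> z)\<bar> + 2 * t)"
        using pw t(1) by (intro AE_I2) simp
    qed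
    have "(LINT z|\<mu>. \<bar>f i (\<pi> z) - q i (\<pi> z)\<bar>) \<le> (LINT z|\<mu>. \<bar>f i (\<pi> z) - h i (\<pi> z)\<bar> + 2 * t)"
      by (rule integral_mono[OF int_q _ pw]) (use h(2) in simp)
    also have "\<dots> = (LINT z|\<mu>. \<bar>f i (\<pi> z) - h i (\<pi> z)\<bar>) + 2 * t"
      using h(2) prob_space by simp
    also have "\<dots> \<le> t / k + 2 * t"
      using h(1) by simp
    also have "\<dots> \<le> 3 * t"
      using t k by (simp add: divide_le_eq)
    finally show ?thesis
      using int_q by blast
  qed
  show thesis
  proof (rule that[OF q])
    fix i j assume ij: "i \<in> {1..k}" "j \<in> {1..k}"
    note fq1 = transfer_q[OF ij(1), of fst, simplified] and fq2 =
        transfer_q[OF ij(2), of snd, simplified]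
    have int: "integrable \<mu> (\<lambda>z. q i (fst z) * q j (snd z))" "integrable \<mu> (\<lambda>z. f i (fst z) * f j
        (snd z))"
      using fair_partitions_tensor(4)[OF \<mu> q' q' ij] fair_partitions_tensor(4)[OF \<mu> f f ij] by auto
    have "\<bar>quotient_matrix k q \<mu> (i, j) - quotient_matrix k f \<mu> (i, j)\<bar> =
        \<bar>LINT z|\<mu>. q i (fst z) * q j (snd z) - f i (fst z) * f j (snd z)\<bar>"
      using int by (simp only: quotient_matrix_eq[OF ij] Bochner_Integration.integral_diff)
    also have "\<dots> \<le> (LINT z|\<mu>. \<bar>q i (fst z) * q j (snd z) - f i (fst z) * f j (snd z)\<bar>)"
      by (rule integral_abs_bound)
    also have "\<dots> \<le> (LINT z|\<mu>. \<bar>f i (fst z) - q i (fst z)\<bar> + \<bar>f j (snd z) - q j (snd z)\<bar>)"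
    proof (rule integral_mono)
      show "integrable \<mu> (\<lambda>z. \<bar>q i (fst z) * q j (snd z) - f i (fst z) * f j (snd z)\<bar>)"
        using int by (intro integrable_abs Bochner_Integration.integrable_diff)
      show "integrable \<mu> (\<lambda>z. \<bar>f i (fst z) - q i (fst z)\<bar> + \<bar>f j (snd z) - q j (snd z)\<bar>)"
        using fq1 fq2 by (intro Bochner_Integration.integrable_add) blast+
      fix z assume "z \<in> space \<mu>"
      then have z: "fst z \<in> unit_interval" "snd z \<in> unit_interval"
        by (simp_all add: prob_measures_squareD(3)[OF \<mu>] mem_Times_iff)
      \<comment> \<open>Changing one factor at a time leaves a factor in \<open>[0,1]\<close>, so
        closeness in the two marginals is enough and the joint law of the coordinates does not
        enter.\<close>
      have "q i (fst z) * q j (snd z) - f i (fst z) * f j (snd z) =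
          q j (snd z) * (q i (fst z) - f i (fst z)) + f i (fst z) * (q j (snd z) - f j (snd z))"
        by (simp add: algebra_simps)
      then have "\<bar>q i (fst z) * q j (snd z) - f i (fst z) * f j (snd z)\<bar> \<le>
          \<bar>q j (snd z)\<bar> * \<bar>f i (fst z) - q i (fst z)\<bar> + \<bar>f i (fst z)\<bar> * \<bar>f j (snd z) - q j (snd z)\<bar>"
        using abs_triangle_ineq[of "q j (snd z) * (q i (fst z) - f i (fst z))" "f i (fst z) * (q j
            (snd z) - f j (snd z))"]
        by (simp only: abs_mult abs_minus_commute)
      also have "\<dots> \<le> 1 * \<bar>f i (fst z) - q i (fst z)\<bar> + 1 * \<bar>f j (snd z) - q j (snd z)\<bar>"
        using fair_partitionsD(2,3)[OF q' ij(2) z(2)] fair_partitionsD(2,3)[OF f ij(1) z(1)]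
        by (intro add_mono mult_right_mono) simp_all
      finally show "\<bar>q i (fst z) * q j (snd z) - f i (fst z) * f j (snd z)\<bar> \<le>
          \<bar>f i (fst z) - q i (fst z)\<bar> + \<bar>f j (snd z) - q j (snd z)\<bar>"
        by simp
    qed
    also have "\<dots> = (LINT z|\<mu>. \<bar>f i (fst z) - q i (fst z)\<bar>) +
        (LINT z|\<mu>. \<bar>f j (snd z) - q j (snd z)\<bar>)"
      using fq1 fq2 by (intro Bochner_Integration.integral_add) blast+
    also have "\<dots> \<le> \<epsilon>"
      using fq1 fq2 t(3) by linarith
    finally show "\<bar>quotient_matrix k q \<mu> (i, j) - quotient_matrix k f \<mu> (i, j)\<bar> \<le> \<epsilon>" .
  qed
qed

section \<open>Shapes and quotient shapes\<close>

lemma initial_topology_weak_topology: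
  "initial_topology weak_topology (\<lambda>g \<nu>. LINT z|\<nu>. g z) {g. continuous_on unit_square g}"
  unfolding weak_topology_def
  using initial_topology_generated_by[of "{g. continuous_on unit_square g}" prob_measures_square
      "\<lambda>g \<nu>. LINT z|\<nu>. g z"]
  by (simp add: continuous_on_const ex_in_conv[symmetric] exI[of _ "\<lambda>_. 0"])

lemma initial_topology_s_graphon:
  "initial_topology s_graphon_topology (\<lambda>g \<nu>. LINT z|\<nu>. g z) {g. continuous_on unit_square g}"
  unfolding s_graphon_topology_def
  by (rule initial_topology_subtopology[OF initial_topology_weak_topology])

lemma topspace_s_graphon_topology: "topspace s_graphon_topology = s_graphons"
proof -
  have "prob_measures_square \<subseteq> topspace weak_topology"
  proof
    fix \<mu> assume "\<mu> \<in> prob_measures_square"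
    then have "\<mu> \<in> {\<mu> \<in> prob_measures_square. (LINT z|\<mu>. (0::real)) \<in> UNIV}"
      by simp
    moreover have "continuous_on unit_square (\<lambda>_. 0 :: real)" "open (UNIV :: real set)"
      by simp_all
    ultimately show "\<mu> \<in> topspace weak_topology"
      unfolding weak_topology_def topology_generated_by_topspace by blast
  qed
  moreover have "s_graphons \<subseteq> prob_measures_square"
    by (auto simp: s_graphons_def)
  ultimately show ?thesis
    by (auto simp: s_graphon_topology_def)
qed

text \<open>The widest admissible transitions, used where the length \<open>2/k\<close> of the
  supports is what counts.\<close>

abbreviation std_partition :: "nat \<Rightarrow> nat \<Rightarrow> real \<Rightarrow> real" where
  "std_partition k \<equiv> trapezoid k (1 / real k)"

lemma std_partition_cont_fair: "k \<ge> 1 \<Longrightarrow> std_partition k \<in> cont_fair_partitions k"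
  by (intro trapezoid_cont_fair) simp_all

text \<open>One grid and one tolerance serve all measures. The matrix \<open>M\<close> may be any
  matrix near the quotient matrix, since it will come from a different measure.\<close>

lemma integral_determined_by_quotient_matrix:
  fixes G :: "(real \<times> real \<Rightarrow> real) set"
  assumes G: "finite G" "\<And>g. g \<in> G \<Longrightarrow> continuous_on unit_square g" and "\<epsilon> > 0"
  obtains k \<delta> where "k \<ge> 1" "\<delta> > 0"
    "\<And>\<nu> g M. \<nu> \<in> prob_measures_square \<Longrightarrow> g \<in> G \<Longrightarrow>
      (\<And>i j. i \<in> {1..k} \<Longrightarrow> j \<in> {1..k} \<Longrightarrow> \<bar>M (i, j) - quotient_matrix k (std_partition k) \<nu> (i, j)\<bar> <
          \<delta>) \<Longrightarrow>
      \<bar>block_functional k (std_partition k) g M - (LINT z|\<nu>. g z)\<bar> < \<epsilon>"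
proof -
  have "\<epsilon>/3 > 0" using \<open>\<epsilon> > 0\<close> by simp
  obtain k where k: "k \<ge> 1"
    and appr: "\<And>\<nu> g. \<nu> \<in> prob_measures_square \<Longrightarrow> g \<in> G \<Longrightarrow>
      \<bar>block_functional k (std_partition k) g (quotient_matrix k (std_partition k) \<nu>) - (LINT z|\<nu>.
          g z)\<bar> \<le> \<epsilon>/3"
    using uniform_block_approximation[OF G \<open>\<epsilon>/3 > 0\<close>] by blast
  obtain \<delta> where \<delta>: "\<delta> > 0"
    and lip: "\<And>M M' g. g \<in> G \<Longrightarrow> (\<And>i j. i \<in> {1..k} \<Longrightarrow> j \<in> {1..k} \<Longrightarrow> \<bar>M (i, j) - M' (i, j)\<bar> < \<delta>) \<Longrightarrow>
      \<bar>block_functional k (std_partition k) g M - block_functional k (std_partition k) g M'\<bar> \<le> \<epsilon>/3"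
    using block_functional_lipschitz[OF G(1) \<open>\<epsilon>/3 > 0\<close>] by blast
  show thesis
  proof (rule that[OF k \<delta>])
    fix \<nu> g M assume \<nu>: "\<nu> \<in> prob_measures_square" and g: "g \<in> G"
      and M: "\<And>i j. i \<in> {1..k} \<Longrightarrow> j \<in> {1..k} \<Longrightarrow> \<bar>M (i, j) - quotient_matrix k (std_partition k) \<nu>
          (i, j)\<bar> < \<delta>"
    show "\<bar>block_functional k (std_partition k) g M - (LINT z|\<nu>. g z)\<bar> < \<epsilon>"
      using lip[OF g, of M "quotient_matrix k (std_partition k) \<nu>", OF M] appr[OF \<nu> g] \<open>\<epsilon> > 0\<close>
          by linarith
  qed
qed

text \<open>The countable control family consists of the entries of the quotient matrices of
  standard partitions over all \<open>k\<close>, \<open>i\<close>, \<open>j\<close>: by the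
  preceding estimate finitely many of them determine any finite set of integrals up to \<epsilon>.
  They are themselves integrals of continuous tensors, so weak limits preserve them.\<close>

lemma compact_space_s_graphon_topology: "compact_space s_graphon_topology"
proof (rule initial_topology_compact_space[OF initial_topology_s_graphon,
      where E = "\<lambda>(k, i, j) \<nu>. quotient_matrix k (std_partition k) \<nu> (i, j)"])
  fix G :: "(real \<times> real \<Rightarrow> real) set" and \<epsilon> :: real
  assume G: "finite G" "G \<subseteq> {g. continuous_on unit_square g}" and "\<epsilon> > 0"
  then have G': "\<And>g. g \<in> G \<Longrightarrow> continuous_on unit_square g" and "\<epsilon>/2 > 0"
    by auto
  obtain k \<delta> where k: "k \<ge> 1" and \<delta>: "\<delta> > 0" and appr: "\<And>\<nu> g M. \<nu> \<in> prob_measures_square \<Longrightarrow> g \<in> G \<Longrightarrow>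
      (\<And>i j. i \<in> {1..k} \<Longrightarrow> j \<in> {1..k} \<Longrightarrow> \<bar>M (i, j) - quotient_matrix k (std_partition k) \<nu> (i, j)\<bar> <
          \<delta>) \<Longrightarrow>
      \<bar>block_functional k (std_partition k) g M - (LINT z|\<nu>. g z)\<bar> < \<epsilon>/2"
    using integral_determined_by_quotient_matrix[OF G(1) G' \<open>\<epsilon>/2 > 0\<close>] by blast
  define H where "H = {k} \<times> {1..k} \<times> {1..k}"
  have "\<bar>(LINT z|y. g z) - (LINT z|x. g z)\<bar> < \<epsilon>"
    if xy: "x \<in> s_graphons" "y \<in> s_graphons" and g: "g \<in> G"
      and yx: "\<forall>a\<in>H. \<bar>(case a of (k, i, j) \<Rightarrow> \<lambda>\<nu>. quotient_matrix k (std_partition k) \<nu> (i, j)) y -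
        (case a of (k, i, j) \<Rightarrow> \<lambda>\<nu>. quotient_matrix k (std_partition k) \<nu> (i, j)) x\<bar> < \<delta>" for x y g
  proof -
    define M where "M = quotient_matrix k (std_partition k) y"
    have "\<bar>block_functional k (std_partition k) g M - (LINT z|y. g z)\<bar> < \<epsilon>/2"
      using \<delta> by (intro appr[OF s_graphonsD(1)[OF xy(2)] g]) (simp add: M_def)
    moreover have "\<bar>block_functional k (std_partition k) g M - (LINT z|x. g z)\<bar> < \<epsilon>/2"
    proof (rule appr[OF s_graphonsD(1)[OF xy(1)] g])
      fix i j assume "i \<in> {1..k}" "j \<in> {1..k}"
      then have "(k, i, j) \<in> H" by (simp add: H_def)
      from bspec[OF yx this] show "\<bar>M (i, j) - quotient_matrix k (std_partition k) x (i, j)\<bar> < \<delta>"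
        by (simp add: M_def)
    qed
    ultimately show ?thesis
      by linarith
  qed
  then show "\<exists>H \<delta>. finite H \<and> \<delta> > 0 \<and>
      (\<forall>x\<in>topspace s_graphon_topology. \<forall>y\<in>topspace s_graphon_topology.
        (\<forall>a\<in>H. \<bar>(case a of (k, i, j) \<Rightarrow> \<lambda>\<nu>. quotient_matrix k (std_partition k) \<nu> (i, j)) y -
          (case a of (k, i, j) \<Rightarrow> \<lambda>\<nu>. quotient_matrix k (std_partition k) \<nu> (i, j)) x\<bar> < \<delta>) \<longrightarrow>
        (\<forall>g\<in>G. \<bar>(LINT z|y. g z) - (LINT z|x. g z)\<bar> < \<epsilon>))"
    unfolding topspace_s_graphon_topology using \<delta>
    by (intro exI[of _ H] exI[of _ \<delta>] conjI ballI impI) (simp_all add: H_def)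
next
  fix s :: "nat \<Rightarrow> (real \<times> real) measure"
  assume "\<And>n. s n \<in> topspace s_graphon_topology"
  then have s: "s n \<in> s_graphons" for n
    by (simp add: topspace_s_graphon_topology)
  obtain r \<kappa> where r: "strict_mono r" and \<kappa>: "\<kappa> \<in> prob_measures_square"
    and lim: "\<And>g :: real \<times> real \<Rightarrow> real. continuous_on unit_square g \<Longrightarrow>
       (\<lambda>n. LINT z|s (r n). g z) \<longlonglongrightarrow> (LINT z|\<kappa>. g z)"
    using prob_measures_square_seq_compact[of s] s_graphonsD(1)[OF s] by blast
  have "\<kappa> \<in> s_graphons"
  proof (rule s_graphonsI[OF \<kappa>])
    fix g :: "real \<times> real \<Rightarrow> real" assume g: "continuous_on UNIV g"
    have gQ: "continuous_on unit_square g"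
      by (rule continuous_on_subset[OF g subset_UNIV])
    have gs: "continuous_on unit_square (\<lambda>z. g (prod.swap z))"
      by (rule continuous_on_compose2[OF g continuous_on_swap subset_UNIV])
    have "(LINT z|s (r n). g (prod.swap z)) = (LINT z|s (r n). g z)" for n
      by (intro s_graphons_integral_swap[OF s] prob_measures_square_measurable_continuous[OF
          s_graphonsD(1)[OF s] gQ])
    then have "(\<lambda>n. LINT z|s (r n). g z) \<longlonglongrightarrow> (LINT z|\<kappa>. g (prod.swap z))"
      using lim[OF gs] by simp
    then show "(LINT z|\<kappa>. g (prod.swap z)) = (LINT z|\<kappa>. g z)"
      using lim[OF gQ] LIMSEQ_unique by blast
  qed
  moreover have "(\<lambda>n. quotient_matrix k (std_partition k) (s (r n)) (i, j)) \<longlonglongrightarrow>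
      quotient_matrix k (std_partition k) \<kappa> (i, j)" for k i j
  proof (cases "i \<in> {1..k} \<and> j \<in> {1..k}")
    case True
    then have ij: "i \<in> {1..k}" "j \<in> {1..k}" and "k \<ge> 1" by auto
    show ?thesis
      unfolding quotient_matrix_eq[OF ij]
      by (intro lim continuous_on_tensor[OF std_partition_cont_fair] \<open>k \<ge> 1\<close> ij)
  next
    \<comment> \<open>Outside the index range, in particular for \<open>k = 0\<close>, the entry is
      \<open>undefined\<close> for every measure and the sequence is constant.\<close>
    case False
    then show ?thesis
      by (auto simp: quotient_matrix_def)
  qed
  ultimately show "\<exists>r x. strict_mono r \<and> x \<in> topspace s_graphon_topology \<and>
      (\<forall>a. (\<lambda>n. (case a of (k, i, j) \<Rightarrow> \<lambda>\<nu>. quotient_matrix k (std_partition k) \<nu> (i, j)) (s (r n)))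
        \<longlonglongrightarrow> (case a of (k, i, j) \<Rightarrow> \<lambda>\<nu>. quotient_matrix k (std_partition k) \<nu> (i, j)) x)"
    using r by (intro exI[of _ r] exI[of _ \<kappa>]) (simp add: topspace_s_graphon_topology
        split_paired_all)
qed

lemma compactin_shape: "compactin s_graphon_topology (shape \<mu>)"
  unfolding shape_def
  by (rule closedin_compact_space[OF compact_space_s_graphon_topology closedin_closure_of])

lemma initial_topology_matrix:
  "initial_topology (matrix_topology k) (\<lambda>ij M. M ij) ({1..k} \<times> {1..k})"
  by (intro initial_topology_powertop_real) simp

text \<open>Entries are integrals of \<open>[0,1]\<close>-valued functions against a probability
  measure, so the closure stays in a compact cube.\<close>

lemma compactin_k_shape:
  assumes \<mu>: "\<mu> \<in> prob_measures_square"
  shows "compactin (matrix_topology k) (k_shape \<mu> k)"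
proof -
  define B where "B = Pi\<^sub>E ({1..k} \<times> {1..k}) (\<lambda>_. {0..1::real})"
  have comp: "compactin (matrix_topology k) B"
    unfolding B_def by (simp add: compactin_PiE)
  have closed: "closedin (matrix_topology k) B"
    unfolding B_def by (simp add: closedin_product_topology)
  have "{quotient_matrix k f \<mu> | f. f \<in> fair_partitions k} \<subseteq> B"
  proof
    fix M assume "M \<in> {quotient_matrix k f \<mu> | f. f \<in> fair_partitions k}"
    then obtain f where f: "f \<in> fair_partitions k" "M = quotient_matrix k f \<mu>" by blast
    have "M (i, j) \<in> {0..1}" if "i \<in> {1..k}" "j \<in> {1..k}" for i j
      unfolding f(2) by (rule quotient_matrix_range[OF \<mu> f(1) that])
    moreover have "M \<in> extensional ({1..k} \<times> {1..k})"
      by (simp add: f(2) quotient_matrix_def)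
    ultimately show "M \<in> B"
      unfolding B_def PiE_iff by blast
  qed
  then have "k_shape \<mu> k \<subseteq> B"
    unfolding k_shape_def by (rule closure_of_minimal[OF _ closed])
  then show ?thesis
    unfolding k_shape_def by (rule closed_compactin[OF comp _ closedin_closure_of])
qed

section \<open>Generators of the shapes and approximation by them\<close>

lemma quotient_matrix_topspace: "quotient_matrix k f \<mu> \<in> topspace (matrix_topology k)"
  by (simp add: quotient_matrix_def)

lemma quotient_matrix_in_k_shape:
  "f \<in> fair_partitions k \<Longrightarrow> quotient_matrix k f \<mu> \<in> k_shape \<mu> k"
  unfolding k_shape_def
  by (intro subsetD[OF closure_of_subset_Int] IntI quotient_matrix_topspace CollectI exI[of _ f]
      conjI refl)

lemma Phi_in_shape:
  assumes "f \<in> FDC" "\<mu> \<in> s_graphons"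
  shows "Phi f \<mu> \<in> shape \<mu>"
proof -
  have "Phi f \<mu> \<in> topspace s_graphon_topology"
    using Phi_s_graphons assms by (simp add: FDC_def topspace_s_graphon_topology)
  then show ?thesis
    unfolding shape_def using assms(1)
    by (intro subsetD[OF closure_of_subset_Int] IntI CollectI exI[of _ f] conjI refl)
qed

lemma shapeE:
  fixes G :: "(real \<times> real \<Rightarrow> real) set"
  assumes "\<nu> \<in> shape \<mu>" "finite G" "\<And>g. g \<in> G \<Longrightarrow> continuous_on unit_square g" "\<epsilon> > 0"
  obtains f where "f \<in> FDC" "\<And>g. g \<in> G \<Longrightarrow> \<bar>(LINT z|Phi f \<mu>. g z) - (LINT z|\<nu>. g z)\<bar> < \<epsilon>"
proof -
  have "\<exists>\<kappa>\<in>{Phi f \<mu> | f. f \<in> FDC}. \<kappa> \<in> topspace s_graphon_topology \<and>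
      (\<forall>g\<in>G. \<bar>(LINT z|\<kappa>. g z) - (LINT z|\<nu>. g z)\<bar> < \<epsilon>)"
    using assms(1)[unfolded shape_def initial_topology_in_closure_of[OF initial_topology_s_graphon],
        THEN conjunct2, rule_format, of G \<epsilon>] assms(2-4) by auto
  then obtain f where "f \<in> FDC" "\<forall>g\<in>G. \<bar>(LINT z|Phi f \<mu>. g z) - (LINT z|\<nu>. g z)\<bar> < \<epsilon>"
    by blast
  then show thesis
    by (intro that[of f]) simp_all
qed

text \<open>Continuous witnesses are required because block kernels must belong to
  \<open>FDC\<close>.\<close>

lemma k_shapeE:
  assumes M: "M \<in> k_shape \<mu> k" and k: "k \<ge> 1" and \<mu>: "\<mu> \<in> prob_measures_square" and "\<epsilon> > 0"
  obtains f where "f \<in> cont_fair_partitions k"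
    "\<And>i j. i \<in> {1..k} \<Longrightarrow> j \<in> {1..k} \<Longrightarrow> \<bar>quotient_matrix k f \<mu> (i, j) - M (i, j)\<bar> < \<epsilon>"
proof -
  have "\<epsilon>/2 > 0" using \<open>\<epsilon> > 0\<close> by simp
  have "\<exists>N\<in>{quotient_matrix k f \<mu> | f. f \<in> fair_partitions k}. N \<in> topspace (matrix_topology k) \<and>
      (\<forall>ij\<in>{1..k} \<times> {1..k}. \<bar>N ij - M ij\<bar> < \<epsilon>/2)"
    using M[unfolded k_shape_def initial_topology_in_closure_of[OF initial_topology_matrix],
        THEN conjunct2, rule_format, OF _ order_refl \<open>\<epsilon>/2 > 0\<close>] by simp
  then obtain f' where f': "f' \<in> fair_partitions k"
    "\<forall>ij\<in>{1..k} \<times> {1..k}. \<bar>quotient_matrix k f' \<mu> ij - M ij\<bar> < \<epsilon>/2" by blast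
  obtain f where f: "f \<in> cont_fair_partitions k"
    "\<And>i j. i \<in> {1..k} \<Longrightarrow> j \<in> {1..k} \<Longrightarrow> \<bar>quotient_matrix k f \<mu> (i, j) - quotient_matrix k f' \<mu> (i,
        j)\<bar> \<le> \<epsilon>/2"
    using quotient_matrix_approx_continuous[OF k \<mu> f'(1) \<open>\<epsilon>/2 > 0\<close>] by blast
  show thesis
  proof (rule that[OF f(1)])
    fix i j assume ij: "i \<in> {1..k}" "j \<in> {1..k}"
    have "\<bar>quotient_matrix k f' \<mu> (i, j) - M (i, j)\<bar> < \<epsilon>/2"
      using f'(2) ij by blast
    then show "\<bar>quotient_matrix k f \<mu> (i, j) - M (i, j)\<bar> < \<epsilon>"
      using f(2)[OF ij] by linarith
  qed
qed

text \<open>The route is \<nu>, a nearby \<open>Phi f \<mu>\<close>, its quotient matrix for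
  \<open>p\<close>, a nearby matrix in the \<open>k\<close>-shape of \<mu>', and the block kernel of
  a continuous partition realising that matrix up to an error. Since \<open>k\<close> and \<delta>
  depend on \<open>G\<close> and \<epsilon> alone, the one-sided statement can be used with the
  measures exchanged and for all indices.\<close>

lemma shape_close_of_k_shape_close:
  fixes G :: "(real \<times> real \<Rightarrow> real) set"
  assumes G: "finite G" "\<And>g. g \<in> G \<Longrightarrow> continuous_on unit_square g" and "\<epsilon> > 0"
  obtains k \<delta> where "k \<ge> 1" "\<delta> > 0"
    "\<And>\<mu> \<mu>' \<nu>. \<mu> \<in> s_graphons \<Longrightarrow> \<mu>' \<in> s_graphons \<Longrightarrow>
      (\<forall>M\<in>k_shape \<mu> k. \<exists>M'\<in>k_shape \<mu>' k. \<forall>ij\<in>{1..k} \<times> {1..k}. \<bar>M ij - M' ij\<bar> < \<delta>) \<Longrightarrow>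
      \<nu> \<in> shape \<mu> \<Longrightarrow> \<exists>\<kappa>\<in>shape \<mu>'. \<forall>g\<in>G. \<bar>(LINT z|\<nu>. g z) - (LINT z|\<kappa>. g z)\<bar> < \<epsilon>"
proof -
  have "\<epsilon>/2 > 0" using \<open>\<epsilon> > 0\<close> by simp
  obtain k \<delta> where k: "k \<ge> 1" and \<delta>: "\<delta> > 0" and appr: "\<And>\<nu> g M. \<nu> \<in> prob_measures_square \<Longrightarrow> g \<in> G \<Longrightarrow>
      (\<And>i j. i \<in> {1..k} \<Longrightarrow> j \<in> {1..k} \<Longrightarrow> \<bar>M (i, j) - quotient_matrix k (std_partition k) \<nu> (i, j)\<bar> <
          \<delta>) \<Longrightarrow>
      \<bar>block_functional k (std_partition k) g M - (LINT z|\<nu>. g z)\<bar> < \<epsilon>/2"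
    using integral_determined_by_quotient_matrix[OF G \<open>\<epsilon>/2 > 0\<close>] by blast
  define p where "p = std_partition k"
  have p: "p \<in> cont_fair_partitions k" and p': "p \<in> fair_partitions k"
    using std_partition_cont_fair[OF k] by (simp_all add: p_def cont_fair_partitions_def)
  show thesis
  proof (rule that[OF k])
    \<comment> \<open>One half is the distance between the \<open>k\<close>-shapes, the other the
      loss in realising \<open>M'\<close> by a continuous fair partition.\<close>
    show "\<delta>/2 > 0" using \<delta> by simp
    fix \<mu> \<mu>' \<nu> assume \<mu>: "\<mu> \<in> s_graphons" "\<mu>' \<in> s_graphons"
      and close: "\<forall>M\<in>k_shape \<mu> k. \<exists>M'\<in>k_shape \<mu>' k. \<forall>ij\<in>{1..k} \<times> {1..k}. \<bar>M ij - M' ij\<bar> < \<delta>/2"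
      and \<nu>: "\<nu> \<in> shape \<mu>"
    note P = s_graphonsD(1)[OF \<mu>(1)] s_graphonsD(1)[OF \<mu>(2)]
    obtain f where f: "f \<in> FDC"
      and f\<nu>: "\<And>g. g \<in> G \<Longrightarrow> \<bar>(LINT z|Phi f \<mu>. g z) - (LINT z|\<nu>. g z)\<bar> < \<epsilon>/2"
      using shapeE[OF \<nu> G \<open>\<epsilon>/2 > 0\<close>] by blast
    have f': "f \<in> FD"
      using f by (simp add: FDC_def)
    have "quotient_matrix k p (Phi f \<mu>) \<in> k_shape \<mu> k"
      unfolding quotient_matrix_Phi[OF f' p' P(1)]
      by (rule quotient_matrix_in_k_shape[OF partition_average_fair[OF f' p']])
    then obtain M' where M': "M' \<in> k_shape \<mu>' k"
      and MM': "\<And>i j. i \<in> {1..k} \<Longrightarrow> j \<in> {1..k} \<Longrightarrow>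
          \<bar>quotient_matrix k p (Phi f \<mu>) (i, j) - M' (i, j)\<bar> < \<delta>/2"
      using close by blast
    obtain h where h: "h \<in> cont_fair_partitions k"
      and hM': "\<And>i j. i \<in> {1..k} \<Longrightarrow> j \<in> {1..k} \<Longrightarrow> \<bar>quotient_matrix k h \<mu>' (i, j) - M' (i, j)\<bar> < \<delta>/2"
      using k_shapeE[OF M' k P(2) \<open>\<delta>/2 > 0\<close>] by blast
    define \<kappa> where "\<kappa> = Phi (block_kernel k h p) \<mu>'"
    have "\<kappa> \<in> shape \<mu>'"
      unfolding \<kappa>_def by (rule Phi_in_shape[OF block_kernel_FDC[OF k h p] \<mu>(2)])
    moreover have "\<bar>(LINT z|\<nu>. g z) - (LINT z|\<kappa>. g z)\<bar> < \<epsilon>" if g: "g \<in> G" for g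
    proof -
      have "(LINT z|\<kappa>. g z) = block_functional k p g (quotient_matrix k h \<mu>')"
        unfolding \<kappa>_def by (rule integral_Phi_block_kernel[OF k h p P(2) G(2)[OF g]])
      moreover have "\<bar>block_functional k p g (quotient_matrix k h \<mu>') - (LINT z|Phi f \<mu>. g z)\<bar> <
          \<epsilon>/2"
        unfolding p_def
      proof (rule appr[OF Phi_prob_measures_square[OF f' P(1)] g])
        fix i j assume ij: "i \<in> {1..k}" "j \<in> {1..k}"
        show "\<bar>quotient_matrix k h \<mu>' (i, j) - quotient_matrix k (std_partition k) (Phi f \<mu>) (i,
            j)\<bar> < \<delta>"
          using MM'[OF ij] hM'[OF ij] unfolding p_def by linarith
      qed
      ultimately show ?thesis
        using f\<nu>[OF g] by linarith
    qed
    ultimately show "\<exists>\<kappa>\<in>shape \<mu>'. \<forall>g\<in>G. \<bar>(LINT z|\<nu>. g z) - (LINT z|\<kappa>. g z)\<bar> < \<epsilon>"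
      by blast
  qed
qed

text \<open>The return route: \<open>M\<close> is realised by a continuous partition
  \<open>f\<close>, whose block kernel gives an element of the shape with nearly the same matrix for
  \<open>p\<close>. A nearby \<open>Phi h \<mu>'\<close> is then read off with the same
  \<open>p\<close>, which gives a matrix in the \<open>k\<close>-shape of \<mu>'.\<close>

lemma k_shape_close_of_shape_close:
  assumes k: "k \<ge> 1" and "\<epsilon> > 0"
  obtains G and \<delta> :: real where "finite G" "G \<subseteq> {g. continuous_on unit_square g}" "\<delta> > 0"
    "\<And>\<mu> \<mu>' M. \<mu> \<in> s_graphons \<Longrightarrow> \<mu>' \<in> s_graphons \<Longrightarrow>
      (\<forall>\<nu>\<in>shape \<mu>. \<exists>\<kappa>\<in>shape \<mu>'. \<forall>g\<in>G. \<bar>(LINT z|\<nu>. g z) - (LINT z|\<kappa>. g z)\<bar> < \<delta>) \<Longrightarrow>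
      M \<in> k_shape \<mu> k \<Longrightarrow> \<exists>M'\<in>k_shape \<mu>' k. \<forall>ij\<in>{1..k} \<times> {1..k}. \<bar>M ij - M' ij\<bar> < \<epsilon>"
proof -
  \<comment> \<open>Four errors of \<open>\<epsilon>/4\<close>: realising \<open>M\<close>, passing
    through the block kernel (\<open>2 * \<eta>\<close>), the distance between the shapes, and
    realising \<kappa> by a kernel.\<close>
  define \<eta> where "\<eta> = \<epsilon> / 8"
  define d where "d = min (1 / real k) (\<eta> / (2 * k))"
  have pos: "\<eta> > 0" "\<epsilon>/4 > 0" using \<open>\<epsilon> > 0\<close> by (simp_all add: \<eta>_def)
  have d: "0 < d" "d \<le> 1 / real k" and "d \<le> \<eta> / (2 * k)"
    using k pos by (simp_all add: d_def)
  then have kd: "2 * k * d \<le> \<eta>"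
    using k by (simp add: field_simps)
  define p where "p = trapezoid k d"
  have p: "p \<in> cont_fair_partitions k" and p': "p \<in> fair_partitions k"
    using trapezoid_cont_fair[OF k d] by (simp_all add: p_def cont_fair_partitions_def)
  have gram: "real k * (LINT u|leb1. p a u * p i u) \<in> {0..1}"
    "\<bar>real k * (LINT u|leb1. p a u * p i u) - (if a = i then 1 else 0)\<bar> \<le> \<eta>"
    if "a \<in> {1..k}" "i \<in> {1..k}" for a i
    using trapezoid_gram[OF k d that] kd unfolding p_def by (blast, linarith)
  \<comment> \<open>Integrals of these continuous tensors are the entries of the quotient matrix for
    \<open>p\<close>, so closeness of s-graphons on them is closeness of matrices.\<close>
  define test where "test = (\<lambda>(i, j) z. p i (fst z) * p j (snd z))"
  define G where "G = test ` ({1..k} \<times> {1..k})"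
  have test: "(LINT z|\<nu>. test (i, j) z) = quotient_matrix k p \<nu> (i, j)" "test (i, j) \<in> G"
    if "i \<in> {1..k}" "j \<in> {1..k}" for i j \<nu>
    using that by (simp_all add: test_def quotient_matrix_eq G_def image_iff)
      (force intro: bexI[of _ "(i, j)"])
  have G: "finite G" "G \<subseteq> {g. continuous_on unit_square g}"
    using continuous_on_tensor[OF p] by (auto simp: G_def test_def)
  then have G': "\<And>g. g \<in> G \<Longrightarrow> continuous_on unit_square g" by blast
  show thesis
  proof (rule that[OF G pos(2)])
    fix \<mu> \<mu>' M assume \<mu>: "\<mu> \<in> s_graphons" "\<mu>' \<in> s_graphons"
      and close: "\<forall>\<nu>\<in>shape \<mu>. \<exists>\<kappa>\<in>shape \<mu>'. \<forall>g\<in>G. \<bar>(LINT z|\<nu>. g z) - (LINT z|\<kappa>. g z)\<bar> < \<epsilon>/4"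
      and M: "M \<in> k_shape \<mu> k"
    note P = s_graphonsD(1)[OF \<mu>(1)] s_graphonsD(1)[OF \<mu>(2)]
    obtain f where f: "f \<in> cont_fair_partitions k"
      and fM: "\<And>i j. i \<in> {1..k} \<Longrightarrow> j \<in> {1..k} \<Longrightarrow> \<bar>quotient_matrix k f \<mu> (i, j) - M (i, j)\<bar> < \<epsilon>/4"
      using k_shapeE[OF M k P(1) pos(2)] by blast
    have "Phi (block_kernel k f p) \<mu> \<in> shape \<mu>"
      by (rule Phi_in_shape[OF block_kernel_FDC[OF k f p] \<mu>(1)])
    then obtain \<kappa> where \<kappa>: "\<kappa> \<in> shape \<mu>'"
      and \<kappa>g: "\<And>g. g \<in> G \<Longrightarrow> \<bar>(LINT z|Phi (block_kernel k f p) \<mu>. g z) - (LINT z|\<kappa>. g z)\<bar> < \<epsilon>/4"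
      using close by blast
    obtain h where h: "h \<in> FDC"
      and h\<kappa>: "\<And>g. g \<in> G \<Longrightarrow> \<bar>(LINT z|Phi h \<mu>'. g z) - (LINT z|\<kappa>. g z)\<bar> < \<epsilon>/4"
      using shapeE[OF \<kappa> G(1) G' pos(2)] by blast
    have h': "h \<in> FD"
      using h by (simp add: FDC_def)
    have "quotient_matrix k p (Phi h \<mu>') \<in> k_shape \<mu>' k"
      unfolding quotient_matrix_Phi[OF h' p' P(2)]
      by (rule quotient_matrix_in_k_shape[OF partition_average_fair[OF h' p']])
    moreover have "\<bar>M (i, j) - quotient_matrix k p (Phi h \<mu>') (i, j)\<bar> < \<epsilon>"
      if ij: "i \<in> {1..k}" "j \<in> {1..k}" for i j
    proof -
      have "\<bar>quotient_matrix k p (Phi (block_kernel k f p) \<mu>) (i, j) - quotient_matrix k f \<mu> (i,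
          j)\<bar> \<le> 2 * \<eta>"
        by (rule quotient_matrix_Phi_block_kernel[OF k f p P(1) gram ij])
      moreover have "2 * \<eta> = \<epsilon>/4"
        by (simp add: \<eta>_def)
      ultimately show ?thesis
        using fM[OF ij] \<kappa>g[OF test(2)[OF ij]] h\<kappa>[OF test(2)[OF ij]]
        unfolding test(1)[OF ij] by linarith
    qed
    ultimately show "\<exists>M'\<in>k_shape \<mu>' k. \<forall>ij\<in>{1..k} \<times> {1..k}. \<bar>M ij - M' ij\<bar> < \<epsilon>"
      by blast
  qed
qed

theorem theorem1:
  fixes \<mu> :: "(real \<times> real) measure"
    and \<mu>s :: "nat \<Rightarrow> (real \<times> real) measure"
  assumes "\<mu> \<in> s_graphons"
    and "\<And>n. n \<ge> 1 \<Longrightarrow> \<mu>s n \<in> s_graphons"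
  shows "(\<forall>k\<ge>1. limitin (vietoris (matrix_topology k)) (\<lambda>n. k_shape (\<mu>s n) k) (k_shape \<mu> k)
      sequentially)
    \<longleftrightarrow> limitin (vietoris s_graphon_topology) (\<lambda>n. shape (\<mu>s n)) (shape \<mu>) sequentially"
proof -
  \<comment> \<open>The sequence starts at index 1 and its value at 0 is unconstrained, so
    membership is known only eventually.\<close>
  have \<mu>s: "\<forall>\<^sub>F n in sequentially. \<mu>s n \<in> s_graphons"
    using eventually_ge_at_top[of 1] by (rule eventually_mono) (rule assms(2))
  have "\<forall>\<^sub>F n in sequentially. compactin (matrix_topology k) (k_shape (\<mu>s n) k)" for k
    using \<mu>s by (rule eventually_mono) (intro compactin_k_shape s_graphonsD)
  note lim_k = limitin_vietoris_iff[OF initial_topology_matrix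
      compactin_k_shape[OF s_graphonsD(1)[OF assms(1)]] this]
  have "\<forall>\<^sub>F n in sequentially. compactin s_graphon_topology (shape (\<mu>s n))"
    by (simp add: compactin_shape)
  note lim_shape = limitin_vietoris_iff[OF initial_topology_s_graphon compactin_shape this]
  show ?thesis
  proof
    assume L: "\<forall>k\<ge>1. limitin (vietoris (matrix_topology k)) (\<lambda>n. k_shape (\<mu>s n) k) (k_shape \<mu> k)
        sequentially"
    show "limitin (vietoris s_graphon_topology) (\<lambda>n. shape (\<mu>s n)) (shape \<mu>) sequentially"
      unfolding lim_shape
    proof (intro allI impI)
      fix G :: "(real \<times> real \<Rightarrow> real) set" and \<epsilon> :: real
      assume G: "finite G" "G \<subseteq> {g. continuous_on unit_square g}" and "\<epsilon> > 0"
      then have G': "\<And>g. g \<in> G \<Longrightarrow> continuous_on unit_square g" by blast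
      obtain k \<delta> where k: "k \<ge> 1" and \<delta>: "\<delta> > 0"
        and transfer: "\<And>\<mu> \<mu>' \<nu>. \<mu> \<in> s_graphons \<Longrightarrow> \<mu>' \<in> s_graphons \<Longrightarrow>
          (\<forall>M\<in>k_shape \<mu> k. \<exists>M'\<in>k_shape \<mu>' k. \<forall>ij\<in>{1..k} \<times> {1..k}. \<bar>M ij - M' ij\<bar> < \<delta>) \<Longrightarrow>
          \<nu> \<in> shape \<mu> \<Longrightarrow> \<exists>\<kappa>\<in>shape \<mu>'. \<forall>g\<in>G. \<bar>(LINT z|\<nu>. g z) - (LINT z|\<kappa>. g z)\<bar> < \<epsilon>"
        using shape_close_of_k_shape_close[OF G(1) G' \<open>\<epsilon> > 0\<close>] by blast
      have "\<forall>\<^sub>F n in sequentially.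
          (\<forall>x\<in>k_shape (\<mu>s n) k. \<exists>y\<in>k_shape \<mu> k. \<forall>ij\<in>{1..k} \<times> {1..k}. \<bar>x ij - y ij\<bar> < \<delta>) \<and>
          (\<forall>y\<in>k_shape \<mu> k. \<exists>x\<in>k_shape (\<mu>s n) k. \<forall>ij\<in>{1..k} \<times> {1..k}. \<bar>x ij - y ij\<bar> < \<delta>)"
        using L[rule_format, OF k, unfolded lim_k, rule_format, OF _ order_refl \<delta>] by simp
      with \<mu>s show "\<forall>\<^sub>F n in sequentially.
          (\<forall>x\<in>shape (\<mu>s n). \<exists>y\<in>shape \<mu>. \<forall>g\<in>G. \<bar>(LINT z|x. g z) - (LINT z|y. g z)\<bar> < \<epsilon>) \<and>
          (\<forall>y\<in>shape \<mu>. \<exists>x\<in>shape (\<mu>s n). \<forall>g\<in>G. \<bar>(LINT z|x. g z) - (LINT z|y. g z)\<bar> < \<epsilon>)"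
      proof eventually_elim
        case (elim n)
        then have "\<forall>y\<in>k_shape \<mu> k. \<exists>x\<in>k_shape (\<mu>s n) k. \<forall>ij\<in>{1..k} \<times> {1..k}. \<bar>y ij - x ij\<bar> < \<delta>"
          by (simp add: abs_minus_commute)
        \<comment> \<open>Each half of the Hausdorff condition is the one-sided transfer, with \<mu>
          and \<open>\<mu>s n\<close> in exchanged roles.\<close>
        from transfer[OF assms(1) elim(1) this] transfer[OF elim(1) assms(1)] elim(2)
        show ?case
          by (simp add: abs_minus_commute)
      qed
    qed
  next
    assume L: "limitin (vietoris s_graphon_topology) (\<lambda>n. shape (\<mu>s n)) (shape \<mu>) sequentially"
    show "\<forall>k\<ge>1. limitin (vietoris (matrix_topology k)) (\<lambda>n. k_shape (\<mu>s n) k) (k_shape \<mu> k)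
        sequentially"
      unfolding lim_k
    proof (intro allI impI)
      fix k :: nat and I :: "(nat \<times> nat) set" and \<epsilon> :: real
      assume k: "k \<ge> 1" and I: "finite I" "I \<subseteq> {1..k} \<times> {1..k}" and "\<epsilon> > 0"
      obtain G and \<delta> :: real where G: "finite G" "G \<subseteq> {g. continuous_on unit_square g}"
          and \<delta>: "\<delta> > 0"
        and transfer: "\<And>\<mu> \<mu>' M. \<mu> \<in> s_graphons \<Longrightarrow> \<mu>' \<in> s_graphons \<Longrightarrow>
          (\<forall>\<nu>\<in>shape \<mu>. \<exists>\<kappa>\<in>shape \<mu>'. \<forall>g\<in>G. \<bar>(LINT z|\<nu>. g z) - (LINT z|\<kappa>. g z)\<bar> < \<delta>) \<Longrightarrow>
          M \<in> k_shape \<mu> k \<Longrightarrow> \<exists>M'\<in>k_shape \<mu>' k. \<forall>ij\<in>{1..k} \<times> {1..k}. \<bar>M ij - M' ij\<bar> < \<epsilon>"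
        using k_shape_close_of_shape_close[OF k \<open>\<epsilon> > 0\<close>] by blast
      from \<mu>s L[unfolded lim_shape, rule_format, OF G \<delta>]
      show "\<forall>\<^sub>F n in sequentially.
          (\<forall>x\<in>k_shape (\<mu>s n) k. \<exists>y\<in>k_shape \<mu> k. \<forall>ij\<in>I. \<bar>x ij - y ij\<bar> < \<epsilon>) \<and>
          (\<forall>y\<in>k_shape \<mu> k. \<exists>x\<in>k_shape (\<mu>s n) k. \<forall>ij\<in>I. \<bar>x ij - y ij\<bar> < \<epsilon>)"
      proof eventually_elim
        case (elim n)
        then have "\<forall>y\<in>shape \<mu>. \<exists>x\<in>shape (\<mu>s n). \<forall>g\<in>G. \<bar>(LINT z|y. g z) - (LINT z|x. g z)\<bar> < \<delta>"
          by (simp add: abs_minus_commute)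
        have "\<exists>x\<in>k_shape (\<mu>s n) k. \<forall>ij\<in>I. \<bar>x ij - y ij\<bar> < \<epsilon>" if y: "y \<in> k_shape \<mu> k" for y
        proof -
          obtain x where x: "x \<in> k_shape (\<mu>s n) k" "\<forall>ij\<in>{1..k} \<times> {1..k}. \<bar>y ij - x ij\<bar> < \<epsilon>"
            using transfer[OF assms(1) elim(1) \<open>\<forall>y\<in>shape \<mu>. _\<close> y] by blast
          have "\<bar>x ij - y ij\<bar> < \<epsilon>" if "ij \<in> I" for ij
            using x(2) that I(2) by (subst abs_minus_commute) blast
          with x(1) show ?thesis by blast
        qed
        moreover have "\<forall>x\<in>k_shape (\<mu>s n) k. \<exists>y\<in>k_shape \<mu> k. \<forall>ij\<in>I. \<bar>x ij - y ij\<bar> < \<epsilon>"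
          using transfer[OF elim(1) assms(1)] elim(2) I(2) by blast
        ultimately show ?case by blast
      qed
    qed
  qed
qed

end
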